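(* Let $q=q(n)$ satisfy $nq(n)\gg\log n$. Then for any sequence $(G_n)_{n\in\mathbb{N}}$ of $n$-vertex graphs which is weakly $q$-pseudorandom, we have $\lim_{n\to\infty}p_{1,c}(\mathbb{Z}^2\times G_n)=4-2\sqrt{3}$.
   Context: A sequence $(G_n)$ of $n$-vertex graphs is weakly $q$-pseudorandom if $\max\{|e(G_n[U])-q|U|^2/2|:\ U\subseteq V(G_n)\}=o(qn^2)$, where $e(G_n[U])$ is the number of edges of the induced subgraph on $U$. For a graph $H$, a random graph model on $H$ is a probability measure $\mu$ on subsets of $E(H)$; $\mathbf{H}_\mu$ denotes the resulting random spanning subgraph. $\mu$ is $1$-independent if for all sets $A,B\subseteq E(H)$ whose edges span disjoint vertex sets, $E(\mathbf{H}_\mu)\cap A$ and $E(\mathbf{H}_\mu)\cap B$ are independent. $\mathcal{M}_{1,\geq p}(H)$ is the set of $1$-independent measures on $H$ in which each edge is present with probability at least $p$. $\mu$ percolates if $\mathbf{H}_\mu$ almost surely contains an infinite connected component, and $p_{1,c}(H)=\inf\{p\ge0:\ \text{every }\mu\in\mathcal{M}_{1,\geq p}(H)\text{ percolates}\}$. $\mathbb{Z}^2$ is the square integer lattice and $\times$ is the Cartesian product of graphs (vertices $(v_1,v_2)$, with $(u_1,u_2)\sim(v_1,v_2)$ iff either $u_1=v_1$ and $u_2v_2$ is an edge of the second factor, or $u_1v_1$ is an edge of the first factor and $u_2=v_2$). *)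

theory Defs
  imports "HOL-Probability.Probability" "HOL-Library.Landau_Symbols"
begin

text \<open>A graph is represented by its edge set: a set of 2-element vertex sets.
  A random graph model on H is a probability measure on subsets of E(H),
  with the product (cylinder) sigma-algebra generated by the events "e is present".\<close>

definition edge_event :: "'v set set \<Rightarrow> 'v set \<Rightarrow> 'v set set set" where
  "edge_event E e = {S \<in> Pow E. e \<in> S}"

definition edge_space :: "'v set set \<Rightarrow> 'v set set measure" where
  "edge_space E = sigma (Pow E) (edge_event E ` E)"

definition cyl_events :: "'v set set \<Rightarrow> 'v set set \<Rightarrow> 'v set set set set" where
  "cyl_events E A = sigma_sets (Pow E) (edge_event E ` A)"

definition one_independent :: "'v set set \<Rightarrow> 'v set set measure \<Rightarrow> bool" where
  "one_independent E \<mu> \<longleftrightarrow>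
     (\<forall>A B. A \<subseteq> E \<longrightarrow> B \<subseteq> E \<longrightarrow> \<Union>A \<inter> \<Union>B = {} \<longrightarrow>
        prob_space.indep_set \<mu> (cyl_events E A) (cyl_events E B))"

definition models_ge :: "'v set set \<Rightarrow> real \<Rightarrow> 'v set set measure set" where
  "models_ge E p = {\<mu>. prob_space \<mu> \<and> space \<mu> = Pow E \<and> sets \<mu> = sets (edge_space E) \<and>
      one_independent E \<mu> \<and> (\<forall>e\<in>E. p \<le> measure \<mu> (edge_event E e))}"

definition adj :: "'v set set \<Rightarrow> ('v \<times> 'v) set" where
  "adj S = {(x, y). {x, y} \<in> S}"

definition has_infinite_component :: "'v set set \<Rightarrow> bool" where
  "has_infinite_component S \<longleftrightarrow> (\<exists>v. infinite ((adj S)\<^sup>* `` {v}))"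

definition percolates :: "'v set set measure \<Rightarrow> bool" where
  "percolates \<mu> \<longleftrightarrow> (AE S in \<mu>. has_infinite_component S)"

definition p1c :: "'v set set \<Rightarrow> real" where
  "p1c E = Inf {p. 0 \<le> p \<and> (\<forall>\<mu>\<in>models_ge E p. percolates \<mu>)}"

definition Z2_edges :: "(int \<times> int) set set" where
  "Z2_edges = {{u, v} | u v. \<bar>fst u - fst v\<bar> + \<bar>snd u - snd v\<bar> = 1}"

definition cart_prod :: "'a set \<Rightarrow> 'a set set \<Rightarrow> 'b set \<Rightarrow> 'b set set \<Rightarrow> ('a \<times> 'b) set set" where
  "cart_prod V1 E1 V2 E2 =
     {{(u, x), (v, x)} | u v x. {u, v} \<in> E1 \<and> x \<in> V2} \<union>
     {{(u, x), (u, y)} | u x y. u \<in> V1 \<and> {x, y} \<in> E2}"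

definition graph_on :: "nat \<Rightarrow> nat set set \<Rightarrow> bool" where
  "graph_on n E \<longleftrightarrow> E \<subseteq> {{x, y} | x y. x \<noteq> y \<and> x < n \<and> y < n}"

definition weakly_pseudorandom :: "(nat \<Rightarrow> real) \<Rightarrow> (nat \<Rightarrow> nat set set) \<Rightarrow> bool" where
  "weakly_pseudorandom q G \<longleftrightarrow>
     (\<lambda>n. Max ((\<lambda>U. \<bar>real (card {e \<in> G n. e \<subseteq> U}) - q n * real (card U) ^ 2 / 2\<bar>)
                 ` Pow {..<n}))
     \<in> o(\<lambda>n. q n * real n ^ 2)"

end

theory Submission
  imports Defs
begin

text \<open>
  Lower bound. Write every level of the sup-norm on the square lattice as \<open>3k\<close>, \<open>3k+1\<close> or \<open>3k+2\<close>. Vertices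
  on levels \<open>3k+1\<close> independently choose, with probabilities \<open>\<theta> = (3 - sqrt 3)/2\<close> and \<open>1 - \<theta>\<close>, to side with
  the region inside or the region outside; vertices on levels \<open>3k+2\<close> independently become, with probability
  \<open>2 - sqrt 3\<close>, pendant to their unique neighbour one level below. Since \<open>\<theta>\<^sup>2 + (1-\<theta>)\<^sup>2 = 4 - 2 sqrt 3\<close>,
  all edges can be made this likely although every component stays within one of these bounded regions.

  Upper bound. By renormalisation it suffices that for \<open>p > 4 - 2 sqrt 3\<close> two adjacent copies of \<open>G\<close>
  are joined, with probability close to 1, by a component that contains more than half of a fixed set in each copy.
  Counting edges, each copy contains a robust giant; call blue what is connected to the giant of the second copy.
  Suppose that the two giants are rarely connected. By monotonicity and averaging there is a scale at which the
  set of blue vertices hardly grows, so that for a test vertex \<open>x\<close> the blueness of its two copies can be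
  decided from disjoint, hence independent, parts of the graph. Non-blue vertices of substantial non-blue
  degree are called red. Counting open edges, the frequencies \<open>r\<close>, \<open>b\<close> of red and blue in a copy satisfy
  \<open>r\<^sup>2 + b\<^sup>2 \<ge> p\<close>. The vertical edge at \<open>x\<close> can almost never be open if one copy of \<open>x\<close> is red and
  the other blue, as this would turn many vertices blue, whence \<open>r\<^sub>1 b\<^sub>2 + b\<^sub>1 r\<^sub>2 \<le> 1 - p\<close>.
  Both inequalities are compatible only for \<open>p \<le> 4 - 2 sqrt 3\<close>. Averages over several outcomes lie in a convex
  hull, on which the bilinear form is still minimal at the extreme points \<open>(sqrt p, 0)\<close> and \<open>(\<theta>, 1-\<theta>)\<close>.
  Disjoint parts of the graph being independent, a positive probability of joining the giants is
  amplified to a probability close to 1.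
\<close>


section \<open>Events local to a finite set of vertices\<close>

text \<open>The extreme points of the upper bound are the two random levels of the lower bound. On
  levels \<open>3k+2\<close> a vertex joins the outer region with probability
  \<open>sqrt 3 - 1 = sqrt p\<close> and is otherwise pendant, thus of neither colour; on levels
  \<open>3k+1\<close> both regions occur, with probabilities \<open>\<theta>\<close> and
  \<open>1 - \<theta>\<close>. An edge between the two levels is closed with probability
  \<open>sqrt p * \<theta> = 2 * sqrt 3 - 3 = 1 - p\<close>, so the bilinear bound is attained and
  the two bounds meet. Two limitations shape the upper bound. 1-independence yields only second
  moments: edges may be correlated whenever they share a vertex, and Chebyshev gives failure
  probabilities of order \<open>1 / (q m)\<close> for sets of size comparable to \<open>m\<close>.
  Weak pseudorandomness controls edge counts of large sets but no single degree. Hence the vertices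
  are cut into a bounded number of cells of linear size, the notions are phrased through majorities
  and edge counts, and all constants are fixed before the graph.\<close>

definition dep :: "'v set \<Rightarrow> ('v set set \<Rightarrow> bool) \<Rightarrow> bool" where
  "dep W P \<longleftrightarrow> (\<forall>S S'. {e \<in> S. e \<subseteq> W} = {e \<in> S'. e \<subseteq> W} \<longrightarrow> P S = P S')"

lemma dep_mono:
  assumes "dep W P" "W \<subseteq> W'"
  shows "dep W' P"
  unfolding dep_def
proof (intro allI impI)
  fix S S' :: "'a set set"
  assume "{e \<in> S. e \<subseteq> W'} = {e \<in> S'. e \<subseteq> W'}"
  then have "{e \<in> S. e \<subseteq> W} = {e \<in> S'. e \<subseteq> W}" using assms(2) by blast
  then show "P S = P S'" using assms(1) unfolding dep_def by blast
qed

lemma depI: "(\<And>S S'. {e \<in> S. e \<subseteq> W} = {e \<in> S'. e \<subseteq> W} \<Longrightarrow> P S = P S') \<Longrightarrow> dep W P"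
  unfolding dep_def by blast

lemma depD: "dep W P \<Longrightarrow> {e \<in> S. e \<subseteq> W} = {e \<in> S'. e \<subseteq> W} \<Longrightarrow> P S = P S'"
  unfolding dep_def by blast

lemma dep_restrict: "dep W (\<lambda>S. Q {e \<in> S. e \<subseteq> W})"
  by (rule depI) (rule arg_cong)

lemma dep_const: "dep W (\<lambda>S. c)"
  by (rule depI) (rule refl)

lemma dep_mem: "e \<subseteq> W \<Longrightarrow> dep W (\<lambda>S. e \<in> S)"
  unfolding dep_def by blast

lemma dep_not:
  assumes "dep W P"
  shows "dep W (\<lambda>S. \<not> P S)"
  by (rule depI) (use depD[OF assms] in metis)

lemma dep_conj:
  assumes "dep W P" "dep W Q"
  shows "dep W (\<lambda>S. P S \<and> Q S)"
  by (rule depI) (use depD[OF assms(1)] depD[OF assms(2)] in metis)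

lemma dep_disj:
  assumes "dep W P" "dep W Q"
  shows "dep W (\<lambda>S. P S \<or> Q S)"
  by (rule depI) (use depD[OF assms(1)] depD[OF assms(2)] in metis)

lemma dep_ex:
  assumes "\<And>x. dep W (P x)"
  shows "dep W (\<lambda>S. \<exists>x. P x S)"
  by (rule depI) (use depD[OF assms] in metis)

lemma dep_all:
  assumes "\<And>x. dep W (P x)"
  shows "dep W (\<lambda>S. \<forall>x. P x S)"
  by (rule depI) (use depD[OF assms] in metis)

lemma dep_imp: "(A \<Longrightarrow> dep W P) \<Longrightarrow> dep W (\<lambda>S. A \<longrightarrow> P S)"
  by (cases A) (auto intro: dep_const)

lemma dep_guard: "(A \<Longrightarrow> dep W P) \<Longrightarrow> dep W (\<lambda>S. A \<and> P S)"
  by (cases A) (auto intro: dep_const)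

lemma dep_Collect:
  assumes "\<And>x. dep W (P x)"
  shows "dep W (\<lambda>S. Q {x. P x S})"
proof (rule depI)
  fix S S'
  assume "{e \<in> S. e \<subseteq> W} = {e \<in> S'. e \<subseteq> W}"
  then have "P x S = P x S'" for x by (rule depD[OF assms])
  then show "Q {x. P x S} = Q {x. P x S'}" by simp
qed

text \<open>Only finitely many edges lie inside \<open>W\<close>, so the event is a finite union of
  atoms that prescribe the trace of \<open>S\<close> on them. Thus naming a finite vertex set on
  which a predicate depends settles measurability and, for disjoint sets, independence.\<close>

lemma dep_cyl:
  assumes "finite W" "dep W P"
  shows "{S \<in> Pow E. P S} \<in> cyl_events E {e \<in> E. e \<subseteq> W}"
proof -
  let ?A = "{e \<in> E. e \<subseteq> W}"
  have sub: "edge_event E ` ?A \<subseteq> Pow (Pow E)" by (auto simp: edge_event_def)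
  interpret sigma_algebra "Pow E" "sigma_sets (Pow E) (edge_event E ` ?A)"
    using sub by (rule sigma_algebra_sigma_sets)
  have finA: "finite ?A" using assms(1) by (intro finite_subset[of ?A "Pow W"]) auto
  have ev: "edge_event E e \<in> sigma_sets (Pow E) (edge_event E ` ?A)" if "e \<in> ?A" for e
    using that by (intro sigma_sets.Basic imageI)
  have atom: "{S \<in> Pow E. S \<inter> A = T} \<in> sigma_sets (Pow E) (edge_event E ` ?A)"
    if "A \<subseteq> ?A" "T \<subseteq> A" for A T
  proof -
    have "finite A" using that(1) finA finite_subset by blast
    have "A \<subseteq> ?A \<longrightarrow> {S \<in> Pow E. S \<inter> A = T \<inter> A} \<in> sigma_sets (Pow E) (edge_event E ` ?A)"
      using \<open>finite A\<close>
    proof (induction A)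
      case empty
      have "{S \<in> Pow E. S \<inter> {} = T \<inter> {}} = Pow E" by auto
      then show ?case using top by auto
    next
      case (insert e A)
      show ?case
      proof
        assume ins: "insert e A \<subseteq> ?A"
        have 1: "{S \<in> Pow E. S \<inter> insert e A = T \<inter> insert e A}
          = {S \<in> Pow E. S \<inter> A = T \<inter> A} \<inter> (if e \<in> T then edge_event E e else Pow E - edge_event E e)"
          unfolding edge_event_def by auto
        have 2: "(if e \<in> T then edge_event E e else Pow E - edge_event E e) \<in> sigma_sets (Pow E) (edge_event E ` ?A)"
          using ev[of e] ins by auto
        show "{S \<in> Pow E. S \<inter> insert e A = T \<inter> insert e A} \<in> sigma_sets (Pow E) (edge_event E ` ?A)"
          unfolding 1 using insert 2 ins by blast
      qed
    qed
    moreover have "T \<inter> A = T" using that by auto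
    ultimately show ?thesis using that by auto
  qed
  have PA: "P S = P (S \<inter> ?A)" if "S \<subseteq> E" for S
  proof -
    have "{e \<in> S. e \<subseteq> W} = {e \<in> S \<inter> ?A. e \<subseteq> W}" using that by auto
    then show ?thesis using assms(2) unfolding dep_def by blast
  qed
  have eq: "{S \<in> Pow E. P S} = (\<Union>T\<in>{T. T \<subseteq> ?A \<and> P T}. {S \<in> Pow E. S \<inter> ?A = T})"
  proof (intro equalityI subsetI)
    fix S assume "S \<in> {S \<in> Pow E. P S}"
    then show "S \<in> (\<Union>T\<in>{T. T \<subseteq> ?A \<and> P T}. {S \<in> Pow E. S \<inter> ?A = T})"
      using PA[of S] by (intro UN_I[of "S \<inter> ?A"]) auto
  next
    fix S assume "S \<in> (\<Union>T\<in>{T. T \<subseteq> ?A \<and> P T}. {S \<in> Pow E. S \<inter> ?A = T})"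
    then have "S \<subseteq> E" "P (S \<inter> ?A)" by auto
    then show "S \<in> {S \<in> Pow E. P S}" using PA[of S] by auto
  qed
  show ?thesis
    unfolding cyl_events_def eq
    by (rule finite_UN) (use finA atom in auto)
qed

section \<open>Probabilities and second moments under a 1-independent measure\<close>

locale model =
  fixes E :: "'v set set" and p :: real and \<mu> :: "'v set set measure"
  assumes model: "\<mu> \<in> models_ge E p"
begin

sublocale prob_space \<mu> using model by (simp add: models_ge_def)

lemma space_eq: "space \<mu> = Pow E" using model by (simp add: models_ge_def)

definition pr :: "('v set set \<Rightarrow> bool) \<Rightarrow> real" where
  "pr P = prob {S \<in> Pow E. P S}"

lemma cyl_sub: "A \<subseteq> E \<Longrightarrow> cyl_events E A \<subseteq> events"
proof -
  assume A: "A \<subseteq> E"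
  have "events = sigma_sets (Pow E) (edge_event E ` E)"
    using model unfolding models_ge_def edge_space_def
    by (subst (asm) sets_measure_of) (auto simp: edge_event_def)
  then show ?thesis unfolding cyl_events_def using A
    by (metis image_mono sigma_sets_mono')
qed

lemma dep_event: "finite W \<Longrightarrow> dep W P \<Longrightarrow> {S \<in> Pow E. P S} \<in> events"
  using dep_cyl[of W P E] cyl_sub[of "{e \<in> E. e \<subseteq> W}"] by blast

lemma pr_indep:
  assumes "finite W" "finite W'" "W \<inter> W' = {}" "dep W P" "dep W' Q"
  shows "pr (\<lambda>S. P S \<and> Q S) = pr P * pr Q"
proof -
  let ?A = "{e \<in> E. e \<subseteq> W}" and ?B = "{e \<in> E. e \<subseteq> W'}"
  have "\<Union>?A \<inter> \<Union>?B = {}" using assms(3) by blast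
  then have "indep_set (cyl_events E ?A) (cyl_events E ?B)"
    using model unfolding models_ge_def one_independent_def by auto
  then have "prob ({S \<in> Pow E. P S} \<inter> {S \<in> Pow E. Q S}) = prob {S \<in> Pow E. P S} * prob {S \<in> Pow E. Q S}"
    by (rule indep_setD) (use dep_cyl assms in auto)
  moreover have "{S \<in> Pow E. P S} \<inter> {S \<in> Pow E. Q S} = {S \<in> Pow E. P S \<and> Q S}" by auto
  ultimately show ?thesis by (simp add: pr_def)
qed

lemma pr_nonneg: "0 \<le> pr P" by (simp add: pr_def)
lemma pr_le1: "pr P \<le> 1" by (simp add: pr_def)

lemma pr_cong: "(\<And>S. S \<subseteq> E \<Longrightarrow> P S = Q S) \<Longrightarrow> pr P = pr Q"
  unfolding pr_def by (metis (mono_tags, lifting) Collect_cong Pow_iff)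

lemma pr_mono:
  assumes "finite W" "dep W Q" "\<And>S. S \<subseteq> E \<Longrightarrow> P S \<Longrightarrow> Q S"
  shows "pr P \<le> pr Q"
  unfolding pr_def by (rule finite_measure_mono) (use assms dep_event in auto)

lemma pr_not:
  assumes "finite W" "dep W P"
  shows "pr (\<lambda>S. \<not> P S) = 1 - pr P"
proof -
  have "{S \<in> Pow E. \<not> P S} = space \<mu> - {S \<in> Pow E. P S}" by (auto simp: space_eq)
  then show ?thesis unfolding pr_def using prob_compl[OF dep_event[OF assms]] by simp
qed

lemma pr_disj_le:
  assumes "finite W" "dep W P" "dep W Q"
  shows "pr (\<lambda>S. P S \<or> Q S) \<le> pr P + pr Q"
proof -
  have "{S \<in> Pow E. P S \<or> Q S} = {S \<in> Pow E. P S} \<union> {S \<in> Pow E. Q S}" by auto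
  then show ?thesis unfolding pr_def
    using measure_Un_le[OF dep_event[OF assms(1,2)] dep_event[OF assms(1,3)]] by simp
qed

lemma pr_Bex_le:
  assumes "finite I" "finite W" "\<And>i. i \<in> I \<Longrightarrow> dep W (P i)"
  shows "pr (\<lambda>S. \<exists>i\<in>I. P i S) \<le> (\<Sum>i\<in>I. pr (P i))"
proof -
  have "{S \<in> Pow E. \<exists>i\<in>I. P i S} = (\<Union>i\<in>I. {S \<in> Pow E. P i S})" by auto
  then show ?thesis unfolding pr_def
    using finite_measure_subadditive_finite[OF assms(1), of "\<lambda>i. {S \<in> Pow E. P i S}"]
      dep_event[OF assms(2)] assms(3) by (simp add: image_subset_iff)
qed

lemma pr_edge: "e \<in> E \<Longrightarrow> p \<le> pr (\<lambda>S. e \<in> S)"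
  using model unfolding models_ge_def edge_event_def pr_def by auto

lemma int_ind:
  assumes "finite W" "dep W P"
  shows "integrable \<mu> (\<lambda>S. of_bool (P S) :: real)" "expectation (\<lambda>S. of_bool (P S)) = pr P"
proof -
  have eq: "(of_bool (P S) :: real) = indicator {S \<in> Pow E. P S} S" if "S \<in> space \<mu>" for S
    using that by (auto simp: space_eq indicator_def)
  have ev: "{S \<in> Pow E. P S} \<in> events" using dep_event assms by blast
  have "integrable \<mu> (indicator {S \<in> Pow E. P S} :: _ \<Rightarrow> real)" using ev by (simp add: emeasure_eq_measure)
  then show "integrable \<mu> (\<lambda>S. of_bool (P S) :: real)"
    using Bochner_Integration.integrable_cong[of \<mu> \<mu> "\<lambda>S. of_bool (P S) :: real" "indicator {S \<in> Pow E. P S}"] eq by simp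
  have "expectation (\<lambda>S. of_bool (P S)) = expectation (indicat_real {S \<in> Pow E. P S})"
    using Bochner_Integration.integral_cong[OF refl, of \<mu> "\<lambda>S. of_bool (P S) :: real" "indicator {S \<in> Pow E. P S}"] eq
    by blast
  also have "\<dots> = pr P" unfolding pr_def using ev by simp
  finally show "expectation (\<lambda>S. of_bool (P S)) = pr P" .
qed

text \<open>Vertex-disjoint edges are uncorrelated, and every other pair adds at most 1 to the
  variance, which is therefore at most \<open>D\<close>. Edge probabilities may exceed
  \<open>p\<close>, so only the lower tail is controlled.\<close>

lemma Chebyshev_edges:
  assumes "F \<subseteq> E" "finite (\<Union>F)" "finite F"
    and D: "real (card {(e, e'). e \<in> F \<and> e' \<in> F \<and> e \<inter> e' \<noteq> {}}) \<le> D" and "0 < a"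
  shows "pr (\<lambda>S. real (card (F \<inter> S)) < p * card F - a) \<le> D / a\<^sup>2"
proof -
  define X where "X e S = (of_bool (e \<in> S) :: real)" for e and S :: "'v set set"
  define c where "c e = pr (\<lambda>S. e \<in> S)" for e
  define Y where "Y S = (\<Sum>e\<in>F. X e S)" for S
  have d: "dep (\<Union>F) (\<lambda>S. e \<in> S)" if "e \<in> F" for e using that by (intro dep_mem) auto
  have iX: "integrable \<mu> (X e)" "expectation (X e) = c e" if "e \<in> F" for e
    unfolding X_def c_def using int_ind[OF assms(2) d[OF that]] by auto
  have Xm: "X e \<in> borel_measurable \<mu>" if "e \<in> F" for e using iX[OF that] by auto
  have XX: "X e S * X e' S = of_bool (e \<in> S \<and> e' \<in> S)" for e e' S by (simp add: X_def)
  have d2: "dep (\<Union>F) (\<lambda>S. e \<in> S \<and> e' \<in> S)" if "e \<in> F" "e' \<in> F" for e e'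
    using d that by (intro dep_conj) auto
  have iXX: "integrable \<mu> (\<lambda>S. X e S * X e' S)"
     "expectation (\<lambda>S. X e S * X e' S) = pr (\<lambda>S. e \<in> S \<and> e' \<in> S)" if "e \<in> F" "e' \<in> F" for e e'
    unfolding XX using int_ind[OF assms(2) d2[OF that]] by auto
  have EY: "expectation Y = (\<Sum>e\<in>F. c e)" unfolding Y_def using iX by simp
  have Y2: "(Y S)\<^sup>2 = (\<Sum>e\<in>F. \<Sum>e'\<in>F. X e S * X e' S)" for S
    unfolding Y_def power2_eq_square sum_product ..
  have iY: "integrable \<mu> Y" unfolding Y_def using iX by simp
  have iY2: "integrable \<mu> (\<lambda>S. (Y S)\<^sup>2)" unfolding Y2 using iXX by simp
  have "variance Y = expectation (\<lambda>S. (Y S)\<^sup>2) - (expectation Y)\<^sup>2"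
    using variance_eq[OF iY iY2] by simp
  also have "\<dots> = (\<Sum>e\<in>F. \<Sum>e'\<in>F. pr (\<lambda>S. e \<in> S \<and> e' \<in> S)) - (\<Sum>e\<in>F. \<Sum>e'\<in>F. c e * c e')"
    unfolding Y2 EY using iXX by (simp add: power2_eq_square sum_product)
  also have "\<dots> = (\<Sum>e\<in>F. \<Sum>e'\<in>F. pr (\<lambda>S. e \<in> S \<and> e' \<in> S) - c e * c e')"
    by (simp add: sum_subtractf)
  also have "\<dots> \<le> (\<Sum>e\<in>F. \<Sum>e'\<in>F. of_bool (e \<inter> e' \<noteq> {}))"
  proof (intro sum_mono)
    fix e e' assume ee: "e \<in> F" "e' \<in> F"
    show "pr (\<lambda>S. e \<in> S \<and> e' \<in> S) - c e * c e' \<le> of_bool (e \<inter> e' \<noteq> {})"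
    proof (cases "e \<inter> e' = {}")
      case True
      have "finite e" "finite e'" using ee assms(2) by (meson Union_upper finite_subset)+
      then have "pr (\<lambda>S. e \<in> S \<and> e' \<in> S) = c e * c e'"
        unfolding c_def using True by (intro pr_indep[of e e']) (auto intro: dep_mem)
      then show ?thesis by simp
    next
      case False
      then show ?thesis using pr_le1[of "\<lambda>S. e \<in> S \<and> e' \<in> S"] pr_nonneg[of "\<lambda>S. e \<in> S"]
          pr_nonneg[of "\<lambda>S. e' \<in> S"] mult_nonneg_nonneg[of "c e" "c e'"]
        unfolding c_def by (smt (verit) of_bool_eq_1_iff)
    qed
  qed
  also have "\<dots> = (\<Sum>x\<in>F \<times> F. of_bool (fst x \<inter> snd x \<noteq> {}))"
    using sum.cartesian_product[of "\<lambda>e e'. of_bool (e \<inter> e' \<noteq> {}) :: real" F F]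
    by (simp only: split_def)
  also have "\<dots> = real (card {x \<in> F \<times> F. fst x \<inter> snd x \<noteq> {}})"
  proof -
    have "(F \<times> F) \<inter> {x. fst x \<inter> snd x \<noteq> {}} = {x \<in> F \<times> F. fst x \<inter> snd x \<noteq> {}}" by blast
    moreover have "finite (F \<times> F)" using assms(3) by simp
    ultimately show ?thesis by (simp only: sum_of_bool_eq)
  qed
  also have "{x \<in> F \<times> F. fst x \<inter> snd x \<noteq> {}} = {(e, e'). e \<in> F \<and> e' \<in> F \<and> e \<inter> e' \<noteq> {}}"
    by force
  finally have var: "variance Y \<le> D" using D by linarith
  have Ym: "Y \<in> borel_measurable \<mu>" using iY by auto
  have EYp: "p * card F \<le> expectation Y"
  proof -
    have "(\<Sum>e\<in>F. p) \<le> (\<Sum>e\<in>F. c e)" unfolding c_def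
      by (rule sum_mono) (use pr_edge assms(1) in auto)
    then show ?thesis by (simp add: EY mult.commute)
  qed
  have Yc: "Y S = card (F \<inter> S)" for S
    unfolding Y_def X_def using assms(3) by (simp add: Int_def)
  have "pr (\<lambda>S. real (card (F \<inter> S)) < p * card F - a) \<le> prob {S \<in> space \<mu>. a \<le> \<bar>Y S - expectation Y\<bar>}"
    unfolding pr_def
  proof (rule finite_measure_mono)
    show "{S \<in> Pow E. real (card (F \<inter> S)) < p * real (card F) - a} \<subseteq> {S \<in> space \<mu>. a \<le> \<bar>Y S - expectation Y\<bar>}"
    proof
      fix S assume "S \<in> {S \<in> Pow E. real (card (F \<inter> S)) < p * real (card F) - a}"
      then have "S \<subseteq> E" "Y S < p * card F - a" by (auto simp: Yc)
      then show "S \<in> {S \<in> space \<mu>. a \<le> \<bar>Y S - expectation Y\<bar>}" using EYp by (auto simp: space_eq)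
    qed
    show "{S \<in> space \<mu>. a \<le> \<bar>Y S - expectation Y\<bar>} \<in> events" using Ym by measurable
  qed
  also have "\<dots> \<le> variance Y / a\<^sup>2"
    by (rule Chebyshev_inequality[OF Ym iY2 assms(5)])
  also have "\<dots> \<le> D / a\<^sup>2" using var by (simp add: divide_right_mono)
  finally show ?thesis .
qed

end


section \<open>Local connectivity and majority components\<close>

definition conn :: "'v set set \<Rightarrow> 'v set \<Rightarrow> 'v \<Rightarrow> 'v \<Rightarrow> bool" where
  "conn S W a b \<longleftrightarrow> (a, b) \<in> (adj {e \<in> S. e \<subseteq> W})\<^sup>*"

lemma sym_adj: "sym (adj S)"
  unfolding adj_def by (auto intro!: symI simp: insert_commute)

lemma conn_refl: "conn S W a a" by (simp add: conn_def)

lemma conn_sym: "conn S W a b \<Longrightarrow> conn S W b a"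
  unfolding conn_def by (meson sym_adj sym_rtrancl symD)

lemma conn_trans: "conn S W a b \<Longrightarrow> conn S W b c \<Longrightarrow> conn S W a c"
  unfolding conn_def by (rule rtrancl_trans)

lemma conn_mono: "conn S W a b \<Longrightarrow> W \<subseteq> W' \<Longrightarrow> conn S W' a b"
  unfolding conn_def
  by (erule rtrancl_mono[THEN subsetD, rotated]) (auto simp: adj_def)

lemma conn_edge: "{a, b} \<in> S \<Longrightarrow> a \<in> W \<Longrightarrow> b \<in> W \<Longrightarrow> conn S W a b"
  unfolding conn_def by (rule r_into_rtrancl) (simp add: adj_def)

lemma conn_full: "conn S W a b \<Longrightarrow> (a, b) \<in> (adj S)\<^sup>*"
  unfolding conn_def
  by (erule rtrancl_mono[THEN subsetD, rotated]) (auto simp: adj_def)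

lemma dep_conn: "dep W (\<lambda>S. conn S W a b)"
  unfolding conn_def by (rule dep_restrict)

text \<open>Two majorities of the same finite set intersect, so for fixed \<open>W\<close>,
  \<open>w\<close> and \<open>A\<close> at most one component qualifies. Giants can thus be glued
  through a common reference set without being named as sets.\<close>

definition maj :: "('a \<times> 'b) set set \<Rightarrow> ('a \<times> 'b) set \<Rightarrow> 'a \<times> 'b \<Rightarrow> 'a \<Rightarrow> 'b set \<Rightarrow> bool" where
  "maj S W c w A \<longleftrightarrow> card A < 2 * card {x \<in> A. conn S W c (w, x)}"

lemma dep_maj: "dep W (\<lambda>S. maj S W c w A)"
proof -
  have "dep W (\<lambda>S. card A < 2 * card {x. x \<in> A \<and> conn S W c (w, x)})"
    by (rule dep_Collect) (intro dep_guard dep_conn)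
  then show ?thesis by (simp add: maj_def)
qed

lemma maj_mono: "maj S W c w A \<Longrightarrow> W \<subseteq> W' \<Longrightarrow> conn S W' c c' \<Longrightarrow> finite A \<Longrightarrow> maj S W' c' w A"
  unfolding maj_def
  by (erule order.strict_trans2)
    (intro mult_left_mono card_mono, auto intro: conn_mono conn_trans conn_sym)

lemma majority_meet:
  assumes "finite A" "B \<subseteq> A" "C \<subseteq> A" "card A < 2 * card B" "card A < 2 * card C"
  shows "B \<inter> C \<noteq> {}"
proof
  assume "B \<inter> C = {}"
  then have "card (B \<union> C) = card B + card C"
    using assms by (intro card_Un_disjoint) (auto intro: finite_subset)
  moreover have "card (B \<union> C) \<le> card A" using assms by (intro card_mono) auto
  ultimately show False using assms(4,5) by linarith
qed

lemma maj_meet: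
  assumes "maj S W c w A" "maj S W c' w A" "finite A"
  shows "conn S W c c'"
proof -
  have "{x \<in> A. conn S W c (w, x)} \<inter> {x \<in> A. conn S W c' (w, x)} \<noteq> {}"
    by (rule majority_meet[of A]) (use assms in \<open>auto simp: maj_def\<close>)
  then obtain x where "conn S W c (w, x)" "conn S W c' (w, x)" by blast
  then show ?thesis by (blast intro: conn_sym conn_trans)
qed

section \<open>A model with finite components\<close>

lemma sqrt3_bounds: "173 / 100 \<le> sqrt 3" "sqrt 3 \<le> 174 / 100" "sqrt 3 * sqrt 3 = (3 :: real)"
  using real_le_rsqrt[of "173 / 100" 3] real_le_lsqrt[of "174 / 100" 3] by (simp_all add: power2_eq_square)

definition rad :: "int \<times> int \<Rightarrow> int" where
  "rad z = max \<bar>fst z\<bar> \<bar>snd z\<bar>"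

text \<open>Corners of a level have no neighbour below; they are mapped to themselves.\<close>

definition lower_nbr :: "int \<times> int \<Rightarrow> int \<times> int" where
  "lower_nbr z = (if \<bar>fst z\<bar> < \<bar>snd z\<bar> then (fst z, snd z - sgn (snd z))
     else if \<bar>snd z\<bar> < \<bar>fst z\<bar> then (fst z - sgn (fst z), snd z) else z)"

text \<open>
  The rule applies to \<open>a\<close> and \<open>b\<close> on the same level, or with \<open>b\<close> one level above \<open>a\<close>. The state \<open>True\<close> means
  ``outer region'' on levels \<open>3k+1\<close> and ``pendant to the lower neighbour'' on levels \<open>3k+2\<close>; states on levels
  \<open>3k\<close> are ignored.
\<close>

definition low_rule :: "((int \<times> int) \<times> nat \<Rightarrow> bool) \<Rightarrow> (int \<times> int) \<times> nat \<Rightarrow> (int \<times> int) \<times> nat \<Rightarrow> bool" where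
  "low_rule \<omega> a b \<longleftrightarrow>
     (rad (fst a) = rad (fst b) \<and>
       (rad (fst a) mod 3 = 0 \<or> rad (fst a) mod 3 = 1 \<and> \<omega> a = \<omega> b \<or> rad (fst a) mod 3 = 2 \<and> \<not> \<omega> a \<and> \<not> \<omega> b)) \<or>
     (rad (fst b) = rad (fst a) + 1 \<and>
       (rad (fst a) mod 3 = 0 \<and> \<not> \<omega> b \<or> rad (fst a) mod 3 = 1 \<and> (\<omega> a \<or> \<omega> b) \<or> rad (fst a) mod 3 = 2 \<and> \<not> \<omega> a))"

definition low_config :: "((int \<times> int) \<times> nat) set set \<Rightarrow> ((int \<times> int) \<times> nat \<Rightarrow> bool) \<Rightarrow> ((int \<times> int) \<times> nat) set set" where
  "low_config E \<omega> = {e \<in> E. \<exists>a b. e = {a, b} \<and> low_rule \<omega> a b}"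

text \<open>The number of the region that contains the component of \<open>v\<close>.\<close>

definition block_index :: "((int \<times> int) \<times> nat \<Rightarrow> bool) \<Rightarrow> (int \<times> int) \<times> nat \<Rightarrow> int" where
  "block_index \<omega> v = rad (fst v) div 3 +
     (if rad (fst v) mod 3 = 0 then 0
      else if rad (fst v) mod 3 = 1 then of_bool (\<omega> v)
      else if \<not> \<omega> v then 1 else of_bool (\<omega> (lower_nbr (fst v), snd v)))"

text \<open>A lattice edge changes one coordinate by 1, and the level rises only if this coordinate
  is strictly dominant at the upper end. Uniqueness of the lower neighbour is what allows a pendant
  vertex to inherit the region of a single vertex.\<close>

lemma Z2_lower_nbr:
  assumes "{u, v} \<in> Z2_edges" "rad v = rad u + 1"
  shows "u = lower_nbr v"
proof -
  obtain u1 u2 v1 v2 where uv: "u = (u1, u2)" "v = (v1, v2)" by (cases u, cases v) auto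
  have "\<bar>u1 - v1\<bar> + \<bar>u2 - v2\<bar> = 1"
    using assms(1) unfolding uv Z2_edges_def by (auto simp: doubleton_eq_iff)
  then consider "u1 = v1" "\<bar>u2 - v2\<bar> = 1" | "u2 = v2" "\<bar>u1 - v1\<bar> = 1" by linarith
  then show ?thesis
  proof cases
    case 1
    then have "max \<bar>v1\<bar> \<bar>v2\<bar> = max \<bar>v1\<bar> \<bar>u2\<bar> + 1" using assms(2) unfolding uv rad_def by simp
    then have "\<bar>v1\<bar> < \<bar>v2\<bar>" "\<bar>v2\<bar> = \<bar>u2\<bar> + 1" using 1 by linarith+
    moreover have "u2 = v2 - sgn v2" using 1 calculation by (cases "v2 > 0") (auto simp: sgn_if)
    ultimately show ?thesis using 1 unfolding uv lower_nbr_def by simp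
  next
    case 2
    then have "max \<bar>v1\<bar> \<bar>v2\<bar> = max \<bar>u1\<bar> \<bar>v2\<bar> + 1" using assms(2) unfolding uv rad_def by simp
    then have "\<bar>v2\<bar> < \<bar>v1\<bar>" "\<bar>v1\<bar> = \<bar>u1\<bar> + 1" using 2 by linarith+
    moreover have "u1 = v1 - sgn v1" using 2 calculation by (cases "v1 > 0") (auto simp: sgn_if)
    ultimately show ?thesis using 2 unfolding uv lower_nbr_def by simp
  qed
qed

text \<open>Invariance of the region number along open edges is what confines components. The
  delicate case is an edge from level \<open>3k+1\<close> up to level \<open>3k+2\<close>: if the
  upper end is pendant, its number is copied from its lower neighbour, which is the other end;
  otherwise the rule forces the lower end into the outer region, and both numbers are
  \<open>k+1\<close>.\<close>

lemma block_index_rule: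
  assumes "e \<in> cart_prod UNIV Z2_edges V G" "e = {a, b}" "low_rule \<omega> a b"
  shows "block_index \<omega> a = block_index \<omega> b"
proof (cases "rad (fst a) = rad (fst b)")
  case True
  then show ?thesis using assms(3) unfolding low_rule_def block_index_def by auto
next
  case False
  then have r: "rad (fst b) = rad (fst a) + 1"
    and c: "rad (fst a) mod 3 = 0 \<and> \<not> \<omega> b \<or> rad (fst a) mod 3 = 1 \<and> (\<omega> a \<or> \<omega> b) \<or> rad (fst a) mod 3 = 2 \<and> \<not> \<omega> a"
    using assms(3) unfolding low_rule_def by auto
  have "{fst a, fst b} \<in> Z2_edges \<and> snd a = snd b"
    using assms(1,2) r unfolding cart_prod_def by (auto simp: doubleton_eq_iff insert_commute)
  then have a: "a = (lower_nbr (fst b), snd b)"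
    using Z2_lower_nbr[OF _ r] by (cases a) auto
  define k where "k = rad (fst a) div 3"
  have k: "rad (fst a) = 3 * k + rad (fst a) mod 3" unfolding k_def by presburger
  consider "rad (fst a) mod 3 = 0" "\<not> \<omega> b" | "rad (fst a) mod 3 = 1" "\<omega> a \<or> \<omega> b" | "rad (fst a) mod 3 = 2" "\<not> \<omega> a"
    using c by blast
  then show ?thesis
  proof cases
    case 1
    then have "rad (fst a) = 3 * k" "rad (fst b) = 3 * k + 1" using k r by auto
    then show ?thesis using 1 unfolding block_index_def by simp
  next
    case 2
    then have "rad (fst a) = 3 * k + 1" "rad (fst b) = 3 * k + 2" using k r by auto
    then show ?thesis using 2 a unfolding block_index_def by auto
  next
    case 3
    then have "rad (fst a) = 3 * k + 2" "rad (fst b) = 3 * (k + 1)" using k r by auto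
    then show ?thesis using 3 unfolding block_index_def by auto
  qed
qed

lemma rad_le_block_index: "rad (fst v) \<le> 3 * block_index \<omega> v + 2"
proof -
  have "rad (fst v) \<le> 3 * (rad (fst v) div 3) + 2" by presburger
  moreover have "rad (fst v) div 3 \<le> block_index \<omega> v" unfolding block_index_def by simp
  ultimately show ?thesis by linarith
qed

lemma low_finite_components:
  fixes n :: nat
  assumes G: "graph_on n G"
  shows "\<not> has_infinite_component (low_config (cart_prod UNIV Z2_edges {..<n} G) \<omega>)"
proof
  let ?S = "low_config (cart_prod UNIV Z2_edges {..<n} G) \<omega>"
  assume "has_infinite_component ?S"
  then obtain v where inf: "infinite ((adj ?S)\<^sup>* `` {v})" unfolding has_infinite_component_def by blast
  have step: "block_index \<omega> b = block_index \<omega> a \<and> snd b < n" if "(a, b) \<in> adj ?S" for a b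
  proof -
    have e: "{a, b} \<in> cart_prod UNIV Z2_edges {..<n} G" and ex: "\<exists>c d. {a, b} = {c, d} \<and> low_rule \<omega> c d"
      using that unfolding adj_def low_config_def by auto
    obtain c d where cd: "{a, b} = {c, d}" "low_rule \<omega> c d" using ex by blast
    have "block_index \<omega> c = block_index \<omega> d" using block_index_rule[OF _ refl cd(2)] e cd(1) by metis
    moreover have "snd w < n" if "w \<in> e" "e \<in> cart_prod UNIV Z2_edges {..<n} G" for w e
    proof -
      have "x < n \<and> y < n" if "{x, y} \<in> G" for x y
        using that G unfolding graph_on_def by (fastforce simp: doubleton_eq_iff)
      then show ?thesis using that unfolding cart_prod_def by auto
    qed
    then have "snd b < n" using e by blast
    ultimately show ?thesis using cd(1) unfolding doubleton_eq_iff by metis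
  qed
  \<comment> \<open>The type also contains vertices with second coordinate at least
    \<open>n\<close>; they are isolated, whence the alternative \<open>w = v\<close>.\<close>
  have "block_index \<omega> w = block_index \<omega> v \<and> (w = v \<or> snd w < n)" if "(v, w) \<in> (adj ?S)\<^sup>*" for w
    using that by (induction rule: rtrancl_induct) (use step in auto)
  then have *: "block_index \<omega> w = block_index \<omega> v \<and> (w = v \<or> snd w < n)" if "(v, w) \<in> (adj ?S)\<^sup>*" for w
    using that by blast
  define R where "R = 3 * block_index \<omega> v + 2"
  have "(adj ?S)\<^sup>* `` {v} \<subseteq> insert v (({-R..R} \<times> {-R..R}) \<times> {..<n})"
  proof
    fix w assume "w \<in> (adj ?S)\<^sup>* `` {v}"
    then have w: "block_index \<omega> w = block_index \<omega> v" "w = v \<or> snd w < n" using *[of w] by blast+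
    have "rad (fst w) \<le> R" using rad_le_block_index[of w \<omega>] w(1) by (simp add: R_def)
    then have "\<bar>fst (fst w)\<bar> \<le> R" "\<bar>snd (fst w)\<bar> \<le> R" unfolding rad_def by auto
    then show "w \<in> insert v (({-R..R} \<times> {-R..R}) \<times> {..<n})"
      using w(2) by (cases w, cases "fst w") (auto simp: abs_le_iff)
  qed
  moreover have "finite (insert v (({-R..R} \<times> {-R..R}) \<times> {..<n}))" by simp
  ultimately show False using inf finite_subset by blast
qed

text \<open>\<open>2 - sqrt 3\<close> solves \<open>(1 - x)^2 = 4 - 2 * sqrt 3\<close>, the
  requirement for two non-pendant vertices joined on a level \<open>3k+2\<close>. With
  \<open>1 - \<theta> = (sqrt 3 - 1) / 2\<close> the edges within level \<open>3k+1\<close> and from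
  \<open>3k+1\<close> to \<open>3k+2\<close> also have probability exactly
  \<open>4 - 2 * sqrt 3\<close>; the remaining types are more likely.\<close>

definition low_prob :: "(int \<times> int) \<times> nat \<Rightarrow> real" where
  "low_prob v = (if rad (fst v) mod 3 = 1 then (sqrt 3 - 1) / 2 else if rad (fst v) mod 3 = 2 then 2 - sqrt 3 else 0)"

abbreviation coin :: "(int \<times> int) \<times> nat \<Rightarrow> bool measure" where
  "coin v \<equiv> measure_pmf (bernoulli_pmf (low_prob v))"

definition low_states :: "((int \<times> int) \<times> nat \<Rightarrow> bool) measure" where
  "low_states = PiM UNIV coin"

lemma low_prob_bounds: "0 \<le> low_prob v" "low_prob v \<le> 1"
  using sqrt3_bounds unfolding low_prob_def by auto

interpretation LP: product_prob_space coin UNIV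
  by standard

lemma LP_prob_space: "prob_space low_states"
  unfolding low_states_def by (rule LP.P.prob_space_axioms)

lemma space_low_states: "space low_states = UNIV"
  by (simp add: low_states_def space_PiM)

lemma low_states_coord: "{\<omega>. Q (\<omega> a)} \<in> sets low_states"
proof -
  have "(\<lambda>\<omega>. \<omega> a) \<in> low_states \<rightarrow>\<^sub>M coin a"
    unfolding low_states_def by (rule measurable_component_singleton) simp
  then have "(\<lambda>\<omega>. \<omega> a) -` {s. Q s} \<inter> space low_states \<in> sets low_states"
    by (rule measurable_sets) simp
  then show ?thesis by (simp add: space_low_states vimage_def)
qed

lemma low_states_coord2: "{\<omega>. Q (\<omega> a) (\<omega> b)} \<in> sets low_states"
proof -
  have "{\<omega>. Q (\<omega> a) (\<omega> b)} = ({\<omega>. \<omega> a} \<inter> {\<omega>. Q True (\<omega> b)}) \<union> ({\<omega>. \<not> \<omega> a} \<inter> {\<omega>. Q False (\<omega> b)})"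
    by (auto; metis (full_types))
  then show ?thesis
    using low_states_coord[of "\<lambda>x. x" a] low_states_coord[of "\<lambda>x. \<not> x" a]
      low_states_coord[of "Q True" b] low_states_coord[of "Q False" b]
    by simp
qed

lemma low_states_pair:
  assumes "a \<noteq> b"
  shows "measure low_states {\<omega>. \<omega> a = s \<and> \<omega> b = t} =
    (if s then low_prob a else 1 - low_prob a) * (if t then low_prob b else 1 - low_prob b)"
proof -
  let ?X = "\<lambda>i. if i = a then {s} else {t}"
  have "measure (PiM UNIV coin)
      (prod_emb UNIV coin {a, b} (Pi\<^sub>E {a, b} ?X))
    = (\<Prod>i\<in>{a, b}. measure (coin i) (?X i))"
    by (rule LP.measure_PiM_emb) auto
  also have "prod_emb UNIV coin {a, b} (Pi\<^sub>E {a, b} ?X)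
    = {\<omega>. \<omega> a = s \<and> \<omega> b = t}"
    using assms by (auto simp: prod_emb_def PiE_iff split: if_splits)
  also have "(\<Prod>i\<in>{a, b}. measure (coin i) (?X i))
    = pmf (bernoulli_pmf (low_prob a)) s * pmf (bernoulli_pmf (low_prob b)) t"
    using assms by (simp add: measure_pmf_single)
  finally show ?thesis unfolding low_states_def using low_prob_bounds[of a] low_prob_bounds[of b]
    by (cases s; cases t) simp_all
qed

lemma low_rule_prob:
  assumes "a \<noteq> b" "rad (fst a) = rad (fst b) \<or> rad (fst b) = rad (fst a) + 1"
  shows "4 - 2 * sqrt 3 \<le> measure low_states {\<omega>. low_rule \<omega> a b}"
proof -
  interpret P: prob_space low_states by (rule LP_prob_space)
  note pair = low_states_pair[OF assms(1)]
  have ev: "{\<omega>. low_rule \<omega> a b} \<in> sets low_states"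
    unfolding low_rule_def
    using low_states_coord2[of "\<lambda>x y. (rad (fst a) = rad (fst b) \<and>
       (rad (fst a) mod 3 = 0 \<or> rad (fst a) mod 3 = 1 \<and> x = y \<or> rad (fst a) mod 3 = 2 \<and> \<not> x \<and> \<not> y)) \<or>
     (rad (fst b) = rad (fst a) + 1 \<and>
       (rad (fst a) mod 3 = 0 \<and> \<not> y \<or> rad (fst a) mod 3 = 1 \<and> (x \<or> y) \<or> rad (fst a) mod 3 = 2 \<and> \<not> x))" a b] .
  have evp: "{\<omega>. \<omega> a = s \<and> \<omega> b = t} \<in> sets low_states" for s t
    using low_states_coord2[of "\<lambda>x y. x = s \<and> y = t" a b] .
  have two: "measure low_states {\<omega>. \<omega> a = s \<and> \<omega> b = t} + measure low_states {\<omega>. \<omega> a = s' \<and> \<omega> b = t'}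
      \<le> measure low_states {\<omega>. low_rule \<omega> a b}"
    if "(s, t) \<noteq> (s', t')" "\<And>\<omega>. \<omega> a = s \<and> \<omega> b = t \<Longrightarrow> low_rule \<omega> a b" "\<And>\<omega>. \<omega> a = s' \<and> \<omega> b = t' \<Longrightarrow> low_rule \<omega> a b"
    for s t s' t'
  proof -
    have "measure low_states {\<omega>. \<omega> a = s \<and> \<omega> b = t} + measure low_states {\<omega>. \<omega> a = s' \<and> \<omega> b = t'}
      = measure low_states ({\<omega>. \<omega> a = s \<and> \<omega> b = t} \<union> {\<omega>. \<omega> a = s' \<and> \<omega> b = t'})"
      by (rule P.finite_measure_Union[symmetric]) (use evp that(1) in auto)
    also have "\<dots> \<le> measure low_states {\<omega>. low_rule \<omega> a b}"
      by (rule P.finite_measure_mono[OF _ ev]) (use that(2,3) in auto)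
    finally show ?thesis .
  qed
  have three: "measure low_states {\<omega>. \<omega> a \<or> \<omega> b} = 1 - (1 - low_prob a) * (1 - low_prob b)"
  proof -
    have "{\<omega>. \<omega> a \<or> \<omega> b} = space low_states - {\<omega>. \<omega> a = False \<and> \<omega> b = False}"
      by (auto simp: space_low_states)
    then show ?thesis using P.prob_compl[OF evp[of False False]] pair[of False False] by simp
  qed
  have one: "measure low_states {\<omega>. low_rule \<omega> a b} = 1" if "\<And>\<omega>. low_rule \<omega> a b"
    using that P.prob_space by (simp add: space_low_states)
  have mod3: "rad (fst a) mod 3 = 0 \<or> rad (fst a) mod 3 = 1 \<or> rad (fst a) mod 3 = 2" by presburger
  have s4: "4 - 2 * sqrt 3 \<le> 1" using sqrt3_bounds by linarith
  show ?thesis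
  proof (cases "rad (fst a) = rad (fst b)")
    case True
    consider "rad (fst a) mod 3 = 0" | "rad (fst a) mod 3 = 1" | "rad (fst a) mod 3 = 2" using mod3 by blast
    then show ?thesis
    proof cases
      case 1
      then show ?thesis using one True s4 unfolding low_rule_def by auto
    next
      case 2
      have l: "low_prob a = (sqrt 3 - 1) / 2" "low_prob b = (sqrt 3 - 1) / 2"
        using 2 True by (auto simp: low_prob_def)
      show ?thesis using two[of True True False False] sqrt3_bounds 2 True unfolding pair l low_rule_def
        by (simp add: field_simps)
    next
      case 3
      have l: "low_prob a = 2 - sqrt 3" "low_prob b = 2 - sqrt 3"
        using 3 True by (auto simp: low_prob_def)
      have "measure low_states {\<omega>. \<omega> a = False \<and> \<omega> b = False} \<le> measure low_states {\<omega>. low_rule \<omega> a b}"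
        by (rule P.finite_measure_mono[OF _ ev]) (use 3 True in \<open>auto simp: low_rule_def\<close>)
      then show ?thesis using sqrt3_bounds unfolding pair l by (simp add: field_simps)
    qed
  next
    case False
    then have r: "rad (fst b) = rad (fst a) + 1" using assms(2) by blast
    consider "rad (fst a) mod 3 = 0" | "rad (fst a) mod 3 = 1" | "rad (fst a) mod 3 = 2" using mod3 by blast
    then show ?thesis
    proof cases
      case 1
      then have "rad (fst b) mod 3 = 1" using r by presburger
      then have l: "low_prob b = (sqrt 3 - 1) / 2" by (simp add: low_prob_def)
      show ?thesis using two[of True False False False] sqrt3_bounds 1 r unfolding pair l low_rule_def
        by (simp add: field_simps)
    next
      case 2
      then have "rad (fst b) mod 3 = 2" using r by presburger
      then have l: "low_prob a = (sqrt 3 - 1) / 2" "low_prob b = 2 - sqrt 3" using 2 by (auto simp: low_prob_def)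
      have "{\<omega>. low_rule \<omega> a b} = {\<omega>. \<omega> a \<or> \<omega> b}" using 2 r unfolding low_rule_def by auto
      then show ?thesis using three sqrt3_bounds unfolding l by (simp add: field_simps)
    next
      case 3
      then have l: "low_prob a = 2 - sqrt 3" by (simp add: low_prob_def)
      show ?thesis using two[of False False False True] sqrt3_bounds 3 r unfolding pair l low_rule_def
        by (simp add: field_simps)
    qed
  qed
qed

lemma low_states_indep:
  "prob_space.indep_vars low_states coin (\<lambda>v \<omega>. \<omega> v) UNIV"
proof -
  interpret P: prob_space low_states by (rule LP_prob_space)
  have rv: "(\<lambda>\<omega>. \<omega> v) \<in> low_states \<rightarrow>\<^sub>M coin v" for v
    unfolding low_states_def by (rule measurable_component_singleton) simp
  have "distr low_states (PiM UNIV coin) (\<lambda>x. \<lambda>i\<in>UNIV. x i) = distr low_states low_states (\<lambda>x. x)"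
    by (simp add: low_states_def restrict_def)
  also have "\<dots> = low_states" by (rule distr_id)
  also have "\<dots> = PiM UNIV (\<lambda>i. distr low_states (coin i) (\<lambda>\<omega>. \<omega> i))"
    unfolding low_states_def by (intro PiM_cong refl LP.PiM_component[symmetric]) simp
  finally show ?thesis by (subst P.indep_vars_iff_distr_eq_PiM) (use rv in auto)
qed

section \<open>The confined model is 1-independent\<close>

definition low_measure :: "((int \<times> int) \<times> nat) set set \<Rightarrow> ((int \<times> int) \<times> nat) set set measure" where
  "low_measure E = distr low_states (edge_space E) (low_config E)"

lemma sets_edge_space: "sets (edge_space E) = sigma_sets (Pow E) (edge_event E ` E)"
  unfolding edge_space_def by (rule sets_measure_of) (auto simp: edge_event_def)

lemma space_edge_space: "space (edge_space E) = Pow E"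
  unfolding edge_space_def by (rule space_measure_of) (auto simp: edge_event_def)

lemma low_config_mem:
  "{a, b} \<in> low_config E \<omega> \<longleftrightarrow> {a, b} \<in> E \<and> (low_rule \<omega> a b \<or> low_rule \<omega> b a)"
proof
  assume "{a, b} \<in> low_config E \<omega>"
  then obtain c d where "{a, b} \<in> E" "{a, b} = {c, d}" "low_rule \<omega> c d" unfolding low_config_def by blast
  then show "{a, b} \<in> E \<and> (low_rule \<omega> a b \<or> low_rule \<omega> b a)" unfolding doubleton_eq_iff by metis
next
  assume "{a, b} \<in> E \<and> (low_rule \<omega> a b \<or> low_rule \<omega> b a)"
  then show "{a, b} \<in> low_config E \<omega>" unfolding low_config_def using insert_commute[of a b "{}"] by blast
qed

lemma low_config_mem_local:
  "\<exists>Q. \<forall>\<omega>. ({a, b} \<in> low_config E \<omega>) = Q (\<omega> a) (\<omega> b)"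
  unfolding low_config_mem low_rule_def by (rule exI, rule allI, rule refl)

lemma low_config_measurable:
  assumes "\<And>e. e \<in> E \<Longrightarrow> \<exists>a b. e = {a, b}"
  shows "low_config E \<in> low_states \<rightarrow>\<^sub>M edge_space E"
  unfolding edge_space_def
proof (rule measurable_measure_of)
  show "edge_event E ` E \<subseteq> Pow (Pow E)" by (auto simp: edge_event_def)
  show "low_config E \<in> space low_states \<rightarrow> Pow E" by (auto simp: low_config_def)
  fix A assume "A \<in> edge_event E ` E"
  then obtain e where e: "e \<in> E" "A = edge_event E e" by blast
  obtain a b where ab: "e = {a, b}" using assms e(1) by blast
  obtain Q where Q: "\<And>\<omega>. ({a, b} \<in> low_config E \<omega>) = Q (\<omega> a) (\<omega> b)" using low_config_mem_local by blast
  have "low_config E -` A \<inter> space low_states = {\<omega>. Q (\<omega> a) (\<omega> b)}"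
    unfolding e(2) edge_event_def space_low_states ab Q[symmetric] by (auto simp: low_config_def)
  then show "low_config E -` A \<inter> space low_states \<in> sets low_states" by (simp add: low_states_coord2)
qed

text \<open>The state of an edge is a function of the states of its two ends. Events about the edges
  of \<open>A\<close>, which may be infinite, are therefore pulled back to events about the states
  on \<open>\<Union>A\<close>, and independence of restrictions to disjoint coordinate sets
  applies.\<close>

lemma low_config_cyl:
  assumes "\<And>e. e \<in> E \<Longrightarrow> \<exists>a b. e = {a, b}" "A \<subseteq> E" "x \<in> cyl_events E A"
  shows "\<exists>X \<in> sets (PiM (\<Union>A) coin).
    \<forall>\<omega>. (low_config E \<omega> \<in> x) = (restrict \<omega> (\<Union>A) \<in> X)"
  using assms(3) unfolding cyl_events_def
proof (induction rule: sigma_sets.induct)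
  case (Basic x)
  let ?M = "PiM (\<Union>A) coin"
  obtain e where e: "e \<in> A" "x = edge_event E e" using Basic by blast
  obtain a b where ab: "e = {a, b}" using assms e(1) by blast
  obtain Q where Q: "\<And>\<omega>. ({a, b} \<in> low_config E \<omega>) = Q (\<omega> a) (\<omega> b)" using low_config_mem_local by blast
  have ab': "a \<in> \<Union>A" "b \<in> \<Union>A" using e ab by auto
  have m: "(\<lambda>f. f c) -` {s. R s} \<inter> space ?M \<in> sets ?M" if "c \<in> \<Union>A" for c R
    by (rule measurable_sets[OF measurable_component_singleton[OF that]]) simp
  have "{f \<in> space ?M. Q (f a) (f b)} =
     ((\<lambda>f. f a) -` {s. s} \<inter> space ?M) \<inter> ((\<lambda>f. f b) -` {s. Q True s} \<inter> space ?M) \<union>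
     ((\<lambda>f. f a) -` {s. \<not> s} \<inter> space ?M) \<inter> ((\<lambda>f. f b) -` {s. Q False s} \<inter> space ?M)"
    by (auto; metis (full_types))
  also have "\<dots> \<in> sets ?M" by (intro sets.Un sets.Int m ab')
  finally have "{f \<in> space ?M. Q (f a) (f b)} \<in> sets ?M" .
  moreover have "(low_config E \<omega> \<in> x) = (restrict \<omega> (\<Union>A) \<in> {f \<in> space ?M. Q (f a) (f b)})" for \<omega>
  proof -
    have "(low_config E \<omega> \<in> x) = Q (\<omega> a) (\<omega> b)"
      unfolding e(2) edge_event_def ab Q[symmetric] by (auto simp: low_config_def)
    moreover have "restrict \<omega> (\<Union>A) \<in> space ?M" by (auto simp: space_PiM)
    ultimately show ?thesis using ab' by (simp add: restrict_def)
  qed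
  ultimately show ?case by blast
next
  case Empty
  then show ?case by (intro bexI[of _ "{}"]) auto
next
  case (Compl x)
  let ?M = "PiM (\<Union>A) coin"
  obtain X where X: "X \<in> sets ?M" "\<And>\<omega>. (low_config E \<omega> \<in> x) = (restrict \<omega> (\<Union>A) \<in> X)"
    using Compl by blast
  show ?case
  proof (intro bexI[of _ "space ?M - X"] allI)
    fix \<omega>
    have "restrict \<omega> (\<Union>A) \<in> space ?M" by (auto simp: space_PiM)
    moreover have "low_config E \<omega> \<in> Pow E" by (auto simp: low_config_def)
    ultimately show "(low_config E \<omega> \<in> Pow E - x) = (restrict \<omega> (\<Union>A) \<in> space ?M - X)" using X(2) by blast
  qed (use X(1) in auto)
next
  case (Union x)
  let ?M = "PiM (\<Union>A) coin"
  have "\<forall>i. \<exists>X\<in>sets ?M. \<forall>\<omega>. (low_config E \<omega> \<in> x i) = (restrict \<omega> (\<Union>A) \<in> X)" using Union by blast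
  then obtain X where X: "\<And>i. X i \<in> sets ?M" "\<And>i \<omega>. (low_config E \<omega> \<in> x i) = (restrict \<omega> (\<Union>A) \<in> X i)"
    by metis
  show ?case
  proof (intro bexI[of _ "\<Union>i::nat. X i"] allI)
    show "(low_config E \<omega> \<in> (\<Union>i. x i)) = (restrict \<omega> (\<Union>A) \<in> (\<Union>i. X i))" for \<omega>
      unfolding UN_iff X(2) ..
  qed (use X(1) in auto)
qed

lemma low_measure_model:
  fixes n :: nat
  assumes G: "graph_on n G"
  defines "E \<equiv> cart_prod UNIV Z2_edges {..<n} G"
  shows "low_measure E \<in> models_ge E (4 - 2 * sqrt 3)"
proof -
  interpret P: prob_space low_states by (rule LP_prob_space)
  have pairs: "\<exists>a b. e = {a, b} \<and> a \<noteq> b \<and> (rad (fst a) = rad (fst b) \<or> rad (fst b) = rad (fst a) + 1)" if "e \<in> E" for e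
  proof -
    have "(\<exists>u v x. e = {(u, x), (v, x)} \<and> {u, v} \<in> Z2_edges) \<or> (\<exists>u x y. e = {(u, x), (u, y)} \<and> {x, y} \<in> G)"
      using that unfolding E_def cart_prod_def by blast
    then consider u v x where "e = {(u, x), (v, x)}" "{u, v} \<in> Z2_edges" | u x y where "e = {(u, x), (u, y)}" "{x, y} \<in> G"
      by metis
    then show ?thesis
    proof cases
      case 1
      obtain u1 u2 v1 v2 where uv: "u = (u1, u2)" "v = (v1, v2)" by (cases u, cases v) auto
      have d: "\<bar>u1 - v1\<bar> + \<bar>u2 - v2\<bar> = 1"
        using 1(2) unfolding uv Z2_edges_def by (auto simp: doubleton_eq_iff)
      then have r: "rad u = rad v \<or> rad v = rad u + 1 \<or> rad u = rad v + 1" and ne: "u \<noteq> v"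
        unfolding uv rad_def by (simp_all add: max_def) linarith+
      have "e = {(v, x), (u, x)}" using 1(1) by auto
      then show ?thesis using r ne 1(1)
        by (elim disjE) (rule exI[of _ "(u, x)"], rule exI[of _ "(v, x)"], simp,
          rule exI[of _ "(u, x)"], rule exI[of _ "(v, x)"], simp,
          rule exI[of _ "(v, x)"], rule exI[of _ "(u, x)"], simp)
    next
      case 2
      then have "{x, y} \<in> {{x, y} | x y. x \<noteq> y \<and> x < n \<and> y < n}" using G unfolding graph_on_def by blast
      then have "x \<noteq> y" by (auto simp: doubleton_eq_iff)
      then show ?thesis using 2 by (intro exI[of _ "(u, x)"] exI[of _ "(u, y)"]) simp
    qed
  qed
  then have pr: "\<exists>a b. e = {a, b}" if "e \<in> E" for e using that by blast
  note meas = low_config_measurable[OF pr]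
  have ps: "prob_space (low_measure E)"
    unfolding low_measure_def by (rule P.prob_space_distr[OF meas]) simp
  interpret Q: prob_space "low_measure E" by (rule ps)
  have sp: "space (low_measure E) = Pow E" by (simp add: low_measure_def space_edge_space)
  have st: "sets (low_measure E) = sets (edge_space E)" by (simp add: low_measure_def)
  have pre: "measure (low_measure E) x = measure low_states {\<omega>. low_config E \<omega> \<in> x}" if "x \<in> sets (edge_space E)" for x
    unfolding low_measure_def using measure_distr[OF meas that]
    by (simp add: space_low_states vimage_def)
  have cyl: "cyl_events E A \<subseteq> sets (edge_space E)" if "A \<subseteq> E" for A
    unfolding cyl_events_def sets_edge_space using that by (metis image_mono sigma_sets_mono')
  have "one_independent E (low_measure E)"
    unfolding one_independent_def
  proof (intro allI impI)
    fix A B assume AB: "A \<subseteq> E" "B \<subseteq> E" "\<Union> A \<inter> \<Union> B = {}"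
    have iv: "P.indep_var (PiM (\<Union>A) coin) (\<lambda>\<omega>. restrict \<omega> (\<Union>A)) (PiM (\<Union>B) coin) (\<lambda>\<omega>. restrict \<omega> (\<Union>B))"
      using P.indep_var_restrict[OF low_states_indep AB(3)] by simp
    show "Q.indep_set (cyl_events E A) (cyl_events E B)"
      unfolding Q.indep_sets2_eq st
    proof (intro conjI ballI cyl AB)
      fix a b assume ab: "a \<in> cyl_events E A" "b \<in> cyl_events E B"
      obtain X where X: "X \<in> sets (PiM (\<Union>A) coin)" "\<And>\<omega>. (low_config E \<omega> \<in> a) = (restrict \<omega> (\<Union>A) \<in> X)"
        using low_config_cyl[OF pr AB(1) ab(1)] by blast
      obtain Y where Y: "Y \<in> sets (PiM (\<Union>B) coin)" "\<And>\<omega>. (low_config E \<omega> \<in> b) = (restrict \<omega> (\<Union>B) \<in> Y)"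
        using low_config_cyl[OF pr AB(2) ab(2)] by blast
      have s: "a \<in> sets (edge_space E)" "b \<in> sets (edge_space E)" using ab cyl AB by blast+
      have "measure low_states {\<omega>. restrict \<omega> (\<Union>A) \<in> X \<and> restrict \<omega> (\<Union>B) \<in> Y}
        = measure low_states {\<omega>. restrict \<omega> (\<Union>A) \<in> X} * measure low_states {\<omega>. restrict \<omega> (\<Union>B) \<in> Y}"
        using P.indep_varD[OF iv X(1) Y(1)] by (simp add: space_low_states vimage_def)
      then show "measure (low_measure E) (a \<inter> b) = measure (low_measure E) a * measure (low_measure E) b"
        using pre[OF s(1)] pre[OF s(2)] pre[OF sets.Int[OF s]] X(2) Y(2) by simp
    qed
  qed
  moreover have "4 - 2 * sqrt 3 \<le> measure (low_measure E) (edge_event E e)" if e: "e \<in> E" for e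
  proof -
    obtain a b where ab: "e = {a, b}" "a \<noteq> b" "rad (fst a) = rad (fst b) \<or> rad (fst b) = rad (fst a) + 1"
      using pairs[OF e] by blast
    have ev: "edge_event E e \<in> sets (edge_space E)" using e unfolding sets_edge_space by blast
    obtain Q where Q: "\<And>\<omega>. ({a, b} \<in> low_config E \<omega>) = Q (\<omega> a) (\<omega> b)" using low_config_mem_local by blast
    have "measure low_states {\<omega>. low_rule \<omega> a b} \<le> measure low_states {\<omega>. e \<in> low_config E \<omega>}"
    proof (rule P.finite_measure_mono)
      show "{\<omega>. low_rule \<omega> a b} \<subseteq> {\<omega>. e \<in> low_config E \<omega>}" using e unfolding ab low_config_mem by auto
      show "{\<omega>. e \<in> low_config E \<omega>} \<in> sets low_states" unfolding ab Q by (rule low_states_coord2)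
    qed
    also have "{\<omega>. e \<in> low_config E \<omega>} = {\<omega>. low_config E \<omega> \<in> edge_event E e}"
      by (auto simp: edge_event_def low_config_def)
    finally show ?thesis using low_rule_prob[OF ab(2,3)] pre[OF ev] by simp
  qed
  ultimately show ?thesis unfolding models_ge_def using ps sp st by auto
qed

lemma p1c_lower:
  fixes n :: nat
  assumes G: "graph_on n G"
  defines "E \<equiv> cart_prod UNIV Z2_edges {..<n} G"
  assumes p: "\<forall>\<mu>\<in>models_ge E p. percolates \<mu>"
  shows "4 - 2 * sqrt 3 \<le> p"
proof (rule ccontr)
  assume "\<not> 4 - 2 * sqrt 3 \<le> p"
  then have "low_measure E \<in> models_ge E p"
    using low_measure_model[OF G] unfolding models_ge_def E_def by fastforce
  then have perc: "percolates (low_measure E)" using p by blast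
  have pr: "\<exists>a b. e = {a, b}" if "e \<in> E" for e using that unfolding E_def cart_prod_def by blast
  have "AE \<omega> in low_states. has_infinite_component (low_config E \<omega>)"
    using perc AE_distrD[OF low_config_measurable[OF pr]] unfolding percolates_def low_measure_def by blast
  then have "AE \<omega> in low_states. False" using low_finite_components[OF G] unfolding E_def by simp
  then show False using prob_space.AE_False[OF LP_prob_space] by simp
qed

section \<open>Renormalisation on the square lattice\<close>

text \<open>
  A cell of scale \<open>k + 1\<close> contains a window of 8 by 8 cells of scale \<open>k\<close>, and neighbouring windows overlap in half of
  their cells. A cell is bad if its window has two bad cells that are vertex-disjoint, so the bad cells of a
  good window lie in three consecutive rows and columns. Hence good neighbouring cells share a good row or
  column, and the probability of being bad is roughly squared from one scale to the next.
\<close>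

definition window :: "(int \<times> int) set" where
  "window = {0..<8} \<times> {0..<8}"

definition subcell :: "int \<times> int \<Rightarrow> int \<times> int \<Rightarrow> int \<times> int" where
  "subcell z i = (4 * fst z + fst i, 4 * snd z + snd i)"

definition far :: "int \<times> int \<Rightarrow> int \<times> int \<Rightarrow> bool" where
  "far i j \<longleftrightarrow> 3 \<le> \<bar>fst i - fst j\<bar> \<or> 3 \<le> \<bar>snd i - snd j\<bar>"

text \<open>The side factor 3 is the least integer \<open>s\<close> with
  \<open>7 + s \<le> 4 * s\<close>, so that the boxes of a window fit into the box of the next
  scale; at scale 0 it covers a site and its two forward neighbours. It also fixes
  \<open>far\<close>: offsets differing by at least 3 in a coordinate give disjoint boxes.\<close>

definition cellbox :: "nat \<Rightarrow> int \<times> int \<Rightarrow> (int \<times> int) set" where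
  "cellbox k z = {4 ^ k * fst z..<4 ^ k * fst z + 3 * 4 ^ k} \<times> {4 ^ k * snd z..<4 ^ k * snd z + 3 * 4 ^ k}"

lemma cellbox_subcell: "i \<in> window \<Longrightarrow> cellbox k (subcell z i) \<subseteq> cellbox (Suc k) z"
proof -
  assume "i \<in> window"
  then have i: "0 \<le> fst i" "fst i \<le> 7" "0 \<le> snd i" "snd i \<le> 7" unfolding window_def by auto
  have "4 ^ k * fst i \<le> 4 ^ k * 7" "4 ^ k * snd i \<le> 4 ^ k * 7" "0 \<le> 4 ^ k * fst i" "0 \<le> 4 ^ k * snd i"
    using i by (simp_all add: mult_left_mono)
  moreover have "0 < (4 :: int) ^ k" by simp
  ultimately show ?thesis
    unfolding cellbox_def subcell_def by (intro Sigma_mono) (auto simp: algebra_simps)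
qed

lemma cellbox_far:
  assumes "far i j"
  shows "cellbox k (subcell z i) \<inter> cellbox k (subcell z j) = {}"
proof -
  have sep: "False" if "3 \<le> \<bar>a - b\<bar>" "4 ^ k * (c + a) \<le> t" "t < 4 ^ k * (c + a) + 3 * 4 ^ k"
    "4 ^ k * (c + b) \<le> t" "t < 4 ^ k * (c + b) + 3 * 4 ^ k" for a b c t :: int
  proof -
    have p: "0 < (4 :: int) ^ k" by simp
    have "4 ^ k * (c + a) < 4 ^ k * (c + b + 3)" "4 ^ k * (c + b) < 4 ^ k * (c + a + 3)"
      using that by (simp_all add: algebra_simps)
    then have "c + a < c + b + 3" "c + b < c + a + 3" using p by (simp_all only: mult_less_cancel_left_pos)
    then show False using that(1) by linarith
  qed
  show ?thesis
    using assms sep unfolding cellbox_def subcell_def far_def by (auto simp del: mult_less_cancel_left_pos) blast+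
qed

text \<open>Integer sets of diameter at most 2 have at most three elements, and
  \<open>3 + 3 < 8\<close> leaves a row or column of the window untouched.\<close>

lemma thin_sets_miss:
  fixes A B :: "int set"
  assumes "\<And>a b. a \<in> A \<Longrightarrow> b \<in> A \<Longrightarrow> \<bar>a - b\<bar> \<le> 2" "\<And>a b. a \<in> B \<Longrightarrow> b \<in> B \<Longrightarrow> \<bar>a - b\<bar> \<le> 2"
  shows "\<exists>y\<in>{0..<8}. y \<notin> A \<and> y \<notin> B"
proof -
  have thin: "\<exists>m. A \<subseteq> {m..m + 4} \<and> finite A \<and> card A \<le> 3" if A: "\<And>a b. a \<in> A \<Longrightarrow> b \<in> A \<Longrightarrow> \<bar>a - b\<bar> \<le> 2" for A :: "int set"
  proof (cases "A = {}")
    case False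
    then obtain a where a: "a \<in> A" by blast
    have "A \<subseteq> {a - 2..a + 2}" using A[OF a] by fastforce
    then have fin: "finite A" using finite_subset by blast
    define m where "m = Min A"
    have "A \<subseteq> {m..m + 2}" using A[of _ m] fin Min_in[OF fin False] Min_le[OF fin]
      unfolding m_def by fastforce
    then show ?thesis using fin card_mono[of "{m..m + 2}" A] by (intro exI[of _ m]) auto
  qed auto
  have "card (A \<union> B) \<le> 6" using thin[OF assms(1)] thin[OF assms(2)] card_Un_le[of A B] by fastforce
  moreover have "finite (A \<union> B)" using thin[OF assms(1)] thin[OF assms(2)] by blast
  ultimately have "\<not> {0..<8} \<subseteq> A \<union> B" using card_mono[of "A \<union> B" "{0..<8 :: int}"] by auto
  then show ?thesis by blast
qed

locale renorm = model E p \<mu> for E :: "((int \<times> int) \<times> nat) set set" and p \<mu> +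
  fixes V A :: "nat set"
  assumes finV: "finite V" and finA: "finite A"
begin

definition opn :: "((int \<times> int) \<times> nat) set set \<Rightarrow> int \<times> int \<Rightarrow> int \<times> int \<Rightarrow> bool" where
  "opn S a b \<longleftrightarrow> (\<exists>c. maj S ({a, b} \<times> V) c a A \<and> maj S ({a, b} \<times> V) c b A)"

lemma opn_sym:
  assumes "opn S a b"
  shows "opn S b a"
proof -
  have "{b, a} = {a, b}" by blast
  then show ?thesis using assms unfolding opn_def by (simp only:) blast
qed

lemma dep_opn: "dep ({a, b} \<times> V) (\<lambda>S. opn S a b)"
  unfolding opn_def by (intro dep_ex dep_conj dep_maj)

primrec bad :: "nat \<Rightarrow> int \<times> int \<Rightarrow> ((int \<times> int) \<times> nat) set set \<Rightarrow> bool" where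
  "bad 0 z S = (\<not> opn S z (z + (1, 0)) \<or> \<not> opn S z (z + (0, 1)))"
| "bad (Suc k) z S = (\<exists>ij \<in> window \<times> window. far (fst ij) (snd ij) \<and>
     bad k (subcell z (fst ij)) S \<and> bad k (subcell z (snd ij)) S)"

declare bad.simps [simp del]

lemma dep_bad: "dep (cellbox k z \<times> V) (bad k z)"
proof (induction k arbitrary: z)
  case 0
  have "{z, z + (1, 0)} \<times> V \<subseteq> cellbox 0 z \<times> V" "{z, z + (0, 1)} \<times> V \<subseteq> cellbox 0 z \<times> V"
    unfolding cellbox_def by (cases z; auto)+
  then have "dep (cellbox 0 z \<times> V) (\<lambda>S. opn S z (z + (1, 0)))" "dep (cellbox 0 z \<times> V) (\<lambda>S. opn S z (z + (0, 1)))"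
    using dep_mono[OF dep_opn] by blast+
  then show ?case unfolding bad.simps by (intro dep_disj dep_not)
next
  case (Suc k)
  show ?case unfolding bad.simps Bex_def
    by (intro dep_ex dep_guard dep_conj dep_mono[OF Suc] Sigma_mono cellbox_subcell) auto
qed

lemma fin_cellbox: "finite (cellbox k z \<times> V)" unfolding cellbox_def using finV by simp

text \<open>A window has \<open>64^2 = 4096\<close> ordered pairs of cells, so a bound
  \<open>Q\<close> for one scale becomes \<open>4096 * Q^2\<close> for the next. Writing
  \<open>Q = 2^-(k+1) / 4096\<close> turns this into squaring a power of 1/2; the base case
  \<open>2 / 16384 = 1 / 8192\<close> dictates the constant in the hypotheses.\<close>

lemma pr_bad:
  assumes "\<And>z. 1 - 1 / 16384 \<le> pr (\<lambda>S. opn S z (z + (1, 0)))"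
    "\<And>z. 1 - 1 / 16384 \<le> pr (\<lambda>S. opn S z (z + (0, 1)))"
  shows "pr (bad k z) \<le> (1 / 2) ^ (k + 1) / 4096"
proof (induction k arbitrary: z)
  case 0
  have sub: "{z, z + (1, 0)} \<times> V \<subseteq> cellbox 0 z \<times> V" "{z, z + (0, 1)} \<times> V \<subseteq> cellbox 0 z \<times> V"
    unfolding cellbox_def by (cases z; auto)+
  have d: "dep (cellbox 0 z \<times> V) (\<lambda>S. opn S z (z + (1, 0)))" "dep (cellbox 0 z \<times> V) (\<lambda>S. opn S z (z + (0, 1)))"
    by (rule dep_mono[OF dep_opn], rule sub)+
  have "pr (bad 0 z) \<le> pr (\<lambda>S. \<not> opn S z (z + (1, 0))) + pr (\<lambda>S. \<not> opn S z (z + (0, 1)))"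
    unfolding bad.simps by (intro pr_disj_le[OF fin_cellbox[of 0 z]] dep_not d)
  also have "\<dots> \<le> 1 / 16384 + 1 / 16384"
    using assms[of z] pr_not[OF fin_cellbox d(1)] pr_not[OF fin_cellbox d(2)] by linarith
  finally show ?case by simp
next
  case (Suc k)
  let ?Q = "(1 / 2) ^ (k + 1) / 4096 :: real"
  have Q: "0 \<le> ?Q" by simp
  have fw: "finite (window \<times> window)" "card (window \<times> window) = 4096"
    unfolding window_def by (simp_all add: card_cartesian_product)
  have d: "dep (cellbox (Suc k) z \<times> V) (bad k (subcell z i))" if "i \<in> window" for i
    using that by (intro dep_mono[OF dep_bad] Sigma_mono cellbox_subcell) auto
  have "pr (bad (Suc k) z) \<le> (\<Sum>ij\<in>window \<times> window. pr (\<lambda>S. far (fst ij) (snd ij) \<and>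
     bad k (subcell z (fst ij)) S \<and> bad k (subcell z (snd ij)) S))"
    unfolding bad.simps
    by (rule pr_Bex_le[OF fw(1) fin_cellbox[of "Suc k" z]]) (intro dep_guard dep_conj d; auto)
  also have "\<dots> \<le> (\<Sum>ij\<in>window \<times> window. ?Q * ?Q)"
  proof (rule sum_mono)
    fix ij assume ij: "ij \<in> window \<times> window"
    show "pr (\<lambda>S. far (fst ij) (snd ij) \<and> bad k (subcell z (fst ij)) S \<and> bad k (subcell z (snd ij)) S) \<le> ?Q * ?Q"
    proof (cases "far (fst ij) (snd ij)")
      case True
      have "pr (\<lambda>S. bad k (subcell z (fst ij)) S \<and> bad k (subcell z (snd ij)) S)
        = pr (bad k (subcell z (fst ij))) * pr (bad k (subcell z (snd ij)))"
        by (rule pr_indep[OF fin_cellbox fin_cellbox _ dep_bad dep_bad]) (use cellbox_far[OF True] in blast)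
      also have "\<dots> \<le> ?Q * ?Q" by (intro mult_mono Suc pr_nonneg Q)
      finally show ?thesis using True by simp
    next
      case False
      then show ?thesis using Q by (simp add: pr_def)
    qed
  qed
  also have "\<dots> = 4096 * (?Q * ?Q)" using fw by simp
  also have "\<dots> = (1 / 2) ^ (2 * k + 2) / 4096" by (simp add: power_add power2_eq_square mult_2)
  also have "\<dots> \<le> (1 / 2) ^ (Suc k + 1) / 4096"
    by (intro divide_right_mono power_decreasing) auto
  finally show ?case .
qed

section \<open>Connected cores of good cells\<close>

definition Zc :: "((int \<times> int) \<times> nat) set set \<Rightarrow> ((int \<times> int) \<times> (int \<times> int)) set" where
  "Zc S = {(a, b). opn S a b}\<^sup>*"

lemma Zc_sym: "(a, b) \<in> Zc S \<Longrightarrow> (b, a) \<in> Zc S"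
proof -
  have "sym {(a, b). opn S a b}" by (rule symI) (auto intro: opn_sym)
  then show "(a, b) \<in> Zc S \<Longrightarrow> (b, a) \<in> Zc S" unfolding Zc_def by (meson sym_rtrancl symD)
qed

lemma Zc_trans: "(a, b) \<in> Zc S \<Longrightarrow> (b, c) \<in> Zc S \<Longrightarrow> (a, c) \<in> Zc S"
  unfolding Zc_def by (rule rtrancl_trans)

definition row_ok :: "nat \<Rightarrow> int \<times> int \<Rightarrow> int \<Rightarrow> ((int \<times> int) \<times> nat) set set \<Rightarrow> bool" where
  "row_ok k z y S \<longleftrightarrow> y \<in> {0..<8} \<and> (\<forall>t\<in>{0..<8}. \<not> bad k (subcell z (t, y)) S)"

definition col_ok :: "nat \<Rightarrow> int \<times> int \<Rightarrow> int \<Rightarrow> ((int \<times> int) \<times> nat) set set \<Rightarrow> bool" where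
  "col_ok k z x S \<longleftrightarrow> x \<in> {0..<8} \<and> (\<forall>t\<in>{0..<8}. \<not> bad k (subcell z (x, t)) S)"

text \<open>The sites reached through good rows and columns at every scale. The core of a good cell
  lies in one cluster of open pairs, and above scale 0 the cores of adjacent good cells both contain
  the core of a common subcell.\<close>

primrec core :: "nat \<Rightarrow> int \<times> int \<Rightarrow> ((int \<times> int) \<times> nat) set set \<Rightarrow> (int \<times> int) set" where
  "core 0 z S = {z}"
| "core (Suc k) z S = (\<Union>i\<in>{i \<in> window. row_ok k z (snd i) S \<or> col_ok k z (fst i) S}. core k (subcell z i) S)"

lemma core_cellbox: "core k z S \<subseteq> cellbox k z"
proof (induction k arbitrary: z)
  case 0
  then show ?case by (cases z) (simp add: cellbox_def)
next
  case (Suc k)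
  have "core k (subcell z i) S \<subseteq> cellbox (Suc k) z" if "i \<in> window" for i
    using Suc[of "subcell z i"] cellbox_subcell[OF that, of k z] by blast
  then show ?case unfolding core.simps by blast
qed

text \<open>In a good window the bad rows have pairwise distance at most 2, and so do the bad
  columns. The same row index has to serve both cells because windows shifted horizontally share
  cells row by row; likewise for columns.\<close>

lemma ok_common:
  assumes "\<not> bad (Suc k) z S" "\<not> bad (Suc k) z' S"
  shows "\<exists>y. row_ok k z y S \<and> row_ok k z' y S" "\<exists>x. col_ok k z x S \<and> col_ok k z' x S"
proof -
  have thin: "\<bar>y - y'\<bar> \<le> 2" "\<bar>x - x'\<bar> \<le> 2"
    if "\<not> bad (Suc k) z S" "bad k (subcell z (x, y)) S" "bad k (subcell z (x', y')) S"
      "x \<in> {0..<8}" "y \<in> {0..<8}" "x' \<in> {0..<8}" "y' \<in> {0..<8}" for x y x' y' z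
  proof -
    have "((x, y), (x', y')) \<in> window \<times> window" using that(4-7) by (simp add: window_def)
    moreover have "\<forall>ij\<in>window \<times> window. \<not> (far (fst ij) (snd ij) \<and> bad k (subcell z (fst ij)) S \<and> bad k (subcell z (snd ij)) S)"
      using that(1) unfolding bad.simps by blast
    ultimately have "\<not> (far (x, y) (x', y') \<and> bad k (subcell z (x, y)) S \<and> bad k (subcell z (x', y')) S)"
      by (metis fst_conv snd_conv)
    then have "\<not> far (x, y) (x', y')" using that(2,3) by simp
    then show "\<bar>y - y'\<bar> \<le> 2" "\<bar>x - x'\<bar> \<le> 2" unfolding far_def by auto
  qed
  let ?R = "\<lambda>z. {y \<in> {0..<8}. \<exists>t\<in>{0..<8}. bad k (subcell z (t, y)) S}"
  let ?C = "\<lambda>z. {x \<in> {0..<8}. \<exists>t\<in>{0..<8}. bad k (subcell z (x, t)) S}"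
  have "\<exists>y\<in>{0..<8}. y \<notin> ?R z \<and> y \<notin> ?R z'"
    by (rule thin_sets_miss) (use thin assms in blast)+
  then show "\<exists>y. row_ok k z y S \<and> row_ok k z' y S" unfolding row_ok_def by blast
  have "\<exists>y\<in>{0..<8}. y \<notin> ?C z \<and> y \<notin> ?C z'"
    by (rule thin_sets_miss) (use thin assms in blast)+
  then show "\<exists>x. col_ok k z x S \<and> col_ok k z' x S" unfolding col_ok_def by blast
qed

definition core_conn :: "nat \<Rightarrow> ((int \<times> int) \<times> nat) set set \<Rightarrow> bool" where
  "core_conn k S \<longleftrightarrow> (\<forall>z z'. \<not> bad k z S \<longrightarrow> \<not> bad k z' S \<longrightarrow> z' = z \<or> z' = z + (1, 0) \<or> z' = z + (0, 1) \<longrightarrow>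
     core k z S \<noteq> {} \<and> core k z S \<times> core k z' S \<subseteq> Zc S)"

lemma chain_Zc:
  assumes "\<And>i. i < n \<Longrightarrow> C i \<noteq> {} \<and> C i \<times> C i \<subseteq> Zc S"
    "\<And>i. Suc i < n \<Longrightarrow> C i \<times> C (Suc i) \<subseteq> Zc S"
  shows "i < n \<Longrightarrow> j < n \<Longrightarrow> C i \<times> C j \<subseteq> Zc S"
proof -
  have le: "C i \<times> C (i + d) \<subseteq> Zc S" if "i + d < n" for i d
    using that
  proof (induction d)
    case 0
    then show ?case using assms(1) by simp
  next
    case (Suc d)
    then have "C i \<times> C (i + d) \<subseteq> Zc S" "C (i + d) \<times> C (i + Suc d) \<subseteq> Zc S" "C (i + d) \<noteq> {}"
      using assms by auto
    then show ?case using Zc_trans by blast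
  qed
  assume ij: "i < n" "j < n"
  show ?thesis
  proof (cases "i \<le> j")
    case True
    then show ?thesis using le[of i "j - i"] ij by simp
  next
    case False
    then have "C j \<times> C i \<subseteq> Zc S" using le[of j "i - j"] ij by simp
    then show ?thesis using Zc_sym by blast
  qed
qed

text \<open>Consecutive cells of a good line are good, so \<open>core_conn\<close> at the lower
  scale joins their cores along the line. Every good row meets every good column in a good cell,
  hence all good lines of the window are joined to the crossing \<open>(x0, y0)\<close>.\<close>

lemma line_Zc:
  assumes "core_conn k S" "\<not> bad (Suc k) z S"
    and i: "i \<in> window" "row_ok k z (snd i) S \<or> col_ok k z (fst i) S"
    and j: "j \<in> window" "row_ok k z (snd j) S \<or> col_ok k z (fst j) S"
  shows "core k (subcell z i) S \<noteq> {}" "core k (subcell z i) S \<times> core k (subcell z j) S \<subseteq> Zc S"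
proof -
  have cc: "core k z S \<noteq> {} \<and> core k z S \<times> core k z' S \<subseteq> Zc S"
    if "\<not> bad k z S" "\<not> bad k z' S" "z' = z \<or> z' = z + (1, 0) \<or> z' = z + (0, 1)" for z z'
    using assms(1) that unfolding core_conn_def by blast
  have line: "core k (subcell z (g a)) S \<times> core k (subcell z (g b)) S \<subseteq> Zc S"
    if ok: "\<And>n. n < 8 \<Longrightarrow> \<not> bad k (subcell z (g n)) S"
      and step: "\<And>n. subcell z (g (Suc n)) = subcell z (g n) + (1, 0) \<or> subcell z (g (Suc n)) = subcell z (g n) + (0, 1)"
      and ab: "a < 8" "b < 8" for g :: "nat \<Rightarrow> int \<times> int" and a b
    using ab
  proof (rule chain_Zc[rotated 2])
    fix i :: nat
    show "core k (subcell z (g i)) S \<noteq> {} \<and> core k (subcell z (g i)) S \<times> core k (subcell z (g i)) S \<subseteq> Zc S"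
      if "i < 8" using cc[OF ok[OF that] ok[OF that]] by simp
    show "core k (subcell z (g i)) S \<times> core k (subcell z (g (Suc i))) S \<subseteq> Zc S" if "Suc i < 8"
      using cc[OF ok[of i] ok[OF that]] step[of i] that by auto
  qed
  have row: "core k (subcell z (s, y)) S \<times> core k (subcell z (t, y)) S \<subseteq> Zc S"
    if "row_ok k z y S" "s \<in> {0..<8}" "t \<in> {0..<8}" for y s t
    using line[of "\<lambda>n. (int n, y)" "nat s" "nat t"] that unfolding row_ok_def by (simp add: subcell_def nat_less_iff)
  have col: "core k (subcell z (x, s)) S \<times> core k (subcell z (x, t)) S \<subseteq> Zc S"
    if "col_ok k z x S" "s \<in> {0..<8}" "t \<in> {0..<8}" for x s t
    using line[of "\<lambda>n. (x, int n)" "nat s" "nat t"] that unfolding col_ok_def by (simp add: subcell_def nat_less_iff)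
  have nonempty: "core k (subcell z i) S \<noteq> {}"
    if "i \<in> window" "row_ok k z (snd i) S \<or> col_ok k z (fst i) S" for i
  proof -
    have "\<not> bad k (subcell z i) S" using that unfolding row_ok_def col_ok_def window_def by (cases i) auto
    then show ?thesis using cc by blast
  qed
  show "core k (subcell z i) S \<noteq> {}" using nonempty i by blast
  have cross: "core k (subcell z i) S \<times> core k (subcell z j) S \<subseteq> Zc S"
    if "i \<in> window" "j \<in> window" "row_ok k z (snd i) S" "col_ok k z (fst j) S" for i j
  proof -
    obtain a b where i: "i = (a, b)" by (cases i)
    obtain c d where j: "j = (c, d)" by (cases j)
    have r: "a \<in> {0..<8}" "b \<in> {0..<8}" "c \<in> {0..<8}" "d \<in> {0..<8}"
      using that(1,2) unfolding i j window_def by auto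
    have "core k (subcell z (c, b)) S \<noteq> {}"
      using nonempty[of "(c, b)"] r that unfolding i window_def by auto
    moreover have "core k (subcell z (a, b)) S \<times> core k (subcell z (c, b)) S \<subseteq> Zc S"
      using row[of b a c] r that i by simp
    moreover have "core k (subcell z (c, b)) S \<times> core k (subcell z (c, d)) S \<subseteq> Zc S"
      using col[of c b d] r that j by simp
    ultimately show ?thesis unfolding i j using Zc_trans by blast
  qed
  obtain x0 y0 where ok: "row_ok k z y0 S" "col_ok k z x0 S" using ok_common assms(2) by blast
  have w: "(x0, y0) \<in> window" using ok unfolding row_ok_def col_ok_def window_def by auto
  have to: "core k (subcell z i) S \<times> core k (subcell z (x0, y0)) S \<subseteq> Zc S"
    if i: "i \<in> window" "row_ok k z (snd i) S \<or> col_ok k z (fst i) S" for i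
    using i(2)
  proof
    assume "row_ok k z (snd i) S"
    then show ?thesis using cross[of i "(x0, y0)"] i w ok by simp
  next
    assume "col_ok k z (fst i) S"
    then have "core k (subcell z (x0, y0)) S \<times> core k (subcell z i) S \<subseteq> Zc S"
      using cross[of "(x0, y0)" i] i w ok by simp
    then show ?thesis using Zc_sym by blast
  qed
  have "core k (subcell z (x0, y0)) S \<noteq> {}" using nonempty[OF w] ok by simp
  then show "core k (subcell z i) S \<times> core k (subcell z j) S \<subseteq> Zc S"
    using to[OF i] to[OF j] Zc_sym Zc_trans by blast
qed

lemma core_conn: "core_conn k S"
proof (induction k)
  case 0
  show ?case unfolding core_conn_def
  proof (intro allI impI)
    fix z z' assume a: "\<not> bad 0 z S" "\<not> bad 0 z' S" "z' = z \<or> z' = z + (1, 0) \<or> z' = z + (0, 1)"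
    then have "(z, z') \<in> Zc S" unfolding Zc_def bad.simps by auto
    then show "core 0 z S \<noteq> {} \<and> core 0 z S \<times> core 0 z' S \<subseteq> Zc S" by simp
  qed
next
  case (Suc k)
  show ?case unfolding core_conn_def
  proof (intro allI impI)
    fix z z' assume a: "\<not> bad (Suc k) z S" "\<not> bad (Suc k) z' S" "z' = z \<or> z' = z + (1, 0) \<or> z' = z + (0, 1)"
    obtain i i' where i: "i \<in> window" "row_ok k z (snd i) S \<or> col_ok k z (fst i) S"
      and i': "i' \<in> window" "row_ok k z' (snd i') S \<or> col_ok k z' (fst i') S"
      and eq: "subcell z i = subcell z' i'"
    proof -
      obtain x y where xy: "row_ok k z y S" "row_ok k z' y S" "col_ok k z x S" "col_ok k z' x S"
        using ok_common[OF a(1,2)] by blast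
      have r: "x \<in> {0..<8}" "y \<in> {0..<8}" using xy unfolding row_ok_def col_ok_def by auto
      from a(3) consider "z' = z" | "z' = z + (1, 0)" | "z' = z + (0, 1)" by blast
      then show ?thesis
      proof cases
        case 1
        then show ?thesis using that[of "(x, y)" "(x, y)"] xy r unfolding window_def by auto
      next
        case 2
        \<comment> \<open>Since \<open>4 * z + 4 = 4 * (z + 1) + 0\<close>, the fifth column of one
          window is the first of the next.\<close>
        then show ?thesis using that[of "(4, y)" "(0, y)"] xy r unfolding window_def subcell_def by auto
      next
        case 3
        then show ?thesis using that[of "(x, 4)" "(x, 0)"] xy r unfolding window_def subcell_def by auto
      qed
    qed
    let ?c = "core k (subcell z i) S"
    have c: "?c \<noteq> {}" using line_Zc(1)[OF Suc a(1) i i] .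
    have "?c \<subseteq> core (Suc k) z S" using i by auto
    moreover have "core (Suc k) z S \<times> ?c \<subseteq> Zc S"
      using line_Zc(2)[OF Suc a(1) _ _ i] by auto
    moreover have "core (Suc k) z' S \<times> ?c \<subseteq> Zc S"
      using line_Zc(2)[OF Suc a(2) _ _ i'] unfolding eq by auto
    ultimately show "core (Suc k) z S \<noteq> {} \<and> core (Suc k) z S \<times> core (Suc k) z' S \<subseteq> Zc S"
      using c Zc_sym Zc_trans by blast
  qed
qed

text \<open>The window of the cell \<open>(0, 0)\<close> of scale \<open>k+1\<close> consists of the
  scale-\<open>k\<close> cells \<open>i \<in> window\<close>, so the cores at the origin increase.
  The increase is strict because the box of \<open>(7, 7)\<close> is disjoint from that of
  \<open>(0, 0)\<close>.\<close>

lemma infinite_Zc_class: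
  assumes good: "\<And>k i. K \<le> k \<Longrightarrow> i \<in> window \<Longrightarrow> \<not> bad k i S"
  shows "\<exists>Y. infinite Y \<and> Y \<times> Y \<subseteq> Zc S"
proof -
  let ?C = "\<lambda>k. core k (0, 0) S"
  have w: "(0, 0) \<in> window" "(7, 7) \<in> window" unfolding window_def by auto
  have ne: "core k i S \<noteq> {}" if "K \<le> k" "i \<in> window" for k i
    using core_conn[of k S] good[OF that] unfolding core_conn_def by blast
  have sub: "core k i S \<subseteq> ?C (Suc k)" if "K \<le> k" "i \<in> window" for k i
  proof -
    have "row_ok k (0, 0) (snd i) S" unfolding row_ok_def
      using that good[OF that(1)] unfolding window_def subcell_def by auto
    then have "core k (subcell (0, 0) i) S \<subseteq> ?C (Suc k)" using that by auto
    then show ?thesis by (simp add: subcell_def)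
  qed
  have fin: "finite (core k z S)" for k z
    by (rule finite_subset[OF core_cellbox]) (simp add: cellbox_def)
  have strict: "card (?C k) < card (?C (Suc k))" if "K \<le> k" for k
  proof -
    have "cellbox k (subcell (0, 0) (0, 0)) \<inter> cellbox k (subcell (0, 0) (7, 7)) = {}"
      by (rule cellbox_far) (simp add: far_def)
    then have disj: "?C k \<inter> core k (7, 7) S = {}" using core_cellbox[of k "(0, 0)" S] core_cellbox[of k "(7, 7)" S]
      by (auto simp: subcell_def)
    have "?C k \<subset> ?C (Suc k)" using sub[OF that w(1)] sub[OF that w(2)] ne[OF that w(2)] disj by blast
    then show ?thesis by (rule psubset_card_mono[OF fin])
  qed
  have mono: "?C (K + j) \<subseteq> ?C (K + j + d)" for j d
  proof (induction d)
    case (Suc d)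
    then show ?case using sub[OF _ w(1), of "K + j + d"] by auto
  qed simp
  have big: "j \<le> card (?C (K + j))" for j
  proof (induction j)
    case (Suc j)
    then show ?case using strict[of "K + j"] by simp
  qed simp
  define Y where "Y = (\<Union>j. ?C (K + j))"
  have "infinite Y"
  proof
    assume f: "finite Y"
    have "Suc (card Y) \<le> card (?C (K + Suc (card Y)))" by (rule big)
    also have "\<dots> \<le> card Y" by (rule card_mono[OF f], unfold Y_def) blast
    finally show False by simp
  qed
  moreover have "(a, b) \<in> Zc S" if ab: "a \<in> Y" "b \<in> Y" for a b
  proof -
    obtain i j where "a \<in> ?C (K + i)" "b \<in> ?C (K + j)"
      using ab unfolding Y_def by blast
    then have m: "a \<in> ?C (K + i + j)" "b \<in> ?C (K + i + j)"
      using subsetD[OF mono[of i j], of a] subsetD[OF mono[of j i], of b] by (simp_all only: add.assoc add.commute[of j i])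
    have g: "\<not> bad (K + i + j) (0, 0) S" by (rule good) (use w in simp_all)
    have "?C (K + i + j) \<times> ?C (K + i + j) \<subseteq> Zc S"
      using core_conn[of "K + i + j" S] g unfolding core_conn_def by blast
    then show ?thesis using m by blast
  qed
  ultimately show ?thesis by blast
qed

text \<open>Open pairs sharing a site have majorities of the same set \<open>A\<close> in that
  layer, and these meet; so one component follows the whole cluster and visits infinitely many
  layers.\<close>

lemma infinite_component:
  assumes "infinite Y" "Y \<times> Y \<subseteq> Zc S"
  shows "has_infinite_component S"
proof -
  obtain a0 where a0: "a0 \<in> Y" using infinite_imp_nonempty[OF assms(1)] by blast
  have "infinite (Y - {a0})" using assms(1) by simp
  then obtain b0 where b0: "b0 \<in> Y" "b0 \<noteq> a0" using infinite_imp_nonempty by blast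
  have ab: "(a0, b0) \<in> {(a, b). opn S a b}\<^sup>*"
    using subsetD[OF assms(2), of "(a0, b0)"] a0 b0(1) unfolding Zc_def by simp
  obtain a1 where "opn S a0 a1"
    using ab
  proof (cases rule: converse_rtranclE)
    case base
    then show ?thesis using b0(2) by simp
  next
    case (step y)
    then show ?thesis using that by simp
  qed
  then obtain c where "maj S ({a0, a1} \<times> V) c a0 A" unfolding opn_def by blast
  then have c: "maj S UNIV c a0 A" by (rule maj_mono) (simp_all add: conn_refl finA)
  have all: "maj S UNIV c b A" if "(a0, b) \<in> Zc S" for b
    using that unfolding Zc_def
  proof (induction rule: rtrancl_induct)
    case base
    then show ?case by (rule c)
  next
    case (step a b)
    then have "opn S a b" by simp
    then obtain d where d0: "maj S ({a, b} \<times> V) d a A" "maj S ({a, b} \<times> V) d b A" unfolding opn_def by blast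
    note d = maj_mono[OF d0(1) subset_UNIV conn_refl finA] maj_mono[OF d0(2) subset_UNIV conn_refl finA]
    have "conn S UNIV d c" using maj_meet[OF d(1) step.IH finA] .
    then show ?case by (rule maj_mono[OF d(2) subset_UNIV _ finA])
  qed
  have "\<exists>x. (b, x) \<in> (adj S)\<^sup>* `` {c}" if "b \<in> Y" for b
  proof -
    have "maj S UNIV c b A" by (rule all, rule subsetD[OF assms(2)]) (use a0 that in simp)
    then have "card {x \<in> A. conn S UNIV c (b, x)} \<noteq> 0" unfolding maj_def by linarith
    then have "{x \<in> A. conn S UNIV c (b, x)} \<noteq> {}" by (metis card.empty)
    then obtain x where "conn S UNIV c (b, x)" by blast
    then show ?thesis using conn_full[of S UNIV c "(b, x)"] by blast
  qed
  then have "Y \<subseteq> fst ` ((adj S)\<^sup>* `` {c})" by force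
  then have "infinite ((adj S)\<^sup>* `` {c})" using assms(1) finite_subset by blast
  then show ?thesis unfolding has_infinite_component_def by blast
qed

lemma renorm_percolates:
  assumes "\<And>z. 1 - 1 / 16384 \<le> pr (\<lambda>S. opn S z (z + (1, 0)))"
    "\<And>z. 1 - 1 / 16384 \<le> pr (\<lambda>S. opn S z (z + (0, 1)))"
  shows "percolates \<mu>"
proof -
  have fw: "finite window" "card window = 64" unfolding window_def by simp_all
  let ?B = "\<lambda>k. {S \<in> Pow E. \<exists>i\<in>window. bad k i S}"
  let ?W = "\<lambda>k. (\<Union>i\<in>window. cellbox k i) \<times> V"
  have finW: "finite (?W k)" for k using fw finV by (auto simp: cellbox_def)
  have d: "dep (?W k) (bad k i)" if "i \<in> window" for k i
    by (rule dep_mono[OF dep_bad[of k i]]) (use that in auto)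
  have meas: "?B k \<in> events" for k
    unfolding Bex_def by (rule dep_event[OF finW[of k]]) (intro dep_ex dep_guard d)
  have bound: "prob (?B k) \<le> (1 / 2) ^ k" for k
  proof -
    have "prob (?B k) = pr (\<lambda>S. \<exists>i\<in>window. bad k i S)" by (simp add: pr_def)
    also have "\<dots> \<le> (\<Sum>i\<in>window. pr (bad k i))" by (rule pr_Bex_le[OF fw(1) finW[of k] d])
    also have "\<dots> \<le> (\<Sum>i\<in>window. (1 / 2) ^ (k + 1) / 4096)" by (intro sum_mono pr_bad assms)
    also have "\<dots> \<le> (1 / 2) ^ k" using fw by simp
    finally show ?thesis .
  qed
  have "summable (\<lambda>k. prob (?B k))"
    by (rule summable_comparison_test'[of "\<lambda>k. (1 / 2) ^ k" 0])
      (use bound in \<open>auto intro: summable_geometric\<close>)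
  then have "AE S in \<mu>. eventually (\<lambda>k. S \<in> space \<mu> - ?B k) sequentially"
    by (intro borel_cantelli_AE1 meas) (simp_all add: emeasure_eq_measure)
  then show ?thesis
    unfolding percolates_def
  proof (rule AE_mp, intro AE_I2 impI)
    fix S assume S: "S \<in> space \<mu>" "eventually (\<lambda>k. S \<in> space \<mu> - ?B k) sequentially"
    then obtain K where "\<And>k. K \<le> k \<Longrightarrow> S \<in> space \<mu> - ?B k" unfolding eventually_sequentially by blast
    then have "\<And>k i. K \<le> k \<Longrightarrow> i \<in> window \<Longrightarrow> \<not> bad k i S" using S(1) unfolding space_eq by blast
    then show "has_infinite_component S" using infinite_Zc_class infinite_component by blast
  qed
qed

end

section \<open>Combinatorial and numerical inequalities\<close>

text \<open>\<open>f\<close> will label vertices by their components. If no component has a majority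
  on both sides, components can be merged into boundedly many groups while at most half of all pairs
  stay inside a group. A bounded number matters because each pair of groups costs a pseudorandomness
  error, whereas the number of components is not bounded.\<close>

lemma three_groups:
  fixes f :: "'x \<Rightarrow> 'l" and A B :: "'x set"
  assumes fin: "finite A" "finite B"
    and no: "\<And>l. \<not> (card A < 2 * card {x \<in> A. f x = l} \<and> card B < 2 * card {x \<in> B. f x = l})"
  shows "\<exists>g :: 'l \<Rightarrow> nat. (\<forall>l. g l < 3) \<and>
    2 * (\<Sum>k<3. card {x \<in> A. g (f x) = k} * card {x \<in> B. g (f x) = k}) \<le> card A * card B"
proof -
  define a where "a L = card {x \<in> A. f x \<in> L}" for L
  define b where "b L = card {x \<in> B. f x \<in> L}" for L
  define L where "L = f ` (A \<union> B)"
  have finL: "finite L" using fin by (simp add: L_def)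
  \<comment> \<open>Either one class \<open>D\<close> has a majority in exactly one set, or a maximal union \<open>P\<close> of classes with at most
    half of both sets, one further class \<open>D\<close>, and the rest all have at most half of one and the same set.\<close>
  let ?Q = "{P. P \<subseteq> L \<and> 2 * a P \<le> card A \<and> 2 * b P \<le> card B}"
  have "finite ?Q" using finL by simp
  moreover have "{} \<in> ?Q" by (simp add: a_def b_def)
  ultimately obtain P where P: "P \<in> ?Q" and max: "\<And>P'. P' \<in> ?Q \<Longrightarrow> P \<subseteq> P' \<Longrightarrow> P' = P"
    using finite_has_maximal[of ?Q] by (metis (no_types, lifting) empty_iff)
  show ?thesis
  proof (cases "P = L")
    case True
    have "{x \<in> A. f x \<in> L} = A" by (auto simp: L_def)
    then have "a P = card A" unfolding a_def True by simp
    then have "A = {}" using P fin by auto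
    then show ?thesis by (intro exI[of _ "\<lambda>_. 0"]) simp
  next
    case False
    then obtain D where D: "D \<in> L" "D \<notin> P" using P by blast
    define aP bP aD bD where "aP = a P" and "bP = b P" and "aD = a {D}" and "bD = b {D}"
    have split: "card {x \<in> X. f x \<in> P \<union> {D}} = card {x \<in> X. f x \<in> P} + card {x \<in> X. f x \<in> {D}}"
      if "finite X" for X
      using that D by (subst card_Un_disjoint[symmetric]) (auto intro!: arg_cong[where f=card])
    have compl: "card {x \<in> X. \<not> Q (f x)} + card {x \<in> X. Q (f x)} = card X" if "finite X" for X Q
      using that by (subst card_Un_disjoint[symmetric]) (auto intro!: arg_cong[where f=card])
    have violate: "card A < 2 * (aP + aD) \<or> card B < 2 * (bP + bD)"
    proof (rule ccontr)
      assume "\<not> ?thesis"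
      then have "P \<union> {D} \<in> ?Q"
        using P D split[OF fin(1)] split[OF fin(2)] unfolding aP_def bP_def aD_def bD_def a_def b_def by auto
      then show False using max[of "P \<union> {D}"] D by blast
    qed
    have P2: "2 * aP \<le> card A" "2 * bP \<le> card B" using P by (auto simp: aP_def bP_def)
    have noD: "\<not> (card A < 2 * aD \<and> card B < 2 * bD)"
      using no[of D] by (simp add: aD_def bD_def a_def b_def)
    have sum3: "(\<Sum>k<3. h k) = h 0 + h 1 + h 2" for h :: "nat \<Rightarrow> nat"
      by (simp add: eval_nat_numeral)
    show ?thesis
    proof (cases "card A < 2 * aD \<or> card B < 2 * bD")
      case True
      let ?g = "\<lambda>l. if l = D then 1 else (0 :: nat)"
      have c: "card {x \<in> A. ?g (f x) = 1} = aD" "card {x \<in> B. ?g (f x) = 1} = bD"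
        "card {x \<in> A. ?g (f x) = 2} = 0"
        by (auto simp: aD_def bD_def a_def b_def intro: arg_cong[where f=card])
      have c0: "card {x \<in> A. ?g (f x) = 0} + aD = card A" "card {x \<in> B. ?g (f x) = 0} + bD = card B"
      proof -
        have "{x \<in> X. ?g (f x) = 0} = {x \<in> X. \<not> f x = D}" for X by auto
        then show "card {x \<in> A. ?g (f x) = 0} + aD = card A" "card {x \<in> B. ?g (f x) = 0} + bD = card B"
          using compl[OF fin(1), of "\<lambda>l. l = D"] compl[OF fin(2), of "\<lambda>l. l = D"]
          unfolding aD_def bD_def a_def b_def by simp_all
      qed
      define a0 b0 where "a0 = card {x \<in> A. ?g (f x) = 0}" and "b0 = card {x \<in> B. ?g (f x) = 0}"
      have "(a0 \<le> aD \<and> bD \<le> b0) \<or> (aD \<le> a0 \<and> b0 \<le> bD)"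
        using True noD c0 unfolding a0_def[symmetric] b0_def[symmetric] by linarith
      then have "(int a0 - int aD) * (int b0 - int bD) \<le> 0"
        by (auto simp: mult_le_0_iff)
      then have "int (2 * (a0 * b0 + aD * bD)) \<le> int ((a0 + aD) * (b0 + bD))"
        by (simp add: algebra_simps)
      then have "2 * (a0 * b0 + aD * bD) \<le> card A * card B"
        using c0 unfolding a0_def[symmetric] b0_def[symmetric] by (simp only: of_nat_le_iff)
      then have "2 * (\<Sum>k<3. card {x \<in> A. ?g (f x) = k} * card {x \<in> B. ?g (f x) = k}) \<le> card A * card B"
        unfolding sum3 c a0_def b0_def by simp
      then show ?thesis by (intro exI[of _ ?g]) simp
    next
      case False
      let ?g = "\<lambda>l. if l \<in> P then 0 else if l = D then 1 else (2 :: nat)"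
      have c: "card {x \<in> A. ?g (f x) = 0} = aP" "card {x \<in> B. ?g (f x) = 0} = bP"
        "card {x \<in> A. ?g (f x) = 1} = aD" "card {x \<in> B. ?g (f x) = 1} = bD"
        unfolding aP_def bP_def aD_def bD_def a_def b_def using D
        by (auto intro!: arg_cong[where f=card])
      define a2 b2 where "a2 = card {x \<in> A. ?g (f x) = 2}" and "b2 = card {x \<in> B. ?g (f x) = 2}"
      have c2: "a2 + (aP + aD) = card A" "b2 + (bP + bD) = card B"
      proof -
        have "{x \<in> X. ?g (f x) = 2} = {x \<in> X. \<not> f x \<in> P \<union> {D}}" for X by auto
        then show "a2 + (aP + aD) = card A" "b2 + (bP + bD) = card B"
          using compl[OF fin(1), of "\<lambda>l. l \<in> P \<union> {D}"] compl[OF fin(2), of "\<lambda>l. l \<in> P \<union> {D}"]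
            split[OF fin(1)] split[OF fin(2)]
          unfolding a2_def b2_def aP_def bP_def aD_def bD_def a_def b_def by simp_all
      qed
      have "2 * (aP * bP + aD * bD + a2 * b2) \<le> card A * card B"
        using violate
      proof
        assume "card A < 2 * (aP + aD)"
        then have "2 * a2 \<le> card A" using c2(1) by simp
        then have l: "2 * aP \<le> card A" "2 * aD \<le> card A" "2 * a2 \<le> card A" using P2 False by auto
        have "2 * (aP * bP + aD * bD + a2 * b2) = (2 * aP) * bP + (2 * aD) * bD + (2 * a2) * b2" by simp
        also have "\<dots> \<le> card A * bP + card A * bD + card A * b2" by (intro add_mono mult_right_mono l) auto
        also have "\<dots> = card A * card B" unfolding c2(2)[symmetric] by (simp add: algebra_simps)
        finally show ?thesis .
      next
        assume "card B < 2 * (bP + bD)"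
        then have "2 * b2 \<le> card B" using c2(2) by simp
        then have l: "2 * bP \<le> card B" "2 * bD \<le> card B" "2 * b2 \<le> card B" using P2 False by auto
        have "2 * (aP * bP + aD * bD + a2 * b2) = aP * (2 * bP) + aD * (2 * bD) + a2 * (2 * b2)" by simp
        also have "\<dots> \<le> aP * card B + aD * card B + a2 * card B" by (intro add_mono mult_left_mono l) auto
        also have "\<dots> = card A * card B" unfolding c2(1)[symmetric] by (simp add: algebra_simps)
        finally show ?thesis .
      qed
      then have "2 * (\<Sum>k<3. card {x \<in> A. ?g (f x) = k} * card {x \<in> B. ?g (f x) = k}) \<le> card A * card B"
        unfolding sum3 c a2_def b2_def .
      then show ?thesis by (intro exI[of _ ?g]) simp
    qed
  qed
qed

section \<open>Stable scales by averaging over permutations\<close>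

lemma permutation_exists:
  fixes A B :: "nat set"
  assumes "A \<subseteq> {..<T}" "B \<subseteq> {..<T}" "card A = card B" "a < T" "b < T" "a \<notin> A" "b \<notin> B"
  shows "\<exists>\<sigma>. \<sigma> permutes {..<T} \<and> \<sigma> b = a \<and> \<sigma> ` B = A"
proof -
  have fin: "finite A" "finite B" using assms(1,2) finite_subset by blast+
  obtain h1 where h1: "bij_betw h1 B A" using fin assms(3) finite_same_card_bij by metis
  have "card ({..<T} - insert b B) = card ({..<T} - insert a A)"
    using assms fin by (simp add: card_Diff_subset)
  then obtain h2 where h2: "bij_betw h2 ({..<T} - insert b B) ({..<T} - insert a A)"
    using finite_same_card_bij[of "{..<T} - insert b B" "{..<T} - insert a A"] by auto
  define \<sigma> where "\<sigma> x = (if x \<in> B then h1 x else if x = b then a else if x < T then h2 x else x)" for x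
  have 1: "bij_betw \<sigma> B A" using h1 by (rule bij_betw_cong[THEN iffD1, rotated]) (simp add: \<sigma>_def)
  have 2: "bij_betw \<sigma> {b} {a}" using assms(7) by (simp add: bij_betw_def \<sigma>_def)
  have 3: "bij_betw \<sigma> ({..<T} - insert b B) ({..<T} - insert a A)"
    using h2 by (rule bij_betw_cong[THEN iffD1, rotated]) (auto simp: \<sigma>_def)
  have "bij_betw \<sigma> ((B \<union> {b}) \<union> ({..<T} - insert b B)) ((A \<union> {a}) \<union> ({..<T} - insert a A))"
    by (intro bij_betw_combine 1 2 3) (use assms in auto)
  moreover have "(B \<union> {b}) \<union> ({..<T} - insert b B) = {..<T}" "(A \<union> {a}) \<union> ({..<T} - insert a A) = {..<T}"
    using assms by auto
  ultimately have "bij_betw \<sigma> {..<T} {..<T}" by simp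
  moreover have "\<sigma> x = x" if "x \<notin> {..<T}" for x using that assms(2,5) by (auto simp: \<sigma>_def)
  ultimately have "\<sigma> permutes {..<T}" by (rule bij_imp_permutes)
  moreover have "\<sigma> b = a" using assms(7) by (simp add: \<sigma>_def)
  moreover have "\<sigma> ` B = A" using 1 by (simp add: bij_betw_def)
  ultimately show ?thesis by blast
qed

primrec scale_seq :: "nat \<Rightarrow> nat \<Rightarrow> nat" where
  "scale_seq k 0 = 1"
| "scale_seq k (Suc j) = 2 * scale_seq k j + k"

lemma scale_seq_pos: "1 \<le> scale_seq k j" by (induction j) auto

lemma scale_seq_mono: "i \<le> j \<Longrightarrow> scale_seq k i \<le> scale_seq k j"
  by (rule lift_Suc_mono_le[of "scale_seq k"]) auto

text \<open>
  Averaging over all permutations of the indices, the mean of \<open>f\<close> depends only on the number of indices. As it is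
  monotone and bounded, its increment is small for some step of the scales \<open>s \<mapsto> 2s + k\<close>.
\<close>

definition stable_triple :: "(nat \<Rightarrow> nat set \<Rightarrow> real) \<Rightarrow> real \<Rightarrow> nat \<Rightarrow> nat set \<Rightarrow> nat set \<Rightarrow> nat set \<Rightarrow> nat set \<Rightarrow> bool" where
  "stable_triple f \<xi> k J I1 I2 Z \<longleftrightarrow> I1 \<union> I2 \<union> Z \<subseteq> J \<and> I1 \<inter> I2 = {} \<and> I1 \<inter> Z = {} \<and> I2 \<inter> Z = {} \<and>
     I1 \<noteq> {} \<and> I2 \<noteq> {} \<and> card Z = k \<and>
     (\<Sum>z\<in>Z. f z (I1 \<union> I2 \<union> Z - {z}) - f z I1) \<le> \<xi> \<and> (\<Sum>z\<in>Z. f z (I1 \<union> I2 \<union> Z - {z}) - f z I2) \<le> \<xi>"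

lemma stable_choice_lessThan:
  fixes \<xi> :: real and k N :: nat
  assumes "0 < \<xi>" "0 < N" "2 * Suc k \<le> \<xi> * N" and T: "T = scale_seq k N + 1"
    and mono: "\<And>z I I'. z < T \<Longrightarrow> I \<subseteq> I' \<Longrightarrow> I' \<subseteq> {..<T} \<Longrightarrow> f z I \<le> f z I'"
    and rng: "\<And>z I. z < T \<Longrightarrow> I \<subseteq> {..<T} \<Longrightarrow> 0 \<le> f z I \<and> f z I \<le> (1 :: real)"
  shows "\<exists>I1 I2 Z. stable_triple f \<xi> (Suc k) {..<T} I1 I2 Z"
proof -
  let ?\<Pi> = "{\<pi>. \<pi> permutes {..<T}}"
  have fin\<Pi>: "finite ?\<Pi>" by (simp add: finite_permutations)
  have ne\<Pi>: "id \<in> ?\<Pi>" by (simp add: permutes_id)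
  define Gs where "Gs z A = (\<Sum>\<pi>\<in>?\<Pi>. f (\<pi> z) (\<pi> ` A))" for z A
  define H where "H s = Gs 0 {1..s}" for s
  \<comment> \<open>The symmetric group is transitive on pairs of a point and a set of given size
    avoiding it; moving the pair to 0 and \<open>{1..card A}\<close> leaves only the
    cardinality.\<close>
  have inv: "Gs z A = H (card A)" if "z < T" "A \<subseteq> {..<T}" "z \<notin> A" for z A
  proof -
    have "card A \<le> card ({..<T} - {z})" using that by (intro card_mono) auto
    then have "card A < T" using that(1) by simp
    then have "\<exists>\<sigma>. \<sigma> permutes {..<T} \<and> \<sigma> 0 = z \<and> \<sigma> ` {1..card A} = A"
      by (intro permutation_exists) (use that in auto)
    then obtain \<sigma> where \<sigma>: "\<sigma> permutes {..<T}" "\<sigma> 0 = z" "\<sigma> ` {1..card A} = A" by blast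
    have "H (card A) = (\<Sum>\<pi>\<in>?\<Pi>. f ((\<pi> \<circ> \<sigma>) 0) ((\<pi> \<circ> \<sigma>) ` {1..card A}))"
      unfolding H_def Gs_def by (rule sum_permutations_compose_right[OF \<sigma>(1)])
    also have "\<dots> = Gs z A" unfolding Gs_def image_comp[symmetric] \<sigma>(3) by (simp add: \<sigma>(2))
    finally show ?thesis ..
  qed
  have permT: "\<pi> x < T" if "\<pi> \<in> ?\<Pi>" "x < T" for \<pi> x using that permutes_in_image[of \<pi> "{..<T}" x] by auto
  have perm_img: "\<pi> ` A \<subseteq> {..<T}" if "\<pi> \<in> ?\<Pi>" "A \<subseteq> {..<T}" for \<pi> A using permT[OF that(1)] that(2) by auto
  have T0: "0 < T" using T by simp
  have Hrng: "0 \<le> H s \<and> H s \<le> card ?\<Pi>" if "s < T" for s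
  proof -
    have "{1..s} \<subseteq> {..<T}" using that by auto
    then have *: "0 \<le> f (\<pi> 0) (\<pi> ` {1..s}) \<and> f (\<pi> 0) (\<pi> ` {1..s}) \<le> 1" if "\<pi> \<in> ?\<Pi>" for \<pi>
      by (intro rng permT[OF that] perm_img[OF that] T0)
    have "(\<Sum>\<pi>\<in>?\<Pi>. f (\<pi> 0) (\<pi> ` {1..s})) \<le> (\<Sum>\<pi>\<in>?\<Pi>. 1)" by (rule sum_mono) (use * in blast)
    moreover have "0 \<le> (\<Sum>\<pi>\<in>?\<Pi>. f (\<pi> 0) (\<pi> ` {1..s}))" by (rule sum_nonneg) (use * in blast)
    ultimately show ?thesis unfolding H_def Gs_def by simp
  qed
  have Hmono: "H s \<le> H s'" if "s \<le> s'" "s' < T" for s s'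
    unfolding H_def Gs_def
  proof (rule sum_mono)
    fix \<pi> assume \<pi>: "\<pi> \<in> ?\<Pi>"
    have "{1..s} \<subseteq> {1..s'}" "{1..s'} \<subseteq> {..<T}" using that by auto
    then show "f (\<pi> 0) (\<pi> ` {1..s}) \<le> f (\<pi> 0) (\<pi> ` {1..s'})"
      by (intro mono[OF permT[OF \<pi> T0]] image_mono perm_img[OF \<pi>])
  qed
  let ?s = "scale_seq k"
  have "\<exists>j<N. H (?s (Suc j)) - H (?s j) \<le> card ?\<Pi> / N"
  proof (rule ccontr)
    assume "\<not> ?thesis"
    then have "card ?\<Pi> / N < H (?s (Suc j)) - H (?s j)" if "j < N" for j using that by fastforce
    then have "(\<Sum>j<N. card ?\<Pi> / N) < (\<Sum>j<N. H (?s (Suc j)) - H (?s j))"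
      using assms(2) by (intro sum_strict_mono) auto
    also have "\<dots> = H (?s N) - H (?s 0)" by (rule sum_lessThan_telescope)
    also have "\<dots> \<le> card ?\<Pi>" using Hrng[of "?s N"] Hrng[of "?s 0"] scale_seq_mono[of 0 N k] T by simp
    finally show False using assms(2) by simp
  qed
  then obtain j where j: "j < N" "H (?s (Suc j)) - H (?s j) \<le> card ?\<Pi> / N" by blast
  define s where "s = ?s j"
  \<comment> \<open>Two blocks of size \<open>s\<close> and \<open>k+1\<close> test indices: without
    one test index exactly \<open>2 * s + k\<close> indices remain, the next scale.\<close>
  define I1 I2 Z where "I1 = {..<s}" and "I2 = {s..<2 * s}" and "Z = {2 * s..<2 * s + Suc k}"
  have s1: "1 \<le> s" using scale_seq_pos by (simp add: s_def)
  have sT: "2 * s + Suc k \<le> T"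
    using scale_seq_mono[of "Suc j" N k] j(1) T by (simp add: s_def)
  have sub: "I1 \<union> I2 \<union> Z \<subseteq> {..<T}" using sT by (auto simp: I1_def I2_def Z_def)
  have disj: "I1 \<inter> I2 = {}" "I1 \<inter> Z = {}" "I2 \<inter> Z = {}" by (auto simp: I1_def I2_def Z_def)
  let ?N = "I1 \<union> I2 \<union> Z"
  have cN: "card (?N - {z}) = ?s (Suc j)" if "z \<in> Z" for z
  proof -
    have "?N = {..<2 * s + Suc k}" using s1 by (auto simp: I1_def I2_def Z_def)
    moreover have "z < 2 * s + Suc k" using that by (simp add: Z_def)
    ultimately show ?thesis by (simp add: s_def)
  qed
  have diff: "Gs z (?N - {z}) - Gs z I = H (?s (Suc j)) - H (?s j)"
    if "z \<in> Z" "I = I1 \<or> I = I2" for z I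
  proof -
    have "z < T" "z \<notin> I" "I \<subseteq> {..<T}" "?N - {z} \<subseteq> {..<T}" using that sub disj by blast+
    moreover have "card I = ?s j" using that(2) by (auto simp: I1_def I2_def s_def)
    ultimately show ?thesis using inv[of z "?N - {z}"] inv[of z I] cN[OF that(1)] by simp
  qed
  define X where "X I \<pi> = (\<Sum>z\<in>Z. f (\<pi> z) (\<pi> ` (?N - {z})) - f (\<pi> z) (\<pi> ` I))" for I and \<pi> :: "nat \<Rightarrow> nat"
  have X0: "0 \<le> X I \<pi>" if "\<pi> \<in> ?\<Pi>" "I = I1 \<or> I = I2" for I \<pi>
    unfolding X_def
  proof (rule sum_nonneg)
    fix z assume z: "z \<in> Z"
    have "f (\<pi> z) (\<pi> ` I) \<le> f (\<pi> z) (\<pi> ` (?N - {z}))"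
      by (intro mono permT[OF that(1)] image_mono perm_img[OF that(1)]) (use z that(2) sub disj in auto)
    then show "0 \<le> f (\<pi> z) (\<pi> ` (?N - {z})) - f (\<pi> z) (\<pi> ` I)" by simp
  qed
  have Xsum: "(\<Sum>\<pi>\<in>?\<Pi>. X I \<pi>) \<le> Suc k * (card ?\<Pi> / N)" if "I = I1 \<or> I = I2" for I
  proof -
    have "(\<Sum>\<pi>\<in>?\<Pi>. X I \<pi>) = (\<Sum>z\<in>Z. \<Sum>\<pi>\<in>?\<Pi>. f (\<pi> z) (\<pi> ` (?N - {z})) - f (\<pi> z) (\<pi> ` I))"
      unfolding X_def by (rule sum.swap)
    also have "\<dots> = (\<Sum>z\<in>Z. Gs z (?N - {z}) - Gs z I)" unfolding Gs_def by (simp add: sum_subtractf)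
    also have "\<dots> = (\<Sum>z\<in>Z. H (?s (Suc j)) - H (?s j))" by (rule sum.cong) (use diff that in auto)
    also have "\<dots> = Suc k * (H (?s (Suc j)) - H (?s j))" by (simp add: Z_def)
    also have "\<dots> \<le> Suc k * (card ?\<Pi> / N)" by (intro mult_left_mono j(2)) simp
    finally show ?thesis .
  qed
  \<comment> \<open>Both increments are averaged at once: a permutation for which their sum is at
    most \<open>\<xi>\<close> bounds each of them, as both are nonnegative.\<close>
  have "\<exists>\<pi>\<in>?\<Pi>. X I1 \<pi> + X I2 \<pi> \<le> \<xi>"
  proof (rule ccontr)
    assume "\<not> ?thesis"
    then have "(\<Sum>\<pi>\<in>?\<Pi>. \<xi>) < (\<Sum>\<pi>\<in>?\<Pi>. X I1 \<pi> + X I2 \<pi>)"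
    proof (intro sum_strict_mono fin\<Pi>)
      show "?\<Pi> \<noteq> {}" using ne\<Pi> by blast
    qed (auto simp: not_le)
    then have "\<xi> * card ?\<Pi> < 2 * (Suc k * (card ?\<Pi> / N))"
    proof -
      assume "(\<Sum>\<pi>\<in>?\<Pi>. \<xi>) < (\<Sum>\<pi>\<in>?\<Pi>. X I1 \<pi> + X I2 \<pi>)"
      then have "card ?\<Pi> * \<xi> < sum (X I1) ?\<Pi> + sum (X I2) ?\<Pi>" by (simp add: sum.distrib)
      moreover define d where "d = Suc k * (card ?\<Pi> / N)"
      moreover have "sum (X I1) ?\<Pi> \<le> d" "sum (X I2) ?\<Pi> \<le> d" unfolding d_def using Xsum by blast+
      ultimately show ?thesis unfolding d_def[symmetric] by (simp add: mult.commute)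
    qed
    then have "\<xi> * card ?\<Pi> * N < 2 * Suc k * card ?\<Pi>"
      using assms(2) by (simp add: field_simps)
    moreover have "2 * Suc k * card ?\<Pi> \<le> \<xi> * N * card ?\<Pi>"
      using mult_right_mono[OF assms(3), of "card ?\<Pi>"] by (simp add: algebra_simps)
    ultimately show False by (simp add: mult.commute mult.left_commute)
  qed
  then obtain \<pi> where \<pi>: "\<pi> \<in> ?\<Pi>" "X I1 \<pi> + X I2 \<pi> \<le> \<xi>" by blast
  have inj: "inj \<pi>" using \<pi>(1) permutes_inj by blast
  have Xeq: "X I \<pi> = (\<Sum>z\<in>\<pi> ` Z. f z (\<pi> ` I1 \<union> \<pi> ` I2 \<union> \<pi> ` Z - {z}) - f z (\<pi> ` I))" for I
  proof -
    have "\<pi> ` (?N - {z}) = \<pi> ` I1 \<union> \<pi> ` I2 \<union> \<pi> ` Z - {\<pi> z}" for z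
      using inj by (simp add: image_set_diff image_Un)
    then show ?thesis unfolding X_def using inj by (simp add: sum.reindex inj_on_subset)
  qed
  have "stable_triple f \<xi> (Suc k) {..<T} (\<pi> ` I1) (\<pi> ` I2) (\<pi> ` Z)"
    unfolding stable_triple_def
  proof (intro conjI)
    show "\<pi> ` I1 \<union> \<pi> ` I2 \<union> \<pi> ` Z \<subseteq> {..<T}" using perm_img[OF \<pi>(1)] sub by (simp add: image_Un)
    show "\<pi> ` I1 \<inter> \<pi> ` I2 = {}" "\<pi> ` I1 \<inter> \<pi> ` Z = {}" "\<pi> ` I2 \<inter> \<pi> ` Z = {}"
      using disj inj by (simp_all add: image_Int[symmetric])
    show "\<pi> ` I1 \<noteq> {}" "\<pi> ` I2 \<noteq> {}" using s1 by (auto simp: I1_def I2_def lessThan_empty_iff)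
    show "card (\<pi> ` Z) = Suc k" using inj by (simp add: card_image inj_on_subset Z_def)
    show "(\<Sum>z\<in>\<pi> ` Z. f z (\<pi> ` I1 \<union> \<pi> ` I2 \<union> \<pi> ` Z - {z}) - f z (\<pi> ` I1)) \<le> \<xi>"
      using \<pi>(2) X0[OF \<pi>(1), of I2] Xeq[of I1] by simp
    show "(\<Sum>z\<in>\<pi> ` Z. f z (\<pi> ` I1 \<union> \<pi> ` I2 \<union> \<pi> ` Z - {z}) - f z (\<pi> ` I2)) \<le> \<xi>"
      using \<pi>(2) X0[OF \<pi>(1), of I1] Xeq[of I2] by simp
  qed
  then show ?thesis by blast
qed

text \<open>\<open>T\<close> depends on \<open>\<xi>\<close> and \<open>k\<close> only. This
  uniformity lets the number of cells be fixed before the graph and the measure are known.\<close>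

lemma stable_choice:
  fixes \<xi> :: real and k :: nat
  assumes "0 < \<xi>"
  shows "\<exists>T>0. \<forall>(J :: nat set) f. card J = T \<longrightarrow>
    (\<forall>z\<in>J. \<forall>I I'. I \<subseteq> I' \<longrightarrow> I' \<subseteq> J \<longrightarrow> f z I \<le> f z I') \<longrightarrow>
    (\<forall>z\<in>J. \<forall>I. I \<subseteq> J \<longrightarrow> 0 \<le> f z I \<and> f z I \<le> 1) \<longrightarrow>
    (\<exists>I1 I2 Z. stable_triple f \<xi> (Suc k) J I1 I2 Z)"
proof -
  obtain N :: nat where N0: "real (2 * Suc k) / \<xi> < N" using reals_Archimedean2 by blast
  then have "real (2 * Suc k) < N * \<xi>" using assms by (simp only: pos_divide_less_eq)
  then have N: "2 * Suc k \<le> \<xi> * N" by (simp only: mult.commute[of \<xi>] less_imp_le)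
  have "0 < real (2 * Suc k) / \<xi>" using assms by simp
  then have "0 < real N" using N0 by linarith
  then have N2: "0 < N" by simp
  define T where "T = scale_seq k N + 1"
  show ?thesis
  proof (intro exI[of _ T] conjI allI impI)
    show "0 < T" by (simp add: T_def)
    fix J :: "nat set" and f :: "nat \<Rightarrow> nat set \<Rightarrow> real"
    assume J: "card J = T" and mono: "\<forall>z\<in>J. \<forall>I I'. I \<subseteq> I' \<longrightarrow> I' \<subseteq> J \<longrightarrow> f z I \<le> f z I'"
      and rng: "\<forall>z\<in>J. \<forall>I. I \<subseteq> J \<longrightarrow> 0 \<le> f z I \<and> f z I \<le> 1"
    have "finite J" using J by (metis card.infinite T_def add_is_0 zero_neq_one)
    then obtain h where h: "bij_betw h {..<T} J" using J finite_same_card_bij[of "{..<T}" J] by auto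
    have hJ: "h z \<in> J" if "z < T" for z using h that bij_betwE by blast
    have hI: "h ` I \<subseteq> J" if "I \<subseteq> {..<T}" for I using hJ that by blast
    have inj: "inj_on h {..<T}" using h bij_betw_def by blast
    obtain I1 I2 Z where *: "I1 \<union> I2 \<union> Z \<subseteq> {..<T}" "I1 \<inter> I2 = {}" "I1 \<inter> Z = {}" "I2 \<inter> Z = {}"
      "I1 \<noteq> {}" "I2 \<noteq> {}" "card Z = Suc k"
      "(\<Sum>z\<in>Z. f (h z) (h ` (I1 \<union> I2 \<union> Z - {z})) - f (h z) (h ` I1)) \<le> \<xi>"
      "(\<Sum>z\<in>Z. f (h z) (h ` (I1 \<union> I2 \<union> Z - {z})) - f (h z) (h ` I2)) \<le> \<xi>"
      using stable_choice_lessThan[OF assms N2 N T_def, of "\<lambda>z I. f (h z) (h ` I)"] mono rng hJ hI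
      unfolding stable_triple_def by (simp add: image_mono) blast
    have injZ: "inj_on h Z" using inj *(1) inj_on_subset by blast
    have eq: "(\<Sum>z\<in>h ` Z. f z (h ` I1 \<union> h ` I2 \<union> h ` Z - {z}) - f z (h ` I))
      = (\<Sum>z\<in>Z. f (h z) (h ` (I1 \<union> I2 \<union> Z - {z})) - f (h z) (h ` I))" for I
    proof -
      have "h ` (I1 \<union> I2 \<union> Z - {z}) = h ` I1 \<union> h ` I2 \<union> h ` Z - {h z}" if "z \<in> Z" for z
        using inj_on_image_set_diff[OF inj, of "I1 \<union> I2 \<union> Z" "{z}"] that *(1) by (auto simp: image_Un)
      then show ?thesis by (simp add: sum.reindex[OF injZ])
    qed
    have int: "h ` A \<inter> h ` B = {}" if "A \<inter> B = {}" "A \<subseteq> {..<T}" "B \<subseteq> {..<T}" for A B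
      using inj_on_image_Int[OF inj that(2,3)] that(1) by simp
    have "stable_triple f \<xi> (Suc k) J (h ` I1) (h ` I2) (h ` Z)"
      unfolding stable_triple_def using * hI[OF *(1)] int by (simp add: eq card_image[OF injZ] image_Un)
    then show "\<exists>I1 I2 Z. stable_triple f \<xi> (Suc k) J I1 I2 Z" by blast
  qed
qed

text \<open>
  With \<open>p = 4 - 2 sqrt 3 = (sqrt 3 - 1)\<^sup>2\<close>, the line \<open>r + (2 - sqrt 3) b = sqrt 3 - 1\<close> joins the points
  \<open>(sqrt p, 0)\<close> and \<open>(\<theta>, 1 - \<theta>)\<close> of the circle \<open>r\<^sup>2 + b\<^sup>2 = p\<close>.
\<close>

lemma chord:
  fixes r b :: real
  assumes "0 \<le> r" "0 \<le> b" "r + b \<le> 1" "4 - 2 * sqrt 3 \<le> r\<^sup>2 + b\<^sup>2" "b \<le> 3 / 5"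
  shows "sqrt 3 - 1 \<le> r + (2 - sqrt 3) * b"
proof (rule ccontr)
  define s where "s = sqrt (3 :: real)"
  have s: "173 / 100 \<le> s" "s \<le> 174 / 100" "s * s = 3" unfolding s_def by (rule sqrt3_bounds)+
  assume "\<not> ?thesis"
  then have c: "r < s - 1 - (2 - s) * b" unfolding s_def by simp
  have "r\<^sup>2 \<le> (1 - b)\<^sup>2" using assms by (intro power_mono) auto
  \<comment> \<open>On \<open>r \<le> 1 - b\<close> the circle condition excludes \<open>b\<close>
    strictly between \<open>1 - \<theta>\<close> and \<open>\<theta>\<close>. As
    \<open>3 / 5 < \<theta>\<close>, only the arc \<open>b \<le> 1 - \<theta>\<close>
    remains.\<close>
  then have "4 - 2 * s \<le> (1 - b)\<^sup>2 + b\<^sup>2" using assms(4) unfolding s_def by linarith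
  then have "0 \<le> 2 * ((b - (s - 1) / 2) * (b - (3 - s) / 2))"
  proof -
    have "2 * ((b - (s - 1) / 2) * (b - (3 - s) / 2)) = 2 * b\<^sup>2 - 2 * b + (4 * s - 3 - s * s) / 2"
      by (simp add: power2_eq_square field_simps)
    also have "\<dots> = (1 - b)\<^sup>2 + b\<^sup>2 - (4 - 2 * s)" unfolding s(3) by (simp add: power2_eq_square field_simps)
    finally show ?thesis using \<open>4 - 2 * s \<le> (1 - b)\<^sup>2 + b\<^sup>2\<close> by linarith
  qed
  then have "(b - (s - 1) / 2) * (b - (3 - s) / 2) \<ge> 0" by simp
  moreover have "b - (3 - s) / 2 < 0" using assms(5) s by simp
  ultimately have b: "b \<le> (s - 1) / 2" by (simp add: zero_le_mult_iff)
  have "r\<^sup>2 < (s - 1 - (2 - s) * b)\<^sup>2" using c assms(1) by (intro power_strict_mono) auto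
  then have "4 - 2 * s < (s - 1 - (2 - s) * b)\<^sup>2 + b\<^sup>2" using assms(4) unfolding s_def by linarith
  also have "\<dots> = 4 - 2 * s + b * ((8 - 4 * s) * b - (6 * s - 10))"
  proof -
    have "(s - 1 - (2 - s) * b)\<^sup>2 + b\<^sup>2
      = s * s - 2 * s + 1 - 2 * (3 * s - s * s - 2) * b + (4 - 4 * s + s * s) * b\<^sup>2 + b\<^sup>2"
      by (simp add: power2_eq_square algebra_simps)
    then show ?thesis unfolding s(3) by (simp add: power2_eq_square algebra_simps)
  qed
  \<comment> \<open>As a polynomial in \<open>b\<close> the right side vanishes at the two ends
    \<open>b = 0\<close> and \<open>b = 1 - \<theta>\<close> of the chord and is negative between
    them, where the chord runs inside the circle.\<close>
  finally have "0 < b * ((8 - 4 * s) * b - (6 * s - 10))" by simp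
  moreover have "(8 - 4 * s) * b \<le> (8 - 4 * s) * ((s - 1) / 2)" using b s by (intro mult_left_mono) auto
  moreover have "(8 - 4 * s) * ((s - 1) / 2) = 6 * s - 10" using s(3) by (simp add: field_simps)
  ultimately show False using assms(2) by (simp add: zero_less_mult_iff)
qed

text \<open>The second pair enters with its colours exchanged. Eliminating \<open>r1\<close> leaves
  an affine function of \<open>b1\<close> with slope \<open>r2 - l * b2\<close>; by its sign the
  minimum is at \<open>b1 = 0\<close> or at the largest admissible
  \<open>b1 = (l + \<tau>) / s\<close>, and the second chord finishes both cases. For
  \<open>\<tau> = 0\<close> the value \<open>2 * sqrt 3 - 3\<close> is attained at
  \<open>r1 = sqrt 3 - 1\<close>, \<open>b1 = 0\<close>, \<open>b2 = \<theta>\<close>,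
  \<open>r2 = 1 - \<theta>\<close>.\<close>

lemma bilinear_bound:
  fixes r1 b1 r2 b2 \<tau> :: real
  assumes nn: "0 \<le> r1" "0 \<le> b1" "0 \<le> r2" "0 \<le> b2" "r1 + b1 \<le> 1" "r2 + b2 \<le> 1" "0 \<le> \<tau>"
    and c1: "sqrt 3 - 1 - \<tau> \<le> r1 + (2 - sqrt 3) * b1" and c2: "sqrt 3 - 1 - \<tau> \<le> b2 + (2 - sqrt 3) * r2"
  shows "2 * sqrt 3 - 3 - 6 * \<tau> \<le> r1 * b2 + b1 * r2"
proof -
  define s l where "s = sqrt (3 :: real) - 1" and "l = 2 - sqrt (3 :: real)"
  have s: "73 / 100 \<le> s" "s \<le> 74 / 100" "l = 1 - s" using sqrt3_bounds unfolding s_def l_def by auto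
  have ss: "s * s = 2 - 2 * s" using sqrt3_bounds(3) unfolding s_def by (simp add: algebra_simps)
  have C1: "s - \<tau> \<le> r1 + l * b1" and C2: "s - \<tau> \<le> b2 + l * r2" using c1 c2 unfolding s_def l_def by auto
  have goal: "2 * sqrt 3 - 3 = s - l" unfolding s_def l_def by simp
  have "(s - \<tau> - l * b1) * b2 \<le> r1 * b2" using C1 nn by (intro mult_right_mono) auto
  moreover have "\<tau> * b2 \<le> \<tau>" using nn mult_left_mono[of b2 1 \<tau>] by auto
  ultimately have base: "s * b2 - \<tau> - b1 * (l * b2 - r2) \<le> r1 * b2 + b1 * r2"
    by (simp add: algebra_simps)
  show ?thesis
  proof (cases "l * b2 \<le> r2")
    case True
    have "l * r2 \<le> l * (1 - b2)" using nn s by (intro mult_left_mono) auto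
    then have "s - \<tau> - l \<le> s * b2" using C2 s(3) by (simp add: algebra_simps)
    moreover have "b1 * (l * b2 - r2) \<le> 0" using True nn by (simp add: mult_le_0_iff)
    ultimately show ?thesis using base nn unfolding goal by linarith
  next
    case False
    have "s * b1 \<le> l + \<tau>" using C1 nn(5) s(3) by (simp add: algebra_simps)
    then have b1s: "(s * b1) * (l * b2 - r2) \<le> (l + \<tau>) * (l * b2 - r2)"
      using False by (intro mult_right_mono) auto
    have lb: "l * b2 - r2 \<le> 1" using nn s mult_mono[of l 1 b2 1] by auto
    have "(s - l) * (b2 + l * r2) \<le> (s - l) * b2 + l * r2"
      using nn s mult_right_mono[of "s - l" 1 "l * r2"] by (simp add: algebra_simps)
    moreover have "(s - l) * (s - \<tau>) \<le> (s - l) * (b2 + l * r2)" using C2 s by (intro mult_left_mono) linarith+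
    ultimately have e1: "(s - l) * (s - \<tau>) \<le> (s - l) * b2 + l * r2" by linarith
    have "s * s - l * l = (s - l) * (s + l)" by (simp add: algebra_simps)
    then have sl: "s * s - l * l = s - l" using s(3) by simp
    have "s * (s * b2 - \<tau> - b1 * (l * b2 - r2)) = s * s * b2 - s * \<tau> - (s * b1) * (l * b2 - r2)"
      by (simp add: algebra_simps)
    also have "\<dots> \<ge> s * s * b2 - s * \<tau> - (l + \<tau>) * (l * b2 - r2)" using b1s by linarith
    moreover have "s * s * b2 - s * \<tau> - (l + \<tau>) * (l * b2 - r2) = (s * s - l * l) * b2 + l * r2 - s * \<tau> - \<tau> * (l * b2 - r2)"
      by (simp add: algebra_simps)
    moreover have "\<tau> * (l * b2 - r2) \<le> \<tau>" using lb nn mult_left_mono[of "l * b2 - r2" 1 \<tau>] by auto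
    ultimately have "(s - l) * (s - \<tau>) - s * \<tau> - \<tau> \<le> s * (s * b2 - \<tau> - b1 * (l * b2 - r2))"
      using e1 unfolding sl by linarith
    moreover have "s * ((s - l) - 6 * \<tau>) \<le> (s - l) * (s - \<tau>) - s * \<tau> - \<tau>"
    proof -
      have "0 \<le> \<tau> * (5 * s - (s - l) - 1)" using nn s by (intro mult_nonneg_nonneg) auto
      then show ?thesis by (simp add: algebra_simps)
    qed
    ultimately have "s * ((s - l) - 6 * \<tau>) \<le> s * (s * b2 - \<tau> - b1 * (l * b2 - r2))" by linarith
    then have "(s - l) - 6 * \<tau> \<le> s * b2 - \<tau> - b1 * (l * b2 - r2)" using s by simp
    then show ?thesis using base unfolding goal by linarith
  qed
qed

section \<open>Two layers of a pseudorandom graph\<close>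

text \<open>\<open>u\<close> and \<open>v\<close> stand for adjacent sites. The classes of
  \<open>cl\<close> below \<open>M\<close> are cells of equal size; larger values can hold the
  remainder. The error is measured against the cell size \<open>m\<close>, since edges between parts
  of single cells have to be counted.\<close>

locale two_layer = model E p \<mu> for E :: "('a \<times> nat) set set" and p \<mu> +
  fixes u v :: 'a and V :: "nat set" and G :: "nat set set" and cl :: "nat \<Rightarrow> nat" and M m :: nat and q \<eta> :: real
  assumes uv: "u \<noteq> v" and finV: "finite V"
    and G_edges: "\<And>e. e \<in> G \<Longrightarrow> \<exists>x y. e = {x, y} \<and> x \<noteq> y \<and> x \<in> V \<and> y \<in> V"
    and layer: "\<And>w e. w \<in> {u, v} \<Longrightarrow> e \<in> G \<Longrightarrow> Pair w ` e \<in> E"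
    and vert: "\<And>x. x \<in> V \<Longrightarrow> {(u, x), (v, x)} \<in> E"
    and card_cell: "\<And>i. i < M \<Longrightarrow> card {x \<in> V. cl x = i} = m"
    and m_pos: "0 < m" and q_pos: "0 < q" and eta_nn: "0 \<le> \<eta>"
    and pseudo: "\<And>U. U \<subseteq> V \<Longrightarrow> \<bar>real (card {e \<in> G. e \<subseteq> U}) - q * (real (card U))\<^sup>2 / 2\<bar> \<le> \<eta> * q * (real m)\<^sup>2"
begin

definition edges_in :: "nat set \<Rightarrow> nat set set" where
  "edges_in U = {e \<in> G. e \<subseteq> U}"

definition cross :: "nat set \<Rightarrow> nat set \<Rightarrow> nat set set" where
  "cross A B = {e \<in> G. \<exists>x\<in>A. \<exists>y\<in>B. e = {x, y}}"

abbreviation err :: real where "err \<equiv> \<eta> * q * (real m)\<^sup>2"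

lemma inj_Pair': "inj (Pair w)"
  by (simp add: inj_on_def)

lemma G_sub: "e \<in> G \<Longrightarrow> e \<subseteq> V" using G_edges by blast

lemma finG: "finite G"
  by (rule finite_subset[of _ "Pow V"]) (use G_sub finV in auto)

lemma fin_sub: "A \<subseteq> V \<Longrightarrow> finite A" using finV finite_subset by blast

lemma err_nn: "0 \<le> err" using eta_nn q_pos by simp

lemma edges_in_le: "U \<subseteq> V \<Longrightarrow> real (card (edges_in U)) \<le> q * (real (card U))\<^sup>2 / 2 + err"
  using pseudo[of U] unfolding edges_in_def by linarith

lemma edges_in_ge: "U \<subseteq> V \<Longrightarrow> q * (real (card U))\<^sup>2 / 2 - err \<le> real (card (edges_in U))"
  using pseudo[of U] unfolding edges_in_def by linarith

lemma card_cross: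
  assumes "A \<subseteq> V" "B \<subseteq> V" "A \<inter> B = {}"
  shows "card (cross A B) + (card (edges_in A) + card (edges_in B)) = card (edges_in (A \<union> B))"
proof -
  have fin: "finite (edges_in X)" "finite (cross A B)" for X
    using finG unfolding edges_in_def cross_def by simp_all
  have ne: "e \<noteq> {}" if "e \<in> G" for e using G_edges[OF that] by blast
  have 1: "edges_in A \<inter> edges_in B = {}" using assms(3) ne unfolding edges_in_def by blast
  have 2: "cross A B \<inter> (edges_in A \<union> edges_in B) = {}" using assms(3) unfolding edges_in_def cross_def by blast
  have "cross A B \<union> (edges_in A \<union> edges_in B) = edges_in (A \<union> B)"
  proof (intro equalityI subsetI)
    fix e assume e: "e \<in> edges_in (A \<union> B)"
    then obtain x y where "e = {x, y}" using G_edges unfolding edges_in_def by blast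
    then show "e \<in> cross A B \<union> (edges_in A \<union> edges_in B)"
      using e unfolding edges_in_def cross_def by (auto simp: insert_commute)
  qed (auto simp: edges_in_def cross_def)
  then have "card (edges_in (A \<union> B)) = card (cross A B) + card (edges_in A \<union> edges_in B)"
    using card_Un_disjoint[OF fin(2) _ 2] fin(1) by simp
  then show ?thesis using card_Un_disjoint[OF fin(1) fin(1) 1] by simp
qed

text \<open>Polarisation: \<open>e(A, B) = e(A \<union> B) - e(A) - e(B)\<close>, with one error for
  each term.\<close>

lemma cross_bounds:
  assumes "A \<subseteq> V" "B \<subseteq> V" "A \<inter> B = {}"
  shows "real (card (cross A B)) \<le> q * card A * card B + 3 * err"
    "q * card A * card B - 3 * err \<le> real (card (cross A B))"
proof -
  have c: "real (card (A \<union> B)) = real (card A) + real (card B)"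
    using card_Un_disjoint[OF fin_sub[OF assms(1)] fin_sub[OF assms(2)] assms(3)] by simp
  have eq: "real (card (cross A B)) + real (card (edges_in A)) + real (card (edges_in B)) = real (card (edges_in (A \<union> B)))"
    using card_cross[OF assms] by linarith
  have sq: "q * (real (card (A \<union> B)))\<^sup>2 / 2 = q * (real (card A))\<^sup>2 / 2 + q * (real (card B))\<^sup>2 / 2 + q * card A * card B"
    unfolding c by (simp add: power2_eq_square algebra_simps add_divide_distrib)
  have AB: "A \<union> B \<subseteq> V" using assms by blast
  show "real (card (cross A B)) \<le> q * card A * card B + 3 * err"
    using eq sq edges_in_ge[OF assms(1)] edges_in_ge[OF assms(2)] edges_in_le[OF AB] by linarith
  show "q * card A * card B - 3 * err \<le> real (card (cross A B))"
    using eq sq edges_in_le[OF assms(1)] edges_in_le[OF assms(2)] edges_in_ge[OF AB] by linarith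
qed

text \<open>Single degrees are not controlled, but the edges touching an exceptional set are, as the
  difference of two induced edge counts.\<close>

lemma edges_meeting:
  assumes "N \<subseteq> Z" "Z \<subseteq> V"
  shows "real (card {e \<in> G. e \<subseteq> Z \<and> e \<inter> N \<noteq> {}}) \<le> q * card Z * card N + 2 * err"
proof -
  have fin: "finite N" "finite Z" using assms fin_sub by blast+
  have "{e \<in> G. e \<subseteq> Z \<and> e \<inter> N \<noteq> {}} = edges_in Z - edges_in (Z - N)" unfolding edges_in_def by blast
  moreover have sub: "edges_in (Z - N) \<subseteq> edges_in Z" unfolding edges_in_def by blast
  moreover have "finite (edges_in Z)" using finG unfolding edges_in_def by simp
  ultimately have "card {e \<in> G. e \<subseteq> Z \<and> e \<inter> N \<noteq> {}} = card (edges_in Z) - card (edges_in (Z - N))"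
    using card_Diff_subset[OF _ sub] finite_subset by metis
  also have "real \<dots> = real (card (edges_in Z)) - real (card (edges_in (Z - N)))"
    by (rule of_nat_diff) (rule card_mono[OF \<open>finite (edges_in Z)\<close> sub])
  also have "\<dots> \<le> q * (real (card Z))\<^sup>2 / 2 - q * (real (card (Z - N)))\<^sup>2 / 2 + 2 * err"
    using edges_in_le[OF assms(2)] edges_in_ge[OF order_trans[OF Diff_subset assms(2)], of N] by linarith
  also have "real (card (Z - N)) = real (card Z) - real (card N)"
    using card_Diff_subset[OF fin(1) assms(1)] card_mono[OF fin(2) assms(1)] by simp
  also have "q * (real (card Z))\<^sup>2 / 2 - q * (real (card Z) - real (card N))\<^sup>2 / 2 + 2 * err
      = q * card Z * card N - q * (real (card N))\<^sup>2 / 2 + 2 * err"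
    by (simp add: power2_eq_square field_simps)
  also have "\<dots> \<le> q * card Z * card N + 2 * err" using q_pos by simp
  finally show ?thesis .
qed

text \<open>An edge meets at most \<open>2 * card W\<close> edges of \<open>F\<close>, so
  \<open>D = 2 * card W * card F\<close> in Chebyshev's inequality. For \<open>F\<close> of size
  about \<open>q * (card W)^2\<close> the bound is of order \<open>1 / (q * card W)\<close>.\<close>

lemma pr_few_open:
  fixes \<nu> :: real
  assumes w: "w \<in> {u, v}" and F: "F \<subseteq> edges_in W" "F \<noteq> {}" and W: "W \<subseteq> V" and "0 < \<nu>"
  shows "pr (\<lambda>S. real (card {e \<in> F. Pair w ` e \<in> S}) < (p - \<nu>) * card F) \<le> 2 * card W / (\<nu>\<^sup>2 * card F)"
proof -
  have inj: "inj_on (image (Pair w)) X" for X :: "nat set set"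
    by (rule inj_onI) (simp only: inj_image_eq_iff[OF inj_Pair'])
  let ?F = "image (Pair w) ` F"
  have FG: "F \<subseteq> G" using F(1) unfolding edges_in_def by auto
  have finF: "finite F" by (rule finite_subset[OF FG finG])
  have F0: "0 < real (card F)" using finF F(2) by (simp add: card_gt_0_iff)
  have finW: "finite W" using fin_sub[OF W] .
  have cF: "card ?F = card F" using inj by (rule card_image)
  have subE: "?F \<subseteq> E" using layer[OF w] F(1) unfolding edges_in_def by blast
  have "\<Union>?F \<subseteq> {w} \<times> W" using F(1) unfolding edges_in_def by blast
  then have finU: "finite (\<Union>?F)" using finW by (meson finite.emptyI finite_SigmaI finite_insert finite_subset)
  have deg: "card {e' \<in> F. x \<in> e'} \<le> card W" for x
  proof -
    have "{e' \<in> F. x \<in> e'} \<subseteq> (\<lambda>y. {x, y}) ` W"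
    proof
      fix e' assume e': "e' \<in> {e' \<in> F. x \<in> e'}"
      then have "e' \<in> G" "e' \<subseteq> W" using F(1) unfolding edges_in_def by auto
      then obtain a b where "e' = {a, b}" using G_edges by blast
      then show "e' \<in> (\<lambda>y. {x, y}) ` W" using e' \<open>e' \<subseteq> W\<close> by (auto simp: insert_commute)
    qed
    then show ?thesis using finW by (meson card_image_le card_mono finite_imageI le_trans)
  qed
  have meet: "card {e' \<in> F. e \<inter> e' \<noteq> {}} \<le> 2 * card W" if "e \<in> F" for e
  proof -
    obtain x y where e: "e = {x, y}" using G_edges F(1) \<open>e \<in> F\<close> unfolding edges_in_def by blast
    have eq: "{e' \<in> F. e \<inter> e' \<noteq> {}} = {e' \<in> F. x \<in> e'} \<union> {e' \<in> F. y \<in> e'}" unfolding e by blast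
    have "card {e' \<in> F. e \<inter> e' \<noteq> {}} \<le> card {e' \<in> F. x \<in> e'} + card {e' \<in> F. y \<in> e'}"
      unfolding eq by (rule card_Un_le)
    then show ?thesis using deg[of x] deg[of y] by linarith
  qed
  let ?I = "SIGMA e:F. {e' \<in> F. e \<inter> e' \<noteq> {}}"
  have finI: "finite ?I" using finF by simp
  have "{(e, e'). e \<in> ?F \<and> e' \<in> ?F \<and> e \<inter> e' \<noteq> {}} \<subseteq> (\<lambda>z. (Pair w ` fst z, Pair w ` snd z)) ` ?I"
  proof
    fix z assume "z \<in> {(e, e'). e \<in> ?F \<and> e' \<in> ?F \<and> e \<inter> e' \<noteq> {}}"
    then obtain e e' where e: "e \<in> F" "e' \<in> F" "z = (Pair w ` e, Pair w ` e')" "Pair w ` e \<inter> Pair w ` e' \<noteq> {}"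
      by blast
    have "e \<inter> e' \<noteq> {}" using e(4) by auto
    then have "(e, e') \<in> ?I" using e(1,2) by simp
    then show "z \<in> (\<lambda>z. (Pair w ` fst z, Pair w ` snd z)) ` ?I" using e(3) by (intro image_eqI[of _ _ "(e, e')"]) simp_all
  qed
  then have "card {(e, e'). e \<in> ?F \<and> e' \<in> ?F \<and> e \<inter> e' \<noteq> {}} \<le> card ((\<lambda>z. (Pair w ` fst z, Pair w ` snd z)) ` ?I)"
    by (rule card_mono[OF finite_imageI[OF finI]])
  also have "\<dots> \<le> card ?I" by (rule card_image_le[OF finI])
  also have "\<dots> = (\<Sum>e\<in>F. card {e' \<in> F. e \<inter> e' \<noteq> {}})" using finF by simp
  also have "\<dots> \<le> (\<Sum>e\<in>F. 2 * card W)" by (rule sum_mono) (rule meet)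
  finally have D: "real (card {(e, e'). e \<in> ?F \<and> e' \<in> ?F \<and> e \<inter> e' \<noteq> {}}) \<le> 2 * real (card W) * real (card F)"
    by (simp add: of_nat_le_iff[symmetric, where 'a=real] mult.commute del: of_nat_le_iff)
  have "?F \<inter> S = image (Pair w) ` {e \<in> F. Pair w ` e \<in> S}" for S by blast
  then have cS: "card (?F \<inter> S) = card {e \<in> F. Pair w ` e \<in> S}" for S by (simp add: card_image[OF inj])
  have "pr (\<lambda>S. real (card (?F \<inter> S)) < p * card ?F - \<nu> * card F) \<le> 2 * real (card W) * real (card F) / (\<nu> * card F)\<^sup>2"
    by (rule Chebyshev_edges[OF subE finU _ D]) (use finF F0 assms(5) in auto)
  moreover have "2 * real (card W) * real (card F) / (\<nu> * card F)\<^sup>2 = 2 * card W / (\<nu>\<^sup>2 * card F)"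
    using F0 by (simp add: power2_eq_square field_simps)
  ultimately show ?thesis unfolding cS cF by (simp add: left_diff_distrib)
qed

text \<open>Vertices are labelled by their components. Without a common majority component all open
  edges lie inside three pairs of groups that together hold at most half of all vertex pairs;
  \<open>9 * err\<close> is three times the error of \<open>cross_bounds\<close>.\<close>

lemma giant_of_edges:
  assumes w: "w \<in> {u, v}" and AB: "A \<subseteq> V" "B \<subseteq> V" "A \<inter> B = {}" and W: "{w} \<times> (A \<union> B) \<subseteq> W"
    and many: "q * card A * card B / 2 + 9 * err < real (card {e \<in> cross A B. Pair w ` e \<in> S})"
  shows "\<exists>a. maj S W a w A \<and> maj S W a w B"
proof (rule ccontr)
  assume no: "\<not> ?thesis"
  define f where "f x = {b. conn S W (w, x) b}" for x
  have fin: "finite A" "finite B" using AB fin_sub by blast+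
  have "\<not> (card A < 2 * card {x \<in> A. f x = l} \<and> card B < 2 * card {x \<in> B. f x = l})" for l
  proof
    assume h: "card A < 2 * card {x \<in> A. f x = l} \<and> card B < 2 * card {x \<in> B. f x = l}"
    then have "card {x \<in> A. f x = l} \<noteq> 0" by linarith
    then have "{x \<in> A. f x = l} \<noteq> {}" by (metis card.empty)
    then obtain x0 where x0: "f x0 = l" by blast
    have "conn S W (w, x0) (w, x)" if "f x = l" for x
      using that x0 conn_refl[of S W "(w, x)"] unfolding f_def by blast
    then have "{x \<in> X. f x = l} \<subseteq> {x \<in> X. conn S W (w, x0) (w, x)}" for X by blast
    then have "card {x \<in> X. f x = l} \<le> card {x \<in> X. conn S W (w, x0) (w, x)}" if "finite X" for X
      using that by (intro card_mono) auto
    then have "maj S W (w, x0) w A \<and> maj S W (w, x0) w B"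
      using h fin unfolding maj_def by (meson less_le_trans mult_le_mono2)
    then show False using no by blast
  qed
  then obtain g :: "('a \<times> nat) set \<Rightarrow> nat" where g: "\<And>l. g l < 3"
    "2 * (\<Sum>k<3. card {x \<in> A. g (f x) = k} * card {x \<in> B. g (f x) = k}) \<le> card A * card B"
    using three_groups[OF fin, of f] by blast
  let ?A = "\<lambda>k. {x \<in> A. g (f x) = k}" and ?B = "\<lambda>k. {x \<in> B. g (f x) = k}"
  have "{e \<in> cross A B. Pair w ` e \<in> S} \<subseteq> (\<Union>k<3. cross (?A k) (?B k))"
  proof
    fix e assume "e \<in> {e \<in> cross A B. Pair w ` e \<in> S}"
    then obtain x y where e: "e \<in> G" "x \<in> A" "y \<in> B" "e = {x, y}" "Pair w ` e \<in> S" unfolding cross_def by blast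
    have "conn S W (w, x) (w, y)" by (rule conn_edge) (use e W in auto)
    then have eq: "conn S W (w, x) b \<longleftrightarrow> conn S W (w, y) b" for b
      using conn_trans[of S W "(w, x)" "(w, y)" b] conn_trans[of S W "(w, y)" "(w, x)" b] conn_sym[of S W "(w, x)" "(w, y)"]
      by blast
    have "f x = f y" unfolding f_def by (rule Collect_cong) (rule eq)
    then have "e \<in> cross (?A (g (f x))) (?B (g (f x)))" using e unfolding cross_def by auto
    then show "e \<in> (\<Union>k<3. cross (?A k) (?B k))" using g(1) by blast
  qed
  then have "card {e \<in> cross A B. Pair w ` e \<in> S} \<le> card (\<Union>k<3. cross (?A k) (?B k))"
    using finG by (intro card_mono) (auto simp: cross_def)
  also have "\<dots> \<le> (\<Sum>k<3. card (cross (?A k) (?B k)))" by (rule card_UN_le) simp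
  finally have "real (card {e \<in> cross A B. Pair w ` e \<in> S}) \<le> (\<Sum>k<3. real (card (cross (?A k) (?B k))))"
    by (simp only: of_nat_sum[symmetric] of_nat_le_iff)
  also have "\<dots> \<le> (\<Sum>k<3. q * card (?A k) * card (?B k) + 3 * err)"
    by (intro sum_mono cross_bounds(1)) (use AB in auto)
  also have "\<dots> = q * real (\<Sum>k<3. card (?A k) * card (?B k)) + 9 * err"
    by (simp add: sum.distrib sum_distrib_left mult.assoc)
  also have "\<dots> \<le> q * (card A * card B / 2) + 9 * err"
  proof -
    have "real (2 * (\<Sum>k<3. card (?A k) * card (?B k))) \<le> real (card A * card B)" using g(2) by (simp only: of_nat_le_iff)
    then have "real (\<Sum>k<3. card (?A k) * card (?B k)) \<le> real (card A) * real (card B) / 2" by simp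
    then show ?thesis using q_pos by (intro add_right_mono mult_left_mono) auto
  qed
  finally show False using many by simp
qed

lemma dep_card_open:
  assumes "\<And>e. e \<in> F \<Longrightarrow> Pair w ` e \<subseteq> W"
  shows "dep W (\<lambda>S. Q (card {e \<in> F. Pair w ` e \<in> S}))"
  using dep_Collect[of W "\<lambda>e S. e \<in> F \<and> Pair w ` e \<in> S" "\<lambda>X. Q (card X)"] assms
  by (blast intro: dep_guard dep_mem)

text \<open>This works because \<open>p\<close> exceeds 1/2. With \<open>a\<close> and
  \<open>b\<close> the two sizes, the margin 2/100 absorbs all errors:
  \<open>err < q * a * b / 600\<close> suffices for
  \<open>q * a * b / 2 + 9 * err < 52 / 100 * (q * a * b - 3 * err)\<close>.\<close>

lemma pr_no_giant:
  fixes \<nu> \<gamma> :: real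
  assumes w: "w \<in> {u, v}" and AB: "A \<subseteq> V" "B \<subseteq> V" "A \<inter> B = {}"
    and \<nu>: "0 < \<nu>" "52 / 100 \<le> p - \<nu>" "p \<le> 1"
    and \<gamma>: "0 < \<gamma>" "\<gamma> * m \<le> card A" "\<gamma> * m \<le> card B" "600 * \<eta> < \<gamma>\<^sup>2"
  shows "pr (\<lambda>S. \<not> (\<exists>a. maj S ({w} \<times> (A \<union> B)) a w A \<and> maj S ({w} \<times> (A \<union> B)) a w B)) \<le> 8 / (\<nu>\<^sup>2 * \<gamma> * (q * m))"
proof -
  let ?W = "{w} \<times> (A \<union> B)" and ?F = "cross A B"
  have fin: "finite ?W" using AB fin_sub by simp
  have m0: "0 < real m" using m_pos by simp
  define a b where "a = real (card A)" and "b = real (card B)"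
  have ab: "\<gamma> * m \<le> a" "\<gamma> * m \<le> b" "0 < a" "0 < b"
    using \<gamma> m0 mult_pos_pos[OF \<gamma>(1) m0] unfolding a_def b_def by linarith+
  have "(\<gamma> * m) * (\<gamma> * m) \<le> a * b" using ab \<gamma>(1) by (intro mult_mono) auto
  moreover have "600 * \<eta> * (real m)\<^sup>2 < \<gamma>\<^sup>2 * (real m)\<^sup>2" using \<gamma>(4) m0 by simp
  ultimately have "600 * \<eta> * (real m)\<^sup>2 < a * b" by (simp add: power2_eq_square ac_simps)
  then have "q * (600 * \<eta> * (real m)\<^sup>2) < q * (a * b)" using q_pos by simp
  then have big: "600 * err < q * a * b" by (simp add: ac_simps)
  have F: "q * a * b - 3 * err \<le> real (card ?F)" using cross_bounds(2)[OF AB] unfolding a_def b_def .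
  then have F2: "q * a * b / 2 \<le> real (card ?F)" using big err_nn by linarith
  have qab: "0 < q * a * b" using q_pos ab by simp
  then have Fne: "?F \<noteq> {}" using F2 by auto
  have Fsub: "?F \<subseteq> edges_in (A \<union> B)" unfolding cross_def edges_in_def by auto
  have AB': "A \<union> B \<subseteq> V" using AB by blast
  have "pr (\<lambda>S. \<not> (\<exists>a. maj S ?W a w A \<and> maj S ?W a w B))
    \<le> pr (\<lambda>S. real (card {e \<in> ?F. Pair w ` e \<in> S}) < (p - \<nu>) * card ?F)"
  proof (rule pr_mono[OF fin])
    show "dep ?W (\<lambda>S. real (card {e \<in> ?F. Pair w ` e \<in> S}) < (p - \<nu>) * card ?F)"
      by (rule dep_card_open[of _ _ _ "\<lambda>n. real n < (p - \<nu>) * card ?F"]) (auto simp: cross_def)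
    fix S assume "\<not> (\<exists>a. maj S ?W a w A \<and> maj S ?W a w B)"
    then have "real (card {e \<in> ?F. Pair w ` e \<in> S}) \<le> q * card A * card B / 2 + 9 * err"
      using giant_of_edges[OF w AB order_refl, of S] by fastforce
    also have "\<dots> < 52 / 100 * (q * a * b - 3 * err)" using big err_nn unfolding a_def b_def by (simp add: field_simps)
    also have "\<dots> \<le> 52 / 100 * card ?F" using F by simp
    also have "\<dots> \<le> (p - \<nu>) * card ?F" using \<nu>(2) by (intro mult_right_mono) auto
    finally show "real (card {e \<in> ?F. Pair w ` e \<in> S}) < (p - \<nu>) * card ?F" .
  qed
  also have "\<dots> \<le> 2 * card (A \<union> B) / (\<nu>\<^sup>2 * card ?F)"
    by (rule pr_few_open[OF w Fsub Fne AB' \<nu>(1)])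
  also have "\<dots> = 2 * (a + b) / (\<nu>\<^sup>2 * card ?F)"
    using card_Un_disjoint[OF fin_sub[OF AB(1)] fin_sub[OF AB(2)] AB(3)] unfolding a_def b_def by simp
  also have "\<dots> \<le> 2 * (a + b) / (\<nu>\<^sup>2 * (q * a * b / 2))"
    using F2 qab \<nu>(1) ab by (intro divide_left_mono mult_left_mono) auto
  also have "\<dots> = 4 / (\<nu>\<^sup>2 * q) * (1 / a + 1 / b)" using ab q_pos \<nu> by (simp add: field_simps)
  also have "\<dots> \<le> 4 / (\<nu>\<^sup>2 * q) * (1 / (\<gamma> * m) + 1 / (\<gamma> * m))"
    using ab q_pos \<gamma> m0 by (intro mult_left_mono add_mono divide_left_mono) auto
  also have "\<dots> = 8 / (\<nu>\<^sup>2 * \<gamma> * (q * m))" by simp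
  finally show ?thesis .
qed

end

section \<open>Vertices attached to the blue component\<close>

context model
begin

lemma expect_card:
  assumes "finite X" "finite W" "\<And>x. x \<in> X \<Longrightarrow> dep W (P x)"
  shows "integrable \<mu> (\<lambda>S. real (card {x \<in> X. P x S}))"
    "expectation (\<lambda>S. real (card {x \<in> X. P x S})) = (\<Sum>x\<in>X. pr (P x))"
proof -
  have eq: "real (card {x \<in> X. P x S}) = (\<Sum>x\<in>X. of_bool (P x S))" for S
    using assms(1) by (simp add: Int_def)
  show "integrable \<mu> (\<lambda>S. real (card {x \<in> X. P x S}))"
    unfolding eq by (intro Bochner_Integration.integrable_sum int_ind(1)[OF assms(2)] assms(3))
  show "expectation (\<lambda>S. real (card {x \<in> X. P x S})) = (\<Sum>x\<in>X. pr (P x))"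
    unfolding eq using int_ind[OF assms(2) assms(3)]
    by (subst Bochner_Integration.integral_sum) auto
qed

lemma pr_sum_le:
  fixes t a b :: real
  assumes fin: "finite X" "finite Y" "finite W"
    and dep: "\<And>x. x \<in> X \<Longrightarrow> dep W (P x)" "\<And>y. y \<in> Y \<Longrightarrow> dep W (Q y)"
    and le: "\<And>S. S \<subseteq> E \<Longrightarrow> t * card {x \<in> X. P x S} \<le> a * card {y \<in> Y. Q y S} + b"
  shows "t * (\<Sum>x\<in>X. pr (P x)) \<le> a * (\<Sum>y\<in>Y. pr (Q y)) + b"
proof -
  note P = expect_card[OF fin(1,3) dep(1)] and Q = expect_card[OF fin(2,3) dep(2)]
  have "expectation (\<lambda>S. t * card {x \<in> X. P x S}) \<le> expectation (\<lambda>S. a * card {y \<in> Y. Q y S} + b)"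
    by (rule integral_mono) (use P(1) Q(1) le in \<open>auto simp: space_eq\<close>)
  then show ?thesis using P Q by (simp add: prob_space)
qed

lemma pr_linear:
  fixes a b c :: real
  assumes fin: "finite X" "finite W"
    and dep: "\<And>x. x \<in> X \<Longrightarrow> dep W (P x)" "\<And>x. x \<in> X \<Longrightarrow> dep W (Q x)" "dep W \<Gamma>"
    and nn: "0 \<le> a" "0 \<le> b"
    and le: "\<And>S. S \<subseteq> E \<Longrightarrow> \<Gamma> S \<Longrightarrow> c \<le> a * card {x \<in> X. P x S} + b * card {x \<in> X. Q x S}"
  shows "c * pr \<Gamma> \<le> a * (\<Sum>x\<in>X. pr (P x)) + b * (\<Sum>x\<in>X. pr (Q x))"
proof -
  note P = expect_card[OF fin dep(1)] and Q = expect_card[OF fin dep(2)] and G = int_ind[OF fin(2) dep(3)]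
  have "expectation (\<lambda>S. c * of_bool (\<Gamma> S)) \<le> expectation (\<lambda>S. a * card {x \<in> X. P x S} + b * card {x \<in> X. Q x S})"
  proof (rule integral_mono)
    fix S assume "S \<in> space \<mu>"
    then show "c * of_bool (\<Gamma> S) \<le> a * card {x \<in> X. P x S} + b * card {x \<in> X. Q x S}"
      using le[of S] nn by (cases "\<Gamma> S") (auto simp: space_eq)
  qed (use P(1) Q(1) G(1) in auto)
  then show ?thesis using P Q G by simp
qed

lemma pr_markov:
  fixes t :: real
  assumes fin: "finite X" "finite W" and dep: "\<And>x. x \<in> X \<Longrightarrow> dep W (P x)" and t: "0 < t"
  shows "pr (\<lambda>S. t \<le> card {x \<in> X. P x S}) \<le> (\<Sum>x\<in>X. pr (P x)) / t"
proof -
  have d: "dep W (\<lambda>S. t \<le> real (card {x. x \<in> X \<and> P x S}))"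
    by (rule dep_Collect[of W "\<lambda>x S. x \<in> X \<and> P x S" "\<lambda>A. t \<le> real (card A)"]) (intro dep_guard dep)
  have "t * pr (\<lambda>S. t \<le> card {x \<in> X. P x S}) \<le> 1 * (\<Sum>x\<in>X. pr (P x)) + 0 * (\<Sum>x\<in>X. pr (P x))"
    by (rule pr_linear[OF fin dep dep d]) auto
  then show ?thesis using t by (simp add: field_simps)
qed

lemma pr_diff:
  assumes "finite W" "dep W P" "dep W Q" "\<And>S. S \<subseteq> E \<Longrightarrow> Q S \<Longrightarrow> P S"
  shows "pr (\<lambda>S. P S \<and> \<not> Q S) = pr P - pr Q"
proof -
  have "{S \<in> Pow E. P S \<and> \<not> Q S} = {S \<in> Pow E. P S} - {S \<in> Pow E. Q S}" by auto
  moreover have "{S \<in> Pow E. Q S} \<subseteq> {S \<in> Pow E. P S}" using assms(4) by auto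
  ultimately show ?thesis unfolding pr_def
    using finite_measure_Diff[OF dep_event[OF assms(1,2)] dep_event[OF assms(1,3)]] by simp
qed

text \<open>Pointwise, \<open>C + A + B \<le> 1 + A C + B C\<close> for indicators with
  \<open>A B = 0\<close>. Here \<open>C\<close> will be an open vertical edge, and \<open>A\<close>,
  \<open>B\<close> the two ways of colouring its ends red and blue.\<close>

lemma pr_vertical:
  assumes fin: "finite W" and dep: "dep W A" "dep W B" "dep W C"
    and disj: "\<And>S. \<not> (A S \<and> B S)"
  shows "pr C \<le> 1 - pr A - pr B + pr (\<lambda>S. A S \<and> C S) + pr (\<lambda>S. B S \<and> C S)"
proof -
  have "expectation (\<lambda>S. of_bool (C S) + (of_bool (A S) + of_bool (B S)) :: real)
    \<le> expectation (\<lambda>S. 1 + (of_bool (A S \<and> C S) + of_bool (B S \<and> C S)) :: real)"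
    by (rule integral_mono)
      (use int_ind(1)[OF fin] dep disj in \<open>auto intro!: Bochner_Integration.integrable_add dep_conj simp: of_bool_def\<close>)
  then show ?thesis
    using int_ind[OF fin] dep dep_conj[OF dep(1,3)] dep_conj[OF dep(2,3)] by (simp add: prob_space)
qed

end

context two_layer
begin

definition cells :: "nat set \<Rightarrow> nat set" where
  "cells I = {x \<in> V. cl x \<in> I}"

definition both :: "nat set \<Rightarrow> ('a \<times> nat) set" where
  "both I = {u, v} \<times> cells I"

text \<open>Any cell may witness the giant of the second copy, so blueness is monotone in
  \<open>W\<close> and needs no preliminary choice of a giant. The notion is asymmetric: the
  majority lies in copy \<open>v\<close> also for vertices of copy \<open>u\<close>.\<close>

definition blue :: "('a \<times> nat) set set \<Rightarrow> ('a \<times> nat) set \<Rightarrow> 'a \<times> nat \<Rightarrow> bool" where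
  "blue S W a \<longleftrightarrow> (\<exists>i<M. maj S W a v (cells {i}))"

text \<open>
  Only the copy \<open>w\<close> of the cell of \<open>x\<close> is added to \<open>both I\<close>: the blueness of the two copies of \<open>x\<close> can
  then be decided from disjoint regions.
\<close>

definition attached :: "nat set \<Rightarrow> 'a \<Rightarrow> nat \<Rightarrow> ('a \<times> nat) set set \<Rightarrow> bool" where
  "attached I w x S \<longleftrightarrow> blue S (both I \<union> {w} \<times> cells {cl x}) (w, x)"

text \<open>The cells witnessing the two giants may differ; they are traded for a common cell only
  when the copies are finally linked. Depending on \<open>both J\<close> alone makes the events for
  disjoint \<open>J\<close> independent.\<close>

definition good :: "nat set \<Rightarrow> ('a \<times> nat) set set \<Rightarrow> bool" where
  "good J S \<longleftrightarrow> (\<exists>a. (\<exists>i<M. maj S (both J) a u (cells {i})) \<and> (\<exists>j<M. maj S (both J) a v (cells {j})))"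

lemma cells_V: "cells I \<subseteq> V" by (auto simp: cells_def)
lemma fin_cells: "finite (cells I)" using cells_V fin_sub by blast
lemma fin_both: "finite (both I)" unfolding both_def using fin_cells by simp
lemma cells_mono: "I \<subseteq> I' \<Longrightarrow> cells I \<subseteq> cells I'" by (auto simp: cells_def)
lemma both_mono: "I \<subseteq> I' \<Longrightarrow> both I \<subseteq> both I'" unfolding both_def using cells_mono by blast
lemma card_cells1: "i < M \<Longrightarrow> card (cells {i}) = m" using card_cell unfolding cells_def by simp
lemma cells_UN: "cells I = (\<Union>i\<in>I. cells {i})" by (auto simp: cells_def)

lemma sum_cells:
  assumes "finite I"
  shows "(\<Sum>x\<in>cells I. h x) = (\<Sum>i\<in>I. \<Sum>x\<in>cells {i}. h x)"
  unfolding cells_UN[of I]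
proof (rule sum.UNION_disjoint[OF assms])
  show "\<forall>i\<in>I. finite (cells {i})" using fin_cells by blast
  show "\<forall>i\<in>I. \<forall>j\<in>I. i \<noteq> j \<longrightarrow> cells {i} \<inter> cells {j} = {}" by (auto simp: cells_def)
qed

lemma card_cells: "finite I \<Longrightarrow> I \<subseteq> {..<M} \<Longrightarrow> card (cells I) = card I * m"
proof -
  assume I: "finite I" "I \<subseteq> {..<M}"
  have "card (cells I) = (\<Sum>i\<in>I. card (cells {i}))" using sum_cells[OF I(1), of "\<lambda>_. 1 :: nat"] by simp
  also have "\<dots> = (\<Sum>i\<in>I. m)" by (rule sum.cong) (use I card_cells1 in auto)
  finally show ?thesis by simp
qed

lemma blue_mono: "blue S W a \<Longrightarrow> W \<subseteq> W' \<Longrightarrow> conn S W' a b \<Longrightarrow> blue S W' b"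
  unfolding blue_def by (elim exE conjE) (intro exI conjI, assumption, rule maj_mono[OF _ _ _ fin_cells])

lemma dep_blue: "dep W (\<lambda>S. blue S W a)"
  unfolding blue_def by (intro dep_ex dep_guard dep_maj)

lemma dep_attached: "dep (both I \<union> {w} \<times> cells {cl x}) (attached I w x)"
  unfolding attached_def by (rule dep_blue)

lemma attached_mono: "attached I w x S \<Longrightarrow> I \<subseteq> I' \<Longrightarrow> attached I' w x S"
  unfolding attached_def by (erule blue_mono) (auto dest: both_mono intro: conn_refl)

lemma dep_good: "dep (both J) (good J)"
  unfolding good_def by (intro dep_ex dep_conj dep_guard dep_maj)

lemma fin_region: "finite (both I \<union> {w} \<times> cells K)"
  using fin_both fin_cells by simp

text \<open>The function to which the choice of a stable scale is applied. Averaging over both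
  copies lets one scale serve both; as increments are nonnegative, the increment of either copy is
  at most twice that of \<open>freq\<close>.\<close>

definition freq :: "nat \<Rightarrow> nat set \<Rightarrow> real" where
  "freq z I = (\<Sum>w\<in>{u, v}. \<Sum>x\<in>cells {z}. pr (attached I w x)) / (2 * m)"

lemma freq_mono: "I \<subseteq> I' \<Longrightarrow> freq z I \<le> freq z I'"
  unfolding freq_def
  by (intro divide_right_mono sum_mono pr_mono[OF fin_region dep_attached]) (auto intro: attached_mono)

lemma freq_range: "z < M \<Longrightarrow> 0 \<le> freq z I \<and> freq z I \<le> 1"
proof -
  assume z: "z < M"
  have "(\<Sum>x\<in>cells {z}. pr (attached I w x)) \<le> (\<Sum>x\<in>cells {z}. 1)" for w by (rule sum_mono) (rule pr_le1)
  then have "(\<Sum>x\<in>cells {z}. pr (attached I w x)) \<le> m" for w using card_cells1[OF z] by simp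
  then have "(\<Sum>w\<in>{u, v}. \<Sum>x\<in>cells {z}. pr (attached I w x)) \<le> (\<Sum>w\<in>{u, v}. real m)" by (intro sum_mono) simp
  moreover have "0 \<le> (\<Sum>w\<in>{u, v}. \<Sum>x\<in>cells {z}. pr (attached I w x))" by (intro sum_nonneg pr_nonneg)
  ultimately show ?thesis using m_pos uv unfolding freq_def by simp
qed

end

section \<open>Red and blue in a stable block of cells\<close>

locale block = two_layer E p \<mu> u v V G cl M m q \<eta>
  for E :: "('a \<times> nat) set set" and p \<mu> u v V G cl M m q \<eta> +
  fixes Iu Iv Zs :: "nat set" and k :: nat and \<delta> :: real
  assumes sub: "Iu \<union> Iv \<union> Zs \<subseteq> {..<M}" and disj: "Iu \<inter> Iv = {}" "Iu \<inter> Zs = {}" "Iv \<inter> Zs = {}"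
    and ne: "Iu \<noteq> {}" "Iv \<noteq> {}" and card_Zs: "card Zs = k" and k_pos: "0 < k" and delta_pos: "0 < \<delta>"
begin

definition side :: "'a \<Rightarrow> nat set" where "side w = (if w = u then Iu else Iv)"
definition other :: "'a \<Rightarrow> 'a" where "other w = (if w = u then v else u)"
definition Z :: "nat set" where "Z = cells Zs"
definition N :: "nat set" where "N = Iu \<union> Iv \<union> Zs"

text \<open>
  \<open>B\<close> is blueness decided by the own side, \<open>BN\<close> blueness decided by everything except the other copy of the
  own cell, and \<open>R\<close> is red. A red vertex becoming blue through its vertical edge makes at least \<open>thr\<close> vertices fresh.
\<close>

definition B :: "'a \<Rightarrow> nat \<Rightarrow> ('a \<times> nat) set set \<Rightarrow> bool" where
  "B w x S \<longleftrightarrow> attached (side w) w x S"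

definition BN :: "'a \<Rightarrow> nat \<Rightarrow> ('a \<times> nat) set set \<Rightarrow> bool" where
  "BN w x S \<longleftrightarrow> attached (N - {cl x}) w x S"

definition fresh :: "'a \<Rightarrow> nat \<Rightarrow> ('a \<times> nat) set set \<Rightarrow> bool" where
  "fresh w x S \<longleftrightarrow> BN w x S \<and> \<not> B w x S"

text \<open>Pairs in the same cell are left out because \<open>BN w y\<close> explores only copy
  \<open>w\<close> of the cell of \<open>y\<close>: blueness can be passed from the other copy of
  \<open>x\<close> to \<open>y\<close> inside that region only if the cell of \<open>x\<close> is
  different. With \<open>k\<close> test cells this discards about a fraction \<open>1 / k\<close> of
  the edges.\<close>

definition nbrs :: "'a \<Rightarrow> nat \<Rightarrow> ('a \<times> nat) set set \<Rightarrow> nat set" where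
  "nbrs w x S = {y. y \<in> Z \<and> cl y \<noteq> cl x \<and> {x, y} \<in> G \<and> {(w, x), (w, y)} \<in> S \<and> \<not> B w y S}"

text \<open>A fraction \<open>\<delta>\<close> of \<open>q * card Z\<close>, the average number of
  neighbours in \<open>Z\<close>. Non-blue vertices below it carry at most
  \<open>\<delta> * q * (card Z)^2\<close> open edges to non-blue neighbours, a negligible
  number.\<close>

definition thr :: real where "thr = \<delta> * q * (k * m)"

definition R :: "'a \<Rightarrow> nat \<Rightarrow> ('a \<times> nat) set set \<Rightarrow> bool" where
  "R w x S \<longleftrightarrow> \<not> B w x S \<and> thr \<le> card (nbrs w x S)"

definition region :: "'a \<Rightarrow> ('a \<times> nat) set" where
  "region w = both (side w) \<union> {w} \<times> Z"

lemma fin_Zs: "finite Zs" using sub finite_subset by blast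
lemma fin_Z: "finite Z" unfolding Z_def by (rule fin_cells)
lemma Z_V: "Z \<subseteq> V" unfolding Z_def by (rule cells_V)
lemma card_Z: "card Z = k * m" unfolding Z_def using card_cells[OF fin_Zs] sub card_Zs by simp
lemma cl_Z: "x \<in> Z \<Longrightarrow> cl x \<in> Zs" unfolding Z_def cells_def by simp
lemma fin_regionw: "finite (region w)" unfolding region_def Z_def by (rule fin_region)
lemma thr_pos: "0 < thr" unfolding thr_def using delta_pos q_pos k_pos m_pos by simp

lemma side_N: "side w \<subseteq> N - Zs"
  unfolding side_def N_def using disj by auto

lemma cell_in_Z: "x \<in> Z \<Longrightarrow> cells {cl x} \<subseteq> Z"
  unfolding Z_def cells_def by auto

lemma dep_B: "x \<in> Z \<Longrightarrow> dep (region w) (B w x)"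
  unfolding B_def[abs_def] region_def
  by (rule dep_mono[OF dep_attached]) (use cell_in_Z in blast)

lemma dep_nbrs: "x \<in> Z \<Longrightarrow> dep (region w) (\<lambda>S. Q (nbrs w x S))"
  unfolding nbrs_def
proof (rule dep_Collect)
  fix y assume x: "x \<in> Z"
  show "dep (region w) (\<lambda>S. y \<in> Z \<and> cl y \<noteq> cl x \<and> {x, y} \<in> G \<and> {(w, x), (w, y)} \<in> S \<and> \<not> B w y S)"
    by (intro dep_guard dep_conj dep_mem dep_not dep_B) (use x in \<open>auto simp: region_def\<close>)
qed

lemma dep_R: "x \<in> Z \<Longrightarrow> dep (region w) (R w x)"
  unfolding R_def[abs_def] by (intro dep_conj dep_not dep_B dep_nbrs)

text \<open>The reason for splitting the cells: \<open>region w\<close> uses both copies of the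
  cells of its own side, but only copy \<open>w\<close> of the test cells. The colours of the two
  copies of a test vertex are therefore independent.\<close>

lemma region_disj: "region u \<inter> region v = {}"
proof -
  have "cells Iu \<inter> cells Iv = {}" "cells Iu \<inter> Z = {}" "cells Iv \<inter> Z = {}"
    using disj unfolding cells_def Z_def by auto
  then show ?thesis unfolding region_def both_def side_def using uv by auto
qed

definition full :: "('a \<times> nat) set" where "full = {u, v} \<times> V"

lemma fin_full: "finite full" unfolding full_def using finV by simp
lemma region_full: "w \<in> {u, v} \<Longrightarrow> region w \<subseteq> full"
  unfolding region_def full_def both_def Z_def using cells_V by blast
lemma both_full: "both I \<subseteq> full" unfolding both_def full_def using cells_V by blast

lemma dep_BN: "w \<in> {u, v} \<Longrightarrow> dep full (BN w x)"
  unfolding BN_def[abs_def]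
  by (rule dep_mono[OF dep_attached]) (use both_full cells_V in \<open>auto simp: full_def\<close>)

lemma dep_Bf: "w \<in> {u, v} \<Longrightarrow> x \<in> Z \<Longrightarrow> dep full (B w x)"
  by (rule dep_mono[OF dep_B region_full])
lemma dep_Rf: "w \<in> {u, v} \<Longrightarrow> x \<in> Z \<Longrightarrow> dep full (R w x)"
  by (rule dep_mono[OF dep_R region_full])
lemma dep_fresh: "w \<in> {u, v} \<Longrightarrow> x \<in> Z \<Longrightarrow> dep full (fresh w x)"
  unfolding fresh_def[abs_def] by (intro dep_conj dep_not dep_BN dep_Bf)

lemma B_BN: "x \<in> Z \<Longrightarrow> B w x S \<Longrightarrow> BN w x S"
  unfolding B_def BN_def by (erule attached_mono) (use side_N cl_Z in blast)

text \<open>As \<open>cl x \<noteq> cl y\<close>, the region explored by \<open>BN w y\<close>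
  contains that of \<open>B w x\<close> and the edge. Hence an open edge between different test
  cells never joins a blue vertex to one that is neither blue nor fresh.\<close>

lemma spread_layer:
  assumes w: "w \<in> {u, v}" and xy: "x \<in> Z" "y \<in> Z" "cl x \<noteq> cl y" and e: "{(w, x), (w, y)} \<in> S" and Bx: "B w x S"
  shows "BN w y S"
proof -
  let ?W = "both (N - {cl y}) \<union> {w} \<times> cells {cl y}"
  have "cl x \<in> N - {cl y}" using cl_Z[OF xy(1)] xy(3) unfolding N_def by blast
  then have "cells {cl x} \<subseteq> cells (N - {cl y})" by (intro cells_mono) simp
  moreover have "side w \<subseteq> N - {cl y}" using side_N[of w] cl_Z[OF xy(2)] by blast
  ultimately have sub: "both (side w) \<union> {w} \<times> cells {cl x} \<subseteq> ?W"
    using both_mono[of "side w" "N - {cl y}"] w unfolding both_def by blast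
  have "(w, x) \<in> ?W" "(w, y) \<in> ?W" using sub xy Z_V by (auto simp: cells_def)
  then have "conn S ?W (w, x) (w, y)" using e by (rule conn_edge[rotated])
  then show ?thesis using Bx blue_mono[OF _ sub] unfolding B_def BN_def attached_def by blast
qed

lemma spread_vertical:
  assumes w: "w \<in> {u, v}" and xy: "x \<in> Z" "y \<in> Z" "cl x \<noteq> cl y" and e: "{(w, x), (w, y)} \<in> S"
    and vx: "{(u, x), (v, x)} \<in> S" and Bx: "B (other w) x S"
  shows "BN w y S"
proof -
  let ?W = "both (N - {cl y}) \<union> {w} \<times> cells {cl y}"
  have w': "other w \<in> {u, v}" unfolding other_def by simp
  have "cl x \<in> N - {cl y}" using cl_Z[OF xy(1)] xy(3) unfolding N_def by blast
  then have cx: "cells {cl x} \<subseteq> cells (N - {cl y})" by (intro cells_mono) simp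
  moreover have "side (other w) \<subseteq> N - {cl y}" using side_N[of "other w"] cl_Z[OF xy(2)] by blast
  ultimately have sub: "both (side (other w)) \<union> {other w} \<times> cells {cl x} \<subseteq> ?W"
    using both_mono[of "side (other w)" "N - {cl y}"] w' unfolding both_def by blast
  have xc: "x \<in> cells {cl x}" "y \<in> cells {cl y}" using xy Z_V by (auto simp: cells_def)
  have i: "(w, x) \<in> ?W" "(other w, x) \<in> ?W" "(w, y) \<in> ?W" using cx xc w w' unfolding both_def by blast+
  have "{(other w, x), (w, x)} = {(u, x), (v, x)}" using w uv unfolding other_def by auto
  then have "conn S ?W (other w, x) (w, x)" using vx i by (intro conn_edge) auto
  moreover have "conn S ?W (w, x) (w, y)" using e i by (intro conn_edge) auto
  ultimately have "conn S ?W (other w, x) (w, y)" by (rule conn_trans)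
  then show ?thesis using Bx blue_mono[OF _ sub] unfolding B_def BN_def attached_def by blast
qed

definition freshset :: "'a \<Rightarrow> ('a \<times> nat) set set \<Rightarrow> nat set" where
  "freshset w S = {x \<in> Z. fresh w x S}"

lemma fin_nbrs: "finite (nbrs w x S)"
  by (rule finite_subset[OF _ fin_Z]) (auto simp: nbrs_def)

text \<open>The five terms count open edges inside one cell, at a fresh vertex, at a non-blue vertex
  of small non-blue degree, between two red vertices, and between two blue ones. No other kind
  exists, since between different cells blue and non-blue are joined only at a fresh vertex.\<close>

lemma open_edges_bound:
  assumes w: "w \<in> {u, v}" and U: "U \<subseteq> Z"
  shows "real (card {e \<in> edges_in U. Pair w ` e \<in> S}) \<le>
    k * (q * (real m)\<^sup>2 / 2 + err) + (q * (k * m) * card (freshset w S) + 2 * err) + thr * (k * m)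
    + (q * (real (card {x \<in> U. R w x S}))\<^sup>2 / 2 + err) + (q * (real (card {x \<in> U. B w x S}))\<^sup>2 / 2 + err)"
proof -
  let ?O = "{e \<in> edges_in U. Pair w ` e \<in> S}"
  let ?A1 = "\<Union>z\<in>Zs. edges_in (cells {z})"
  let ?A2 = "{e \<in> G. e \<subseteq> Z \<and> e \<inter> freshset w S \<noteq> {}}"
  let ?Q = "{x \<in> Z. \<not> R w x S \<and> \<not> B w x S}"
  let ?A3 = "\<Union>x\<in>?Q. (\<lambda>y. {x, y}) ` nbrs w x S"
  let ?A4 = "edges_in {x \<in> U. R w x S}" and ?A5 = "edges_in {x \<in> U. B w x S}"
  have finE: "finite (edges_in X)" for X unfolding edges_in_def using finG by simp
  have cover: "?O \<subseteq> ?A1 \<union> (?A2 \<union> (?A3 \<union> (?A4 \<union> ?A5)))"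
  proof
    fix e assume e: "e \<in> ?O"
    then have eG: "e \<in> G" "e \<subseteq> U" "Pair w ` e \<in> S" unfolding edges_in_def by auto
    obtain x y where xy: "e = {x, y}" "x \<noteq> y" using G_edges[OF eG(1)] by blast
    have xZ: "x \<in> Z" "y \<in> Z" "x \<in> U" "y \<in> U" using eG(2) xy U by auto
    have op: "{(w, x), (w, y)} \<in> S" "{(w, y), (w, x)} \<in> S" using eG(3) xy by (simp_all add: insert_commute)
    show "e \<in> ?A1 \<union> (?A2 \<union> (?A3 \<union> (?A4 \<union> ?A5)))"
    proof (cases "cl x = cl y")
      case True
      have "e \<in> edges_in (cells {cl x})" using eG xy xZ Z_V True unfolding edges_in_def cells_def by auto
      then show ?thesis using cl_Z[OF xZ(1)] by blast
    next
      case diff: False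
      show ?thesis
      proof (cases "fresh w x S \<or> fresh w y S")
        case True
        then have "e \<in> ?A2" using eG xy xZ unfolding freshset_def by auto
        then show ?thesis by blast
      next
        case False
        have eq: "B w x S \<longleftrightarrow> B w y S"
          using False spread_layer[OF w xZ(1,2) diff op(1)] spread_layer[OF w xZ(2,1) diff[symmetric] op(2)]
          unfolding fresh_def by blast
        show ?thesis
        proof (cases "B w x S")
          case True
          then have "e \<in> ?A5" using eq eG xy xZ unfolding edges_in_def by auto
          then show ?thesis by blast
        next
          case nB: False
          have yn: "y \<in> nbrs w x S" "x \<in> nbrs w y S"
            using nB eq xZ diff eG xy op unfolding nbrs_def by (auto simp: insert_commute)
          show ?thesis
          proof (cases "R w x S \<and> R w y S")
            case True
            then have "e \<in> ?A4" using eG xy xZ unfolding edges_in_def by auto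
            then show ?thesis by blast
          next
            case False
            then have "x \<in> ?Q \<or> y \<in> ?Q" using nB eq xZ by blast
            moreover have "e = {y, x}" using xy by blast
            ultimately have "e \<in> ?A3" using yn xy by blast
            then show ?thesis by blast
          qed
        qed
      qed
    qed
  qed
  have fin2: "finite ?A2" using finG by simp
  have finQ: "finite ?Q" using fin_Z by simp
  have fin3: "finite ?A3" using finQ fin_nbrs by blast
  have "card ?O \<le> card (?A1 \<union> (?A2 \<union> (?A3 \<union> (?A4 \<union> ?A5))))"
    by (rule card_mono[OF _ cover]) (use fin_Zs finE fin2 fin3 in blast)
  also have "\<dots> \<le> card ?A1 + (card ?A2 + (card ?A3 + (card ?A4 + card ?A5)))"
    by (meson add_left_mono card_Un_le le_trans)
  finally have "real (card ?O) \<le> real (card ?A1) + (real (card ?A2) + (real (card ?A3) + (real (card ?A4) + real (card ?A5))))"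
    by linarith
  moreover have "real (card ?A1) \<le> k * (q * (real m)\<^sup>2 / 2 + err)"
  proof -
    have "card ?A1 \<le> (\<Sum>z\<in>Zs. card (edges_in (cells {z})))" by (rule card_UN_le[OF fin_Zs])
    then have "real (card ?A1) \<le> (\<Sum>z\<in>Zs. real (card (edges_in (cells {z}))))"
      by (simp only: of_nat_sum[symmetric] of_nat_le_iff)
    also have "\<dots> \<le> (\<Sum>z\<in>Zs. q * (real m)\<^sup>2 / 2 + err)"
    proof (rule sum_mono)
      fix z assume "z \<in> Zs"
      then have "z < M" using sub by auto
      then show "real (card (edges_in (cells {z}))) \<le> q * (real m)\<^sup>2 / 2 + err"
        using edges_in_le[OF cells_V, of "{z}"] card_cells1 by simp
    qed
    finally show ?thesis by (simp add: card_Zs)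
  qed
  moreover have "real (card ?A2) \<le> q * (k * m) * card (freshset w S) + 2 * err"
    using edges_meeting[OF _ Z_V, of "freshset w S"] card_Z unfolding freshset_def by simp
  moreover have "real (card ?A3) \<le> thr * (k * m)"
  proof -
    have "card ?A3 \<le> (\<Sum>x\<in>?Q. card ((\<lambda>y. {x, y}) ` nbrs w x S))" by (rule card_UN_le[OF finQ])
    also have "\<dots> \<le> (\<Sum>x\<in>?Q. card (nbrs w x S))" by (intro sum_mono card_image_le fin_nbrs)
    finally have "real (card ?A3) \<le> (\<Sum>x\<in>?Q. real (card (nbrs w x S)))"
      by (simp only: of_nat_sum[symmetric] of_nat_le_iff)
    also have "\<dots> \<le> (\<Sum>x\<in>?Q. thr)" by (rule sum_mono) (auto simp: R_def)
    also have "\<dots> = card ?Q * thr" by simp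
    also have "\<dots> \<le> (k * m) * thr"
    proof -
      have "card ?Q \<le> k * m" unfolding card_Z[symmetric] by (rule card_mono[OF fin_Z]) auto
      then show ?thesis using thr_pos by (intro mult_right_mono) (simp_all only: of_nat_le_iff less_imp_le)
    qed
    finally show ?thesis by (simp add: mult.commute)
  qed
  moreover have "real (card ?A4) \<le> q * (real (card {x \<in> U. R w x S}))\<^sup>2 / 2 + err"
    by (rule edges_in_le) (use U Z_V in blast)
  moreover have "real (card ?A5) \<le> q * (real (card {x \<in> U. B w x S}))\<^sup>2 / 2 + err"
    by (rule edges_in_le) (use U Z_V in blast)
  ultimately show ?thesis by linarith
qed

text \<open>If \<open>x\<close> is red, its other copy blue and the vertical edge open, then all of
  its at least \<open>thr\<close> vertices in \<open>nbrs\<close> are fresh. Few fresh vertices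
  touch few edges, and each edge is counted at most twice, once from each end.\<close>

lemma crossing_bound:
  assumes w: "w \<in> {u, v}"
  shows "thr * card {x \<in> Z. R w x S \<and> B (other w) x S \<and> {(u, x), (v, x)} \<in> S}
    \<le> 2 * (q * (k * m) * card (freshset w S) + 2 * err)"
proof -
  let ?X = "{x \<in> Z. R w x S \<and> B (other w) x S \<and> {(u, x), (v, x)} \<in> S}"
  let ?A2 = "{e \<in> G. e \<subseteq> Z \<and> e \<inter> freshset w S \<noteq> {}}"
  have finX: "finite ?X" using fin_Z by simp
  have "thr * card ?X = (\<Sum>x\<in>?X. thr)" by simp
  also have "\<dots> \<le> (\<Sum>x\<in>?X. real (card (nbrs w x S)))" by (rule sum_mono) (auto simp: R_def)
  also have "\<dots> = real (card (SIGMA x:?X. nbrs w x S))" using finX fin_nbrs by simp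
  also have "\<dots> \<le> real (card (?A2 \<times> (UNIV :: bool set)))"
  proof -
    let ?h = "\<lambda>(x :: nat, y). ({x, y}, x < y)"
    have "inj_on ?h (SIGMA x:?X. nbrs w x S)"
      by (rule inj_onI) (auto simp: doubleton_eq_iff)
    moreover have "?h ` (SIGMA x:?X. nbrs w x S) \<subseteq> ?A2 \<times> UNIV"
    proof
      fix z assume "z \<in> ?h ` (SIGMA x:?X. nbrs w x S)"
      then obtain a where a: "a \<in> (SIGMA x:?X. nbrs w x S)" "z = ?h a" by blast
      obtain x y where "a = (x, y)" by (cases a)
      then have z: "z = ({x, y}, x < y)" "x \<in> ?X" "y \<in> nbrs w x S" using a by auto
      have y: "y \<in> Z" "cl x \<noteq> cl y" "{x, y} \<in> G" "{(w, x), (w, y)} \<in> S" "\<not> B w y S"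
        using z(3) unfolding nbrs_def by auto
      have "BN w y S" by (rule spread_vertical[OF w _ y(1,2,4)]) (use z(2) in auto)
      then have "y \<in> freshset w S" using y unfolding freshset_def fresh_def by blast
      then show "z \<in> ?A2 \<times> UNIV" using z(1,2) y by auto
    qed
    moreover have "finite (?A2 \<times> (UNIV :: bool set))" using finG by simp
    ultimately have "card (SIGMA x:?X. nbrs w x S) \<le> card (?A2 \<times> (UNIV :: bool set))" by (rule card_inj_on_le)
    then show ?thesis by simp
  qed
  also have "\<dots> = 2 * real (card ?A2)" by (simp add: card_cartesian_product)
  also have "\<dots> \<le> 2 * (q * (k * m) * card (freshset w S) + 2 * err)"
    using edges_meeting[OF _ Z_V, of "freshset w S"] card_Z unfolding freshset_def by simp
  finally show ?thesis .
qed

lemma expected_fresh: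
  fixes \<xi> :: real
  assumes w: "w \<in> {u, v}" and st: "(\<Sum>z\<in>Zs. freq z (N - {z}) - freq z (side w)) \<le> \<xi>"
  shows "(\<Sum>x\<in>Z. pr (fresh w x)) \<le> 2 * m * \<xi>"
proof -
  have eq: "pr (fresh w x) = pr (BN w x) - pr (B w x)" if "x \<in> Z" for x
    unfolding fresh_def[abs_def]
    by (rule pr_diff[OF fin_full dep_BN[OF w] dep_Bf[OF w that]]) (rule B_BN[OF that])
  have "(\<Sum>x\<in>Z. pr (fresh w x)) = (\<Sum>x\<in>Z. pr (BN w x) - pr (B w x))" using eq by simp
  also have "\<dots> = (\<Sum>z\<in>Zs. \<Sum>x\<in>cells {z}. pr (BN w x) - pr (B w x))"
    unfolding Z_def by (rule sum_cells[OF fin_Zs])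
  also have "\<dots> \<le> (\<Sum>z\<in>Zs. 2 * m * (freq z (N - {z}) - freq z (side w)))"
  proof (rule sum_mono)
    fix z assume z: "z \<in> Zs"
    let ?d = "\<lambda>w'. \<Sum>x\<in>cells {z}. pr (attached (N - {z}) w' x) - pr (attached (side w) w' x)"
    have "side w \<subseteq> N - {z}" using side_N[of w] z by blast
    then have nn: "0 \<le> ?d w'" for w'
      by (intro sum_nonneg) (use pr_mono[OF fin_region dep_attached] attached_mono in \<open>simp add: le_diff_eq\<close>)
    have "(\<Sum>x\<in>cells {z}. pr (BN w x) - pr (B w x)) = ?d w"
      by (rule sum.cong) (auto simp: BN_def[abs_def] B_def[abs_def] cells_def)
    also have "\<dots> \<le> (\<Sum>w'\<in>{u, v}. ?d w')"
      by (rule member_le_sum) (use w nn in auto)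
    also have "\<dots> = 2 * m * (freq z (N - {z}) - freq z (side w))"
      unfolding freq_def using m_pos by (simp add: sum_subtractf diff_divide_distrib[symmetric])
    finally show "(\<Sum>x\<in>cells {z}. pr (BN w x) - pr (B w x)) \<le> 2 * m * (freq z (N - {z}) - freq z (side w))" .
  qed
  also have "\<dots> = 2 * m * (\<Sum>z\<in>Zs. freq z (N - {z}) - freq z (side w))" by (simp add: sum_distrib_left)
  also have "\<dots> \<le> 2 * m * \<xi>" by (rule mult_left_mono[OF st]) simp
  finally show ?thesis .
qed

end

section \<open>Joining the two giants with positive probability\<close>

context block
begin

definition rep :: "'a \<Rightarrow> nat" where "rep w = (SOME i. i \<in> side w)"

text \<open>A component of copy \<open>w\<close> alone with a majority both in \<open>X\<close> and
  in one fixed cell. Since \<open>rep w\<close> belongs to the side that decides colours in copy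
  \<open>w\<close>, this giant is visible to \<open>B w\<close>.\<close>

definition giant :: "'a \<Rightarrow> nat set \<Rightarrow> ('a \<times> nat) set set \<Rightarrow> bool" where
  "giant w X S \<longleftrightarrow> (\<exists>a. maj S ({w} \<times> (X \<union> cells {rep w})) a w X \<and>
     maj S ({w} \<times> (X \<union> cells {rep w})) a w (cells {rep w}))"

lemma rep_side: "rep w \<in> side w"
  unfolding rep_def by (rule someI_ex) (use ne in \<open>auto simp: side_def\<close>)

lemma rep_M: "rep w < M"
  using rep_side[of w] side_N[of w] sub unfolding N_def by auto

lemma giant_B_v:
  assumes X: "X \<subseteq> cells {z}" and "giant v X S"
  shows "card X < 2 * card {x \<in> X. B v x S}"
proof -
  obtain a where a: "maj S ({v} \<times> (X \<union> cells {rep v})) a v X"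
    "maj S ({v} \<times> (X \<union> cells {rep v})) a v (cells {rep v})" using assms(2) unfolding giant_def by blast
  have finX: "finite X" using X fin_cells finite_subset by blast
  have "B v x S" if x: "x \<in> X" "conn S ({v} \<times> (X \<union> cells {rep v})) a (v, x)" for x
  proof -
    have "cl x = z" using X x(1) by (auto simp: cells_def)
    then have sub: "{v} \<times> (X \<union> cells {rep v}) \<subseteq> both (side v) \<union> {v} \<times> cells {cl x}"
      using X rep_side[of v] unfolding both_def cells_def by auto
    have "maj S (both (side v) \<union> {v} \<times> cells {cl x}) (v, x) v (cells {rep v})"
      by (rule maj_mono[OF a(2) sub conn_mono[OF x(2) sub] fin_cells])
    then show ?thesis unfolding B_def attached_def blue_def using rep_M by blast
  qed
  then have "card {x \<in> X. conn S ({v} \<times> (X \<union> cells {rep v})) a (v, x)} \<le> card {x \<in> X. B v x S}"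
    using finX by (intro card_mono) auto
  then show ?thesis using a(1) unfolding maj_def by linarith
qed

text \<open>If blue were the majority in copy \<open>u\<close>, it would meet the giant of
  \<open>u\<close>, and the two giants would be joined within \<open>both J\<close>. In copy
  \<open>v\<close>, by contrast, the giant itself is blue (\<open>giant_B_v\<close>). This asymmetry
  selects opposite arcs of the circle for the two copies.\<close>

lemma giant_B_u:
  assumes X: "X \<subseteq> cells {z}" "z \<in> Zs" and g: "giant u X S" and J: "N \<subseteq> J" and ng: "\<not> good J S"
  shows "2 * card {x \<in> X. B u x S} \<le> card X"
proof (rule ccontr)
  assume c: "\<not> ?thesis"
  let ?W = "{u} \<times> (X \<union> cells {rep u})"
  obtain a where a: "maj S ?W a u X" "maj S ?W a u (cells {rep u})" using g unfolding giant_def by blast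
  have finX: "finite X" using X fin_cells finite_subset by blast
  have "{x \<in> X. B u x S} \<inter> {x \<in> X. conn S ?W a (u, x)} \<noteq> {}"
    by (rule majority_meet[OF finX]) (use c a(1) in \<open>auto simp: maj_def\<close>)
  then obtain x where x: "x \<in> X" "B u x S" "conn S ?W a (u, x)" by blast
  have clx: "cl x = z" using X x(1) by (auto simp: cells_def)
  have sN: "side u \<subseteq> N" using side_N by blast
  have "rep u \<in> J" "z \<in> J" using rep_side[of u] sN J X(2) unfolding N_def by auto
  then have sub1: "?W \<subseteq> both J" using X unfolding both_def cells_def by auto
  have sub2: "both (side u) \<union> {u} \<times> cells {cl x} \<subseteq> both J"
    using both_mono[of "side u" J] sN J \<open>z \<in> J\<close> clx unfolding both_def cells_def by auto
  have "maj S (both J) (u, x) u (cells {rep u})"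
    by (rule maj_mono[OF a(2) sub1 conn_mono[OF x(3) sub1] fin_cells])
  moreover obtain i where i: "i < M" "maj S (both (side u) \<union> {u} \<times> cells {cl x}) (u, x) v (cells {i})"
    using x(2) unfolding B_def attached_def blue_def by blast
  moreover have "maj S (both J) (u, x) v (cells {i})"
    by (rule maj_mono[OF i(2) sub2 conn_refl fin_cells])
  ultimately show False using ng rep_M unfolding good_def by blast
qed

lemma RB_disjoint: "{x \<in> U. R w x S} \<inter> {x \<in> U. B w x S} = {}"
  unfolding R_def by blast

lemma chord_card:
  fixes n r b :: real
  assumes "0 < n" "0 \<le> r" "0 \<le> b" "r + b \<le> n" "(4 - 2 * sqrt 3) * n\<^sup>2 \<le> r\<^sup>2 + b\<^sup>2" "b \<le> 3 / 5 * n"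
  shows "(sqrt 3 - 1) * n \<le> r + (2 - sqrt 3) * b"
proof -
  have "sqrt 3 - 1 \<le> r / n + (2 - sqrt 3) * (b / n)"
  proof (rule chord)
    show "r / n + b / n \<le> 1" using assms by (simp add: field_simps)
    show "4 - 2 * sqrt 3 \<le> (r / n)\<^sup>2 + (b / n)\<^sup>2" using assms by (simp add: power_divide field_simps)
    show "b / n \<le> 3 / 5" using assms by (simp add: field_simps)
  qed (use assms in auto)
  then have "(sqrt 3 - 1) * n \<le> (r / n + (2 - sqrt 3) * (b / n)) * n" using assms(1) by (intro mult_right_mono) auto
  also have "\<dots> = r + (2 - sqrt 3) * b" using assms(1) by (simp add: field_simps)
  finally show ?thesis .
qed

lemma sum_card_cells:
  assumes "U \<subseteq> Z"
  shows "card {x \<in> U. P x} = (\<Sum>z\<in>Zs. card {x \<in> U \<inter> cells {z}. P x})"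
proof -
  have "{x \<in> U. P x} = (\<Union>z\<in>Zs. {x \<in> U \<inter> cells {z}. P x})"
    using assms cl_Z Z_V by (fastforce simp: cells_def)
  also have "card \<dots> = (\<Sum>z\<in>Zs. card {x \<in> U \<inter> cells {z}. P x})"
  proof (rule card_UN_disjoint[OF fin_Zs])
    show "\<forall>z\<in>Zs. finite {x \<in> U \<inter> cells {z}. P x}" using fin_cells by simp
  qed (auto simp: cells_def)
  finally show ?thesis .
qed

lemma giant_region: "w \<in> {u, v} \<Longrightarrow> X \<subseteq> V \<Longrightarrow> {w} \<times> (X \<union> cells {rep w}) \<subseteq> full"
  unfolding full_def using cells_V by blast

lemma dep_giant: "w \<in> {u, v} \<Longrightarrow> X \<subseteq> V \<Longrightarrow> dep full (giant w X)"
  unfolding giant_def[abs_def] by (intro dep_ex dep_conj dep_mono[OF dep_maj giant_region])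

lemma expected_crossing:
  fixes \<xi> :: real
  assumes w: "w \<in> {u, v}" and st: "(\<Sum>z\<in>Zs. freq z (N - {z}) - freq z (side w)) \<le> \<xi>" and xi: "0 \<le> \<xi>"
  shows "(\<Sum>x\<in>Z. pr (\<lambda>S. R w x S \<and> B (other w) x S \<and> {(u, x), (v, x)} \<in> S)) \<le> 4 * m * (\<xi> + \<eta>) / \<delta>"
proof -
  let ?X = "\<Sum>x\<in>Z. pr (\<lambda>S. R w x S \<and> B (other w) x S \<and> {(u, x), (v, x)} \<in> S)"
  have w': "other w \<in> {u, v}" unfolding other_def by simp
  have d: "dep full (\<lambda>S. R w x S \<and> B (other w) x S \<and> {(u, x), (v, x)} \<in> S)" if "x \<in> Z" for x
    by (intro dep_conj dep_Rf dep_Bf dep_mem w w' that) (use that Z_V in \<open>auto simp: full_def\<close>)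
  have "thr * ?X \<le> 2 * (q * (k * m)) * (\<Sum>x\<in>Z. pr (fresh w x)) + 4 * err"
  proof (rule pr_sum_le[OF fin_Z fin_Z fin_full d dep_fresh[OF w]])
    fix S
    show "thr * real (card {x \<in> Z. R w x S \<and> B (other w) x S \<and> {(u, x), (v, x)} \<in> S})
      \<le> 2 * (q * (k * m)) * real (card {y \<in> Z. fresh w y S}) + 4 * err"
      using crossing_bound[OF w, of S] unfolding freshset_def by (simp add: algebra_simps)
  qed
  also have "\<dots> \<le> 2 * (q * (k * m)) * (2 * m * \<xi>) + 4 * err"
    using expected_fresh[OF w st] q_pos by (intro add_right_mono mult_left_mono) auto
  also have "\<dots> \<le> 4 * q * k * (real m)\<^sup>2 * (\<xi> + \<eta>)"
  proof -
    have "1 * (\<eta> * q * (real m)\<^sup>2) \<le> real k * (\<eta> * q * (real m)\<^sup>2)" using k_pos err_nn by (intro mult_right_mono) auto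
    then show ?thesis by (simp add: power2_eq_square algebra_simps)
  qed
  also have "\<dots> = thr * (4 * m * (\<xi> + \<eta>) / \<delta>)"
    unfolding thr_def using delta_pos by (simp add: power2_eq_square)
  finally show ?thesis by (simp only: mult_le_cancel_left_pos[OF thr_pos])
qed

text \<open>
  Here \<open>U\<close> is a set of test vertices with almost the same probabilities of being red and blue. The assumption
  that turns out to be impossible is \<open>gd\<close>; the others are satisfied by a suitable choice of constants.
\<close>

context
  fixes U J :: "nat set" and \<nu> K \<xi> :: real
  assumes U: "U \<subseteq> Z" "U \<noteq> {}" and J: "N \<subseteq> J"
    and nu: "0 < \<nu>" "\<nu> \<le> 1 / 100" and p: "4 - 2 * sqrt 3 + 4 * \<nu> \<le> p" "p \<le> 1"
    and K: "1 \<le> K" "60000 * \<eta> * K\<^sup>2 < 1" "\<delta> = \<nu> / (4 * K\<^sup>2)" "K\<^sup>2 \<le> \<nu> * k" "12 * \<eta> * K\<^sup>2 \<le> \<nu>"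
    and KU: "real (k * m) \<le> K * card U"
    and st: "\<And>w. w \<in> {u, v} \<Longrightarrow> (\<Sum>z\<in>Zs. freq z (N - {z}) - freq z (side w)) \<le> \<xi>"
    and gd: "pr (good J) \<le> \<nu> / 100"
    and sz: "8 * K / (\<nu>\<^sup>2 * (q * m)) \<le> \<nu> / 100" "8 * K\<^sup>2 * \<xi> / \<nu> \<le> \<nu> / 100" "k * (80 * K / (\<nu>\<^sup>2 * (q * m))) \<le> \<nu> / 100"
      "8 * K * (\<xi> + \<eta>) / \<delta> \<le> \<nu>"
    and xi: "0 \<le> \<xi>"
    and close: "\<And>w x y. w \<in> {u, v} \<Longrightarrow> x \<in> U \<Longrightarrow> y \<in> U \<Longrightarrow> \<bar>pr (B w x) - pr (B w y)\<bar> \<le> \<nu> / 40 \<and> \<bar>pr (R w x) - pr (R w y)\<bar> \<le> \<nu> / 40"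
begin

text \<open>Giants are demanded only in cells where \<open>U\<close> has at least
  \<open>m / (10 * K)\<close> vertices. The thinner cells together contain at most a tenth of
  \<open>U\<close>, because \<open>k * m \<le> K * card U\<close>; hence the bounds 2/5 and 3/5
  below.\<close>

definition typical :: "'a \<Rightarrow> ('a \<times> nat) set set \<Rightarrow> bool" where
  "typical w S \<longleftrightarrow>
     \<not> real (card {e \<in> edges_in U. Pair w ` e \<in> S}) < (p - \<nu>) * card (edges_in U) \<and>
     \<not> \<nu> / (4 * K\<^sup>2) * (k * m) \<le> card {x \<in> Z. fresh w x S} \<and>
     \<not> (\<exists>z\<in>{z \<in> Zs. 1 / (10 * K) * m \<le> card (U \<inter> cells {z})}. \<not> giant w (U \<inter> cells {z}) S) \<and>
     \<not> good J S"

text \<open>The error terms of \<open>open_edges_bound\<close>, together with that of the lower edge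
  count, add up to at most \<open>3 / 2 * \<nu> * q * n^2\<close>. Doubling gives
  \<open>3 * \<nu>\<close>; with the \<open>\<nu>\<close> lost to fluctuations of open edges this is
  the \<open>4 * \<nu>\<close> in the assumption on \<open>p\<close>.\<close>

lemma realized_squares:
  assumes w: "w \<in> {u, v}" and ty: "typical w S"
  shows "(4 - 2 * sqrt 3) * (real (card U))\<^sup>2 \<le> (real (card {x \<in> U. R w x S}))\<^sup>2 + (real (card {x \<in> U. B w x S}))\<^sup>2"
proof -
  have op: "(p - \<nu>) * card (edges_in U) \<le> card {e \<in> edges_in U. Pair w ` e \<in> S}"
    and fr: "card (freshset w S) \<le> \<nu> / (4 * K\<^sup>2) * (k * m)"
    using ty by (auto simp: typical_def freshset_def)
  define n r b L where "n = real (card U)" and "r = real (card {x \<in> U. R w x S})"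
    and "b = real (card {x \<in> U. B w x S})" and "L = real k * real m"
  have finU: "finite U" using U(1) fin_Z finite_subset by blast
  have n0: "0 < n" unfolding n_def using U(2) finU by (simp add: card_gt_0_iff)
  have k1: "1 \<le> real k" using k_pos by simp
  have L0: "0 \<le> L" "L \<le> K * n" using KU unfolding L_def n_def by simp_all
  have K0: "0 < K\<^sup>2" using K(1) by simp
  have L2: "L\<^sup>2 \<le> K\<^sup>2 * n\<^sup>2" using power_mono[OF L0(2) L0(1), of 2] by (simp add: power_mult_distrib)
  have m2: "(real m)\<^sup>2 \<le> L\<^sup>2" unfolding L_def using k1 mult_right_mono[of 1 "real k" "real m"] by (intro power_mono) auto
  have km2: "k * (real m)\<^sup>2 \<le> L\<^sup>2"
  proof -
    have "1 * (real k * (real m)\<^sup>2) \<le> real k * (real k * (real m)\<^sup>2)" using k1 by (intro mult_right_mono) auto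
    then show ?thesis unfolding L_def by (simp add: power2_eq_square ac_simps)
  qed
  have qn: "0 \<le> q * n\<^sup>2" using q_pos by simp
  have e1: "\<eta> * L\<^sup>2 \<le> \<nu> / 12 * n\<^sup>2"
  proof -
    have "\<eta> * L\<^sup>2 \<le> \<eta> * (K\<^sup>2 * n\<^sup>2)" using L2 eta_nn by (rule mult_left_mono)
    also have "\<dots> = (12 * \<eta> * K\<^sup>2) * (n\<^sup>2 / 12)" by simp
    also have "\<dots> \<le> \<nu> * (n\<^sup>2 / 12)" using K(5) by (intro mult_right_mono) auto
    finally show ?thesis by simp
  qed
  have er: "err \<le> \<nu> / 12 * (q * n\<^sup>2)"
  proof -
    have "\<eta> * (real m)\<^sup>2 \<le> \<nu> / 12 * n\<^sup>2" using mult_left_mono[OF m2 eta_nn] e1 by linarith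
    then have "q * (\<eta> * (real m)\<^sup>2) \<le> q * (\<nu> / 12 * n\<^sup>2)" using q_pos by (intro mult_left_mono) auto
    then show ?thesis by (simp add: ac_simps)
  qed
  have ker: "k * err \<le> \<nu> / 12 * (q * n\<^sup>2)"
  proof -
    have "\<eta> * (k * (real m)\<^sup>2) \<le> \<nu> / 12 * n\<^sup>2" using mult_left_mono[OF km2 eta_nn] e1 by linarith
    then have "q * (\<eta> * (k * (real m)\<^sup>2)) \<le> q * (\<nu> / 12 * n\<^sup>2)" using q_pos by (intro mult_left_mono) auto
    then show ?thesis by (simp add: ac_simps)
  qed
  have same: "k * (q * (real m)\<^sup>2 / 2) \<le> \<nu> / 2 * (q * n\<^sup>2)"
  proof -
    have "real k * (k * (real m)\<^sup>2) = L\<^sup>2" unfolding L_def by (simp add: power2_eq_square)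
    also have "\<dots> \<le> (\<nu> * k) * n\<^sup>2" using L2 mult_right_mono[OF K(4), of "n\<^sup>2"] by simp
    also have "\<dots> = real k * (\<nu> * n\<^sup>2)" by simp
    finally have "k * (real m)\<^sup>2 \<le> \<nu> * n\<^sup>2" using k_pos by simp
    then have "q / 2 * (k * (real m)\<^sup>2) \<le> q / 2 * (\<nu> * n\<^sup>2)" using q_pos by (intro mult_left_mono) auto
    then show ?thesis by (simp add: ac_simps)
  qed
  have dL: "\<nu> / (4 * K\<^sup>2) * L\<^sup>2 \<le> \<nu> / 4 * n\<^sup>2"
  proof -
    have "\<nu> / (4 * K\<^sup>2) * L\<^sup>2 \<le> \<nu> / (4 * K\<^sup>2) * (K\<^sup>2 * n\<^sup>2)" using L2 nu(1) K0 by (intro mult_left_mono) auto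
    then show ?thesis using K0 by simp
  qed
  have th: "thr * (k * m) \<le> \<nu> / 4 * (q * n\<^sup>2)"
  proof -
    have "thr * (k * m) = q * (\<nu> / (4 * K\<^sup>2) * L\<^sup>2)" unfolding thr_def L_def by (simp add: K(3) power2_eq_square)
    also have "\<dots> \<le> q * (\<nu> / 4 * n\<^sup>2)" using dL q_pos by (intro mult_left_mono) auto
    finally show ?thesis by (simp add: ac_simps)
  qed
  have fs: "q * (k * m) * card (freshset w S) \<le> \<nu> / 4 * (q * n\<^sup>2)"
  proof -
    have "q * (k * m) * card (freshset w S) \<le> q * (k * m) * (\<nu> / (4 * K\<^sup>2) * (k * m))"
      using fr q_pos by (intro mult_left_mono) auto
    also have "\<dots> = q * (\<nu> / (4 * K\<^sup>2) * L\<^sup>2)" unfolding L_def by (simp add: power2_eq_square)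
    also have "\<dots> \<le> q * (\<nu> / 4 * n\<^sup>2)" using dL q_pos by (intro mult_left_mono) auto
    finally show ?thesis by (simp add: ac_simps)
  qed
  have pn: "0 \<le> p - \<nu>" "p - \<nu> \<le> 1" using nu p sqrt3_bounds by auto
  have "(p - \<nu>) * (q * n\<^sup>2 / 2 - err) \<le> (p - \<nu>) * card (edges_in U)"
    unfolding n_def by (rule mult_left_mono[OF edges_in_ge pn(1)]) (use U(1) Z_V in blast)
  then have "(p - \<nu>) * (q * n\<^sup>2 / 2) - err \<le> (p - \<nu>) * card (edges_in U)"
    using mult_right_mono[OF pn(2) err_nn] by (simp add: right_diff_distrib)
  then have "(p - \<nu>) * (q * n\<^sup>2 / 2) - err \<le> k * (q * (real m)\<^sup>2 / 2) + k * err + (\<nu> / 4 * (q * n\<^sup>2) + 2 * err) + \<nu> / 4 * (q * n\<^sup>2)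
      + (q * r\<^sup>2 / 2 + err) + (q * b\<^sup>2 / 2 + err)"
    using op open_edges_bound[OF w U(1), of S] th fs unfolding r_def b_def by (simp add: distrib_left)
  then have "(p - \<nu>) * (q * n\<^sup>2 / 2) \<le> 3 / 2 * \<nu> * (q * n\<^sup>2) + q * r\<^sup>2 / 2 + q * b\<^sup>2 / 2"
    using er ker same by linarith
  then have "q * ((p - 4 * \<nu>) * n\<^sup>2) \<le> q * (r\<^sup>2 + b\<^sup>2)" by (simp add: algebra_simps)
  then have "(p - 4 * \<nu>) * n\<^sup>2 \<le> r\<^sup>2 + b\<^sup>2" using q_pos by simp
  moreover have "(4 - 2 * sqrt 3) * n\<^sup>2 \<le> (p - 4 * \<nu>) * n\<^sup>2" using p(1) by (intro mult_right_mono) auto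
  ultimately show ?thesis unfolding n_def r_def b_def by linarith
qed

text \<open>In copy \<open>u\<close> at most \<open>1 / 2 + 1 / 10\<close> of \<open>U\<close> is
  blue; in copy \<open>v\<close> at least \<open>1 / 2 - 1 / 10\<close> is, so red takes at most 3/5
  there. The chord inequality is therefore applied with the colours exchanged in copy
  \<open>v\<close>.\<close>

lemma typical_chord:
  assumes w: "w \<in> {u, v}" and ty: "typical w S"
  shows "(sqrt 3 - 1) * card U \<le> (if w = u then 1 else 2 - sqrt 3) * card {x \<in> U. R w x S} + (if w = u then 2 - sqrt 3 else 1) * card {x \<in> U. B w x S}"
proof -
  define n r b where "n = real (card U)" and "r = real (card {x \<in> U. R w x S})"
    and "b = real (card {x \<in> U. B w x S})"
  have finU: "finite U" using U(1) fin_Z finite_subset by blast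
  have n0: "0 < n" unfolding n_def using U(2) finU by (simp add: card_gt_0_iff)
  have rb: "r + b \<le> n"
  proof -
    have "card {x \<in> U. R w x S} + card {x \<in> U. B w x S} = card ({x \<in> U. R w x S} \<union> {x \<in> U. B w x S})"
      by (rule card_Un_disjoint[symmetric]) (use finU RB_disjoint in auto)
    also have "\<dots> \<le> card U" by (rule card_mono[OF finU]) blast
    finally show ?thesis unfolding r_def b_def n_def by linarith
  qed
  have sq: "(4 - 2 * sqrt 3) * n\<^sup>2 \<le> r\<^sup>2 + b\<^sup>2"
    unfolding n_def r_def b_def
    by (rule realized_squares[OF w ty])
  let ?U = "\<lambda>z. U \<inter> cells {z}"
  have gi: "giant w (?U z) S" if "z \<in> Zs" "1 / (10 * K) * m \<le> card (?U z)" for z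
    using ty that unfolding typical_def by blast
  have small: "k * (1 / (10 * K) * m) \<le> n / 10"
  proof -
    have "k * (1 / (10 * K) * m) = real (k * m) / (10 * K)" by simp
    also have "\<dots> \<le> K * n / (10 * K)" using KU K(1) unfolding n_def by (intro divide_right_mono) auto
    finally show ?thesis using K(1) by simp
  qed
  have nsum: "n = (\<Sum>z\<in>Zs. real (card (?U z)))"
  proof -
    have T: "{x \<in> X. True} = X" for X :: "nat set" by blast
    show ?thesis using sum_card_cells[OF U(1), of "\<lambda>_. True"] unfolding n_def T by (simp only: of_nat_sum)
  qed
  have bsum: "b = (\<Sum>z\<in>Zs. real (card {x \<in> ?U z. B w x S}))"
    using sum_card_cells[OF U(1), of "\<lambda>x. B w x S"] unfolding b_def by simp
  show ?thesis
  proof (cases "w = u")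
    case True
    have "b \<le> (\<Sum>z\<in>Zs. real (card (?U z)) / 2 + 1 / (10 * K) * m)"
      unfolding bsum
    proof (rule sum_mono)
      fix z assume z: "z \<in> Zs"
      have le: "card {x \<in> ?U z. B w x S} \<le> card (?U z)" using finU by (intro card_mono) auto
      show "real (card {x \<in> ?U z. B w x S}) \<le> real (card (?U z)) / 2 + 1 / (10 * K) * m"
      proof (cases "1 / (10 * K) * m \<le> card (?U z)")
        case big: True
        have ng: "\<not> good J S" using ty unfolding typical_def by blast
        have "2 * card {x \<in> ?U z. B u x S} \<le> card (?U z)"
          by (rule giant_B_u[OF Int_lower2 z _ J ng]) (use gi[OF z big] True in simp)
        then have "real (card {x \<in> ?U z. B u x S}) \<le> real (card (?U z)) / 2" by linarith
        moreover have "0 \<le> 1 / (10 * K) * m" using K(1) by simp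
        ultimately show ?thesis unfolding True by linarith
      next
        case False
        then show ?thesis using le by linarith
      qed
    qed
    also have "\<dots> = n / 2 + k * (1 / (10 * K) * m)"
      by (simp only: sum.distrib sum_divide_distrib[symmetric] nsum[symmetric] sum_constant card_Zs)
    finally have "b \<le> 3 / 5 * n" using small by simp
    then show ?thesis using chord_card[OF n0 _ _ rb sq] True unfolding n_def r_def b_def by simp
  next
    case False
    then have wv: "w = v" using w by simp
    have "(\<Sum>z\<in>Zs. real (card (?U z)) / 2 - 1 / (10 * K) * m) \<le> b"
      unfolding bsum
    proof (rule sum_mono)
      fix z assume z: "z \<in> Zs"
      show "real (card (?U z)) / 2 - 1 / (10 * K) * m \<le> real (card {x \<in> ?U z. B w x S})"
      proof (cases "1 / (10 * K) * m \<le> card (?U z)")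
        case big: True
        have "card (?U z) < 2 * card {x \<in> ?U z. B v x S}"
          by (rule giant_B_v[OF Int_lower2]) (use gi[OF z big] wv in simp)
        moreover have "0 \<le> 1 / (10 * K) * m" using K(1) by simp
        ultimately show ?thesis unfolding wv by linarith
      qed simp
    qed
    moreover have "(\<Sum>z\<in>Zs. real (card (?U z)) / 2 - 1 / (10 * K) * m) = n / 2 - k * (1 / (10 * K) * m)"
      by (simp only: sum_subtractf sum_divide_distrib[symmetric] nsum[symmetric] sum_constant card_Zs)
    ultimately have "2 / 5 * n \<le> b" using small by simp
    then have "r \<le> 3 / 5 * n" using rb by simp
    moreover have "b + r \<le> n" "(4 - 2 * sqrt 3) * n\<^sup>2 \<le> b\<^sup>2 + r\<^sup>2" using rb sq by simp_all
    ultimately have "(sqrt 3 - 1) * n \<le> b + (2 - sqrt 3) * r"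
      using chord_card[OF n0, of b r] unfolding r_def b_def by simp
    then show ?thesis using False unfolding n_def r_def b_def by simp
  qed
qed

lemma pr_not_typical:
  assumes w: "w \<in> {u, v}"
  shows "dep full (typical w)" "1 - \<nu> / 25 \<le> pr (typical w)"
proof -
  let ?P1 = "\<lambda>S. real (card {e \<in> edges_in U. Pair w ` e \<in> S}) < (p - \<nu>) * card (edges_in U)"
  let ?P2 = "\<lambda>S. \<nu> / (4 * K\<^sup>2) * (k * m) \<le> card {x \<in> Z. fresh w x S}"
  let ?I = "{z \<in> Zs. 1 / (10 * K) * m \<le> card (U \<inter> cells {z})}"
  let ?P3 = "\<lambda>S. \<exists>z\<in>?I. \<not> giant w (U \<inter> cells {z}) S"
  have UV: "U \<subseteq> V" using U(1) Z_V by blast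
  have finU: "finite U" using fin_sub[OF UV] .
  have d1: "dep full ?P1"
    by (rule dep_card_open[of _ _ _ "\<lambda>n. real n < (p - \<nu>) * card (edges_in U)"])
      (use UV w in \<open>auto simp: edges_in_def full_def\<close>)
  have d2: "dep full ?P2"
    by (rule dep_Collect[of _ "\<lambda>x S. x \<in> Z \<and> fresh w x S" "\<lambda>A. \<nu> / (4 * K\<^sup>2) * (k * m) \<le> real (card A)"])
      (intro dep_guard dep_fresh w)
  have dg: "dep full (\<lambda>S. \<not> giant w (U \<inter> cells {z}) S)" for z
    by (intro dep_not dep_giant w) (use UV in blast)
  have d3: "dep full ?P3" unfolding Bex_def by (intro dep_ex dep_guard dg)
  have d4: "dep full (good J)" by (rule dep_mono[OF dep_good both_full])
  have ty: "typical w = (\<lambda>S. \<not> (?P1 S \<or> ?P2 S \<or> ?P3 S \<or> good J S))"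
    unfolding typical_def[abs_def] by blast
  show "dep full (typical w)" unfolding ty by (intro dep_not dep_disj d1 d2 d3 d4)
  have m0: "0 < real m" "0 < real k" using m_pos k_pos by simp_all
  have n0: "0 < real (card U)" using U(2) finU by (simp add: card_gt_0_iff)
  have K0: "0 < K" using K(1) by simp
  have p1: "pr ?P1 \<le> \<nu> / 100"
  proof -
    define n where "n = real (card U)"
    have mn: "m \<le> K * n" using KU k_pos mult_right_mono[of 1 "real k" "real m"] unfolding n_def by simp
    have "4 * (\<eta> * (real m)\<^sup>2) \<le> n\<^sup>2"
    proof -
      have "4 * (\<eta> * (real m)\<^sup>2) \<le> 4 * (\<eta> * (K * n)\<^sup>2)" using mn eta_nn by (intro mult_left_mono power_mono) auto
      also have "\<dots> = (4 * \<eta> * K\<^sup>2) * n\<^sup>2" by (simp add: power_mult_distrib)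
      also have "\<dots> \<le> 1 * n\<^sup>2"
      proof (rule mult_right_mono)
        have "0 \<le> \<eta> * K\<^sup>2" using eta_nn by simp
        then show "4 * \<eta> * K\<^sup>2 \<le> 1" using K(2) by simp
      qed simp
      finally show ?thesis by simp
    qed
    then have "q * (4 * (\<eta> * (real m)\<^sup>2)) \<le> q * n\<^sup>2" using q_pos by (intro mult_left_mono) auto
    then have e4: "err \<le> q * n\<^sup>2 / 4" by (simp add: ac_simps)
    then have F: "q * n\<^sup>2 / 4 \<le> card (edges_in U)" using edges_in_ge[OF UV] unfolding n_def by linarith
    have qn: "0 < q * n\<^sup>2 / 4" using q_pos n0 unfolding n_def by simp
    then have Fne: "edges_in U \<noteq> {}" using F by auto
    have "pr ?P1 \<le> 2 * card U / (\<nu>\<^sup>2 * card (edges_in U))"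
      by (rule pr_few_open[OF w order_refl Fne UV nu(1)])
    also have "\<dots> = 2 * n / (\<nu>\<^sup>2 * card (edges_in U))" by (simp add: n_def)
    also have "\<dots> \<le> 2 * n / (\<nu>\<^sup>2 * (q * n\<^sup>2 / 4))"
      using F qn nu(1) n0 unfolding n_def[symmetric]
      by (intro divide_left_mono mult_left_mono) auto
    also have "\<dots> = 8 / (\<nu>\<^sup>2 * q * n)" using n0 unfolding n_def by (simp add: power2_eq_square)
    also have "\<dots> \<le> 8 / (\<nu>\<^sup>2 * q * (m / K))"
    proof (rule divide_left_mono)
      have "m / K \<le> n" using mn K0 by (simp add: field_simps)
      then show "\<nu>\<^sup>2 * q * (m / K) \<le> \<nu>\<^sup>2 * q * n" using q_pos by (intro mult_left_mono) auto
    qed (use n0 m0 K0 q_pos nu(1) in \<open>auto simp: n_def\<close>)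
    also have "\<dots> = 8 * K / (\<nu>\<^sup>2 * (q * m))" using K0 by simp
    also have "\<dots> \<le> \<nu> / 100" by (rule sz(1))
    finally show ?thesis .
  qed
  have p2: "pr ?P2 \<le> \<nu> / 100"
  proof -
    have t0: "0 < \<nu> / (4 * K\<^sup>2) * (k * m)" using nu(1) K0 m0 by simp
    have "pr ?P2 \<le> (\<Sum>x\<in>Z. pr (fresh w x)) / (\<nu> / (4 * K\<^sup>2) * (k * m))"
      by (rule pr_markov[OF fin_Z fin_full dep_fresh[OF w] t0])
    also have "\<dots> \<le> 2 * m * \<xi> / (\<nu> / (4 * K\<^sup>2) * (k * m))"
      using expected_fresh[OF w st[OF w]] t0 by (intro divide_right_mono) auto
    also have "\<dots> = 8 * K\<^sup>2 * \<xi> / \<nu> / k" using m0 K0 nu(1) by (simp add: field_simps)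
    also have "\<dots> \<le> 8 * K\<^sup>2 * \<xi> / \<nu> / 1"
      using k_pos xi nu(1) by (intro divide_left_mono) auto
    finally show ?thesis using sz(2) by simp
  qed
  have p3: "pr ?P3 \<le> \<nu> / 100"
  proof -
    have "pr ?P3 \<le> (\<Sum>z\<in>?I. pr (\<lambda>S. \<not> giant w (U \<inter> cells {z}) S))"
      by (rule pr_Bex_le[OF _ fin_full dg]) (use fin_Zs in auto)
    also have "\<dots> \<le> (\<Sum>z\<in>?I. 80 * K / (\<nu>\<^sup>2 * (q * m)))"
    proof (rule sum_mono)
      fix z assume z: "z \<in> ?I"
      have "rep w \<noteq> z" using rep_side[of w] side_N[of w] z by blast
      then have dj: "U \<inter> cells {z} \<inter> cells {rep w} = {}" by (auto simp: cells_def)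
      \<comment> \<open>\<open>pr_no_giant\<close> with \<open>\<gamma> = 1 / (10 * K)\<close>; its
        condition \<open>600 * \<eta> < \<gamma>^2\<close> is the assumption
        \<open>60000 * \<eta> * K^2 < 1\<close>.\<close>
      have "pr (\<lambda>S. \<not> giant w (U \<inter> cells {z}) S) \<le> 8 / (\<nu>\<^sup>2 * (1 / (10 * K)) * (q * m))"
        unfolding giant_def
      proof (rule pr_no_giant[OF w _ cells_V dj nu(1) _ p(2)])
        show "U \<inter> cells {z} \<subseteq> V" using UV by blast
        show "52 / 100 \<le> p - \<nu>" using nu p sqrt3_bounds by simp
        show "1 / (10 * K) * real m \<le> card (U \<inter> cells {z})" using z by simp
        show "1 / (10 * K) * real m \<le> card (cells {rep w})"
          using card_cells1[OF rep_M] K(1) m0 by (simp add: field_simps)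
        show "600 * \<eta> < (1 / (10 * K))\<^sup>2" using K(2) K0 by (simp add: power_divide power_mult_distrib field_simps)
      qed (use K0 in auto)
      also have "\<dots> = 80 * K / (\<nu>\<^sup>2 * (q * m))" using K0 by simp
      finally show "pr (\<lambda>S. \<not> giant w (U \<inter> cells {z}) S) \<le> 80 * K / (\<nu>\<^sup>2 * (q * m))" .
    qed
    also have "\<dots> = card ?I * (80 * K / (\<nu>\<^sup>2 * (q * m)))" by simp
    also have "\<dots> \<le> k * (80 * K / (\<nu>\<^sup>2 * (q * m)))"
    proof (rule mult_right_mono)
      show "real (card ?I) \<le> real k" unfolding card_Zs[symmetric] of_nat_le_iff by (rule card_mono[OF fin_Zs]) auto
    qed (use K0 q_pos in auto)
    finally show ?thesis using sz(3) by simp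
  qed
  have "pr (\<lambda>S. ?P1 S \<or> ?P2 S \<or> ?P3 S \<or> good J S) \<le> pr ?P1 + (pr ?P2 + (pr ?P3 + pr (good J)))"
    using pr_disj_le[OF fin_full d1 dep_disj[OF d2 dep_disj[OF d3 d4]]]
      pr_disj_le[OF fin_full d2 dep_disj[OF d3 d4]] pr_disj_le[OF fin_full d3 d4] by linarith
  then have "pr (\<lambda>S. ?P1 S \<or> ?P2 S \<or> ?P3 S \<or> good J S) \<le> \<nu> / 25" using p1 p2 p3 gd by linarith
  moreover have "pr (typical w) = 1 - pr (\<lambda>S. ?P1 S \<or> ?P2 S \<or> ?P3 S \<or> good J S)"
    unfolding ty by (intro pr_not[OF fin_full] dep_disj d1 d2 d3 d4)
  ultimately show "1 - \<nu> / 25 \<le> pr (typical w)" by linarith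
qed

lemma block_contradiction: False
proof -
  define n where "n = real (card U)"
  have finU: "finite U" using U(1) fin_Z finite_subset by blast
  have n0: "0 < n" unfolding n_def using U(2) finU by (simp add: card_gt_0_iff)
  obtain x0 where x0: "x0 \<in> U" using U(2) by blast
  have UZ: "x \<in> Z" if "x \<in> U" for x using U(1) that by blast
  \<comment> \<open>\<open>\<nu> / 25\<close> accounts for atypical configurations,
    \<open>\<nu> / 20\<close> for the variation of the two frequencies over
    \<open>U\<close>.\<close>
  define \<tau> where "\<tau> = \<nu> / 25 + \<nu> / 20"
  define l where "l = 2 - sqrt (3 :: real)"
  have l: "0 \<le> l" "l \<le> 1" using sqrt3_bounds unfolding l_def by auto
  \<comment> \<open>The chord inequality is linear and so survives taking expectations, unlike the
    circle inequality for realised counts behind it.\<close>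
  have avg: "sqrt 3 - 1 - \<tau> \<le> a * pr (R w x0) + b * pr (B w x0)"
    if w: "w \<in> {u, v}" and ab: "a = (if w = u then 1 else l)" "b = (if w = u then l else 1)" for w a b
  proof -
    have ab0: "0 \<le> a" "a \<le> 1" "0 \<le> b" "b \<le> 1" using ab l by auto
    note ty = pr_not_typical[OF w]
    have "(sqrt 3 - 1) * n * pr (typical w) \<le> a * (\<Sum>x\<in>U. pr (R w x)) + b * (\<Sum>x\<in>U. pr (B w x))"
    proof (rule pr_linear[OF finU fin_full _ _ ty(1) ab0(1,3)])
      show "dep full (R w x)" "dep full (B w x)" if "x \<in> U" for x using dep_Rf[OF w] dep_Bf[OF w] UZ[OF that] by auto
      show "(sqrt 3 - 1) * n \<le> a * real (card {x \<in> U. R w x S}) + b * real (card {x \<in> U. B w x S})" if "typical w S" for S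
        using typical_chord[OF w that] unfolding n_def ab l_def .
    qed
    also have "\<dots> \<le> a * (n * (pr (R w x0) + \<nu> / 40)) + b * (n * (pr (B w x0) + \<nu> / 40))"
    proof -
      have c: "pr (R w x) \<le> pr (R w x0) + \<nu> / 40" "pr (B w x) \<le> pr (B w x0) + \<nu> / 40" if "x \<in> U" for x
        using close[OF w that x0] by linarith+
      have "(\<Sum>x\<in>U. pr (R w x)) \<le> (\<Sum>x\<in>U. pr (R w x0) + \<nu> / 40)"
        by (rule sum_mono) (rule c(1))
      moreover have "(\<Sum>x\<in>U. pr (B w x)) \<le> (\<Sum>x\<in>U. pr (B w x0) + \<nu> / 40)"
        by (rule sum_mono) (rule c(2))
      ultimately have "(\<Sum>x\<in>U. pr (R w x)) \<le> n * (pr (R w x0) + \<nu> / 40)" "(\<Sum>x\<in>U. pr (B w x)) \<le> n * (pr (B w x0) + \<nu> / 40)"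
        unfolding n_def by simp_all
      then show ?thesis using ab0 by (intro add_mono mult_left_mono)
    qed
    finally have "n * ((sqrt 3 - 1) * pr (typical w)) \<le> n * (a * (pr (R w x0) + \<nu> / 40) + b * (pr (B w x0) + \<nu> / 40))"
      by (simp add: algebra_simps)
    then have "(sqrt 3 - 1) * pr (typical w) \<le> a * (pr (R w x0) + \<nu> / 40) + b * (pr (B w x0) + \<nu> / 40)"
      using n0 by simp
    moreover have "(sqrt 3 - 1) * (1 - \<nu> / 25) \<le> (sqrt 3 - 1) * pr (typical w)"
      using ty(2) sqrt3_bounds by (intro mult_left_mono) auto
    moreover have "(sqrt 3 - 1) * (\<nu> / 25) \<le> 1 * (\<nu> / 25)" using sqrt3_bounds nu(1) by (intro mult_right_mono) auto
    moreover have "a * (\<nu> / 40) \<le> 1 * (\<nu> / 40)" "b * (\<nu> / 40) \<le> 1 * (\<nu> / 40)" using ab0 nu(1) by (intro mult_right_mono; simp)+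
    moreover have "(sqrt 3 - 1) * (1 - \<nu> / 25) = sqrt 3 - 1 - (sqrt 3 - 1) * (\<nu> / 25)"
      by (simp add: algebra_simps)
    moreover have "a * (pr (R w x0) + \<nu> / 40) + b * (pr (B w x0) + \<nu> / 40)
      = a * pr (R w x0) + b * pr (B w x0) + (a * (\<nu> / 40) + b * (\<nu> / 40))" by (simp add: algebra_simps)
    moreover define t where "t = (sqrt 3 - 1) * pr (typical w)"
    ultimately show ?thesis unfolding \<tau>_def t_def[symmetric] by linarith
  qed
  define r1 b1 r2 b2 where "r1 = pr (R u x0)" and "b1 = pr (B u x0)" and "r2 = pr (R v x0)" and "b2 = pr (B v x0)"
  have rb: "pr (R w x) + pr (B w x) \<le> 1" if "w \<in> {u, v}" "x \<in> U" for w x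
  proof -
    note dB = dep_Bf[OF that(1) UZ[OF that(2)]]
    have "pr (R w x) \<le> pr (\<lambda>S. \<not> B w x S)" by (rule pr_mono[OF fin_full dep_not[OF dB]]) (simp add: R_def)
    then show ?thesis using pr_not[OF fin_full dB] by simp
  qed
  have bil: "2 * sqrt 3 - 3 - 6 * \<tau> \<le> r1 * b2 + b1 * r2"
  proof (rule bilinear_bound)
    show "sqrt 3 - 1 - \<tau> \<le> r1 + (2 - sqrt 3) * b1" using avg[of u 1 l] unfolding r1_def b1_def l_def by simp
    show "sqrt 3 - 1 - \<tau> \<le> b2 + (2 - sqrt 3) * r2" using avg[of v l 1] uv unfolding r2_def b2_def l_def by simp
    show "r1 + b1 \<le> 1" "r2 + b2 \<le> 1" using rb[OF _ x0] unfolding r1_def b1_def r2_def b2_def by simp_all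
    show "0 \<le> \<tau>" using nu(1) unfolding \<tau>_def by simp
  qed (simp_all add: r1_def b1_def r2_def b2_def pr_nonneg)
  have prodb: "r * b - \<nu> / 20 \<le> r' * b'"
    if "\<bar>r' - r\<bar> \<le> \<nu> / 40" "\<bar>b' - b\<bar> \<le> \<nu> / 40" "0 \<le> r'" "r' \<le> 1" "0 \<le> b" "b \<le> 1" for r b r' b' :: real
  proof -
    have "\<bar>r' * (b' - b)\<bar> \<le> 1 * (\<nu> / 40)" unfolding abs_mult using that by (intro mult_mono) auto
    moreover have "\<bar>b * (r' - r)\<bar> \<le> 1 * (\<nu> / 40)" unfolding abs_mult using that by (intro mult_mono) auto
    moreover have "r' * b' = r * b + r' * (b' - b) + b * (r' - r)" by (simp add: algebra_simps)
    ultimately show ?thesis by linarith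
  qed
  define Xu Xv where "Xu x = pr (\<lambda>S. R u x S \<and> B v x S \<and> {(u, x), (v, x)} \<in> S)"
    and "Xv x = pr (\<lambda>S. R v x S \<and> B u x S \<and> {(u, x), (v, x)} \<in> S)" for x
  have vx: "p \<le> 1 - (r1 * b2 - \<nu> / 20) - (b1 * r2 - \<nu> / 20) + Xu x + Xv x" if x: "x \<in> U" for x
  proof -
    note xZ = UZ[OF x]
    have uvm: "u \<in> {u, v}" "v \<in> {u, v}" by auto
    have dC: "dep full (\<lambda>S. {(u, x), (v, x)} \<in> S)" by (rule dep_mem) (use xZ Z_V in \<open>auto simp: full_def\<close>)
    have "p \<le> pr (\<lambda>S. {(u, x), (v, x)} \<in> S)" by (rule pr_edge[OF vert]) (use xZ Z_V in blast)
    also have "\<dots> \<le> 1 - pr (\<lambda>S. R u x S \<and> B v x S) - pr (\<lambda>S. B u x S \<and> R v x S)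
      + pr (\<lambda>S. (R u x S \<and> B v x S) \<and> {(u, x), (v, x)} \<in> S) + pr (\<lambda>S. (B u x S \<and> R v x S) \<and> {(u, x), (v, x)} \<in> S)"
      by (rule pr_vertical[OF fin_full dep_conj[OF dep_Rf[OF uvm(1) xZ] dep_Bf[OF uvm(2) xZ]]
            dep_conj[OF dep_Bf[OF uvm(1) xZ] dep_Rf[OF uvm(2) xZ]] dC]) (simp add: R_def)
    also have "pr (\<lambda>S. (R u x S \<and> B v x S) \<and> {(u, x), (v, x)} \<in> S) = Xu x" unfolding Xu_def by (rule pr_cong) auto
    also have "pr (\<lambda>S. (B u x S \<and> R v x S) \<and> {(u, x), (v, x)} \<in> S) = Xv x" unfolding Xv_def by (rule pr_cong) auto
    \<comment> \<open>Here the disjoint regions pay off: the joint probabilities of the colours at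
      \<open>x\<close> are products, and the bilinear form appears.\<close>
    also have "pr (\<lambda>S. R u x S \<and> B v x S) = pr (R u x) * pr (B v x)"
      by (rule pr_indep[OF fin_regionw fin_regionw region_disj dep_R[OF xZ] dep_B[OF xZ]])
    also have "pr (\<lambda>S. B u x S \<and> R v x S) = pr (B u x) * pr (R v x)"
      by (rule pr_indep[OF fin_regionw fin_regionw region_disj dep_B[OF xZ] dep_R[OF xZ]])
    finally have *: "p \<le> 1 - pr (R u x) * pr (B v x) - pr (B u x) * pr (R v x) + Xu x + Xv x" .
    have "r1 * b2 - \<nu> / 20 \<le> pr (R u x) * pr (B v x)" unfolding r1_def b2_def
      by (rule prodb) (use close[OF _ x x0] pr_nonneg pr_le1 in auto)
    moreover have "b1 * r2 - \<nu> / 20 \<le> pr (B u x) * pr (R v x)" unfolding b1_def r2_def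
      by (rule prodb) (use close[OF _ x x0] pr_nonneg pr_le1 in auto)
    ultimately show ?thesis using * by linarith
  qed
  have "n * p = (\<Sum>x\<in>U. p)" unfolding n_def by simp
  also have "\<dots> \<le> (\<Sum>x\<in>U. (1 - (r1 * b2 - \<nu> / 20) - (b1 * r2 - \<nu> / 20)) + (Xu x + Xv x))"
    by (rule sum_mono) (use vx in \<open>simp add: add.assoc\<close>)
  also have "\<dots> = n * (1 - (r1 * b2 - \<nu> / 20) - (b1 * r2 - \<nu> / 20)) + ((\<Sum>x\<in>U. Xu x) + (\<Sum>x\<in>U. Xv x))"
    unfolding n_def by (simp add: sum.distrib)
  also have "(\<Sum>x\<in>U. Xu x) + (\<Sum>x\<in>U. Xv x) \<le> \<nu> * n"
  proof -
    have "(\<Sum>x\<in>U. Xu x) \<le> (\<Sum>x\<in>Z. Xu x)" "(\<Sum>x\<in>U. Xv x) \<le> (\<Sum>x\<in>Z. Xv x)"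
      by (rule sum_mono2[OF fin_Z U(1)]; simp add: Xu_def Xv_def pr_nonneg)+
    moreover have "(\<Sum>x\<in>Z. Xu x) \<le> 4 * m * (\<xi> + \<eta>) / \<delta>" "(\<Sum>x\<in>Z. Xv x) \<le> 4 * m * (\<xi> + \<eta>) / \<delta>"
      using expected_crossing[OF _ st xi, of u] expected_crossing[OF _ st xi, of v] uv unfolding Xu_def Xv_def other_def by simp_all
    moreover have "4 * m * (\<xi> + \<eta>) / \<delta> \<le> 4 * (K * n) * (\<xi> + \<eta>) / \<delta>"
    proof -
      have "m \<le> K * n" using KU k_pos mult_right_mono[of 1 "real k" "real m"] unfolding n_def by simp
      then show ?thesis using xi eta_nn delta_pos by (intro divide_right_mono mult_right_mono mult_left_mono) auto
    qed
    moreover have "8 * K * (\<xi> + \<eta>) / \<delta> * n \<le> \<nu> * n" using sz(4) n0 by (intro mult_right_mono) auto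
    moreover have "8 * K * (\<xi> + \<eta>) / \<delta> * n = 2 * (4 * (K * n) * (\<xi> + \<eta>) / \<delta>)" by simp
    note facts = calculation this
    have arith: "a + b \<le> f" if "a \<le> a'" "b \<le> b'" "a' \<le> c" "b' \<le> c" "c \<le> d" "e \<le> f" "e = 2 * d"
      for a b a' b' c d e f :: real using that by linarith
    show ?thesis using facts by (rule arith)
  qed
  finally have "n * p \<le> n * (1 - (r1 * b2 - \<nu> / 20) - (b1 * r2 - \<nu> / 20) + \<nu>)" by (simp add: algebra_simps)
  then have "p \<le> 1 - (r1 * b2 - \<nu> / 20) - (b1 * r2 - \<nu> / 20) + \<nu>" using n0 by simp
  \<comment> \<open>The accumulated loss \<open>6 * \<tau> + \<nu> / 10 + \<nu>\<close> is less than
    \<open>4 * \<nu>\<close>, whereas \<open>1 - (2 * sqrt 3 - 3) = 4 - 2 * sqrt 3\<close>.\<close>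
  then show False using bil nu(1) p(1) unfolding \<tau>_def by argo
qed

end

end

section \<open>Joining the two giants with high probability\<close>

text \<open>The bilinear form has to be evaluated at one pair of colour frequencies, but the
  frequencies vary with the vertex, and an average of products is not the product of averages.
  Rounding the four frequencies to multiples of \<open>1 / L\<close> leaves at most
  \<open>(L + 1)^4\<close> classes, so one of them is large; this number is the later
  \<open>K\<close>.\<close>

lemma pigeonhole_class:
  fixes g1 g2 g3 g4 :: "nat \<Rightarrow> real" and L :: nat
  assumes Z: "finite Z" "Z \<noteq> {}" and L: "0 < L"
    and rng: "\<And>x. x \<in> Z \<Longrightarrow> 0 \<le> g1 x \<and> g1 x \<le> 1 \<and> 0 \<le> g2 x \<and> g2 x \<le> 1 \<and> 0 \<le> g3 x \<and> g3 x \<le> 1 \<and> 0 \<le> g4 x \<and> g4 x \<le> 1"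
  shows "\<exists>U\<subseteq>Z. U \<noteq> {} \<and> card Z \<le> (L + 1) ^ 4 * card U \<and>
    (\<forall>x\<in>U. \<forall>y\<in>U. \<bar>g1 x - g1 y\<bar> \<le> 1 / L \<and> \<bar>g2 x - g2 y\<bar> \<le> 1 / L \<and> \<bar>g3 x - g3 y\<bar> \<le> 1 / L \<and> \<bar>g4 x - g4 y\<bar> \<le> 1 / L)"
proof -
  define f where "f g x = nat \<lfloor>real L * g x\<rfloor>" for g :: "nat \<Rightarrow> real" and x
  define h where "h x = (f g1 x, f g2 x, f g3 x, f g4 x)" for x
  let ?C = "{..L} \<times> {..L} \<times> {..L} \<times> {..L}"
  have cC: "card ?C = (L + 1) ^ 4" by (simp add: card_cartesian_product power4_eq_xxxx)
  have fL: "f g x \<le> L" if "0 \<le> g x" "g x \<le> 1" for g x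
  proof -
    have "real L * g x \<le> real L * 1" using that by (intro mult_left_mono) auto
    then have "\<lfloor>real L * g x\<rfloor> \<le> int L" by linarith
    then show ?thesis unfolding f_def by linarith
  qed
  have hC: "h ` Z \<subseteq> ?C" using fL rng unfolding h_def by auto
  define fib where "fib c = {x \<in> Z. h x = c}" for c
  have "Z = (\<Union>c\<in>?C. fib c)" using hC unfolding fib_def by blast
  then have "card Z = card (\<Union>c\<in>?C. fib c)" by (rule arg_cong)
  also have "\<dots> = (\<Sum>c\<in>?C. card (fib c))"
    by (rule card_UN_disjoint) (use Z in \<open>auto simp: fib_def\<close>)
  finally have cZ: "card Z = (\<Sum>c\<in>?C. card (fib c))" .
  have "\<exists>c\<in>?C. card Z \<le> (L + 1) ^ 4 * card (fib c)"
  proof (rule ccontr)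
    assume "\<not> ?thesis"
    then have "(\<Sum>c\<in>?C. (L + 1) ^ 4 * card (fib c)) < (\<Sum>c\<in>?C. card Z)"
      by (intro sum_strict_mono) (auto simp: not_le)
    then show False using cZ cC by (simp add: sum_distrib_left[symmetric])
  qed
  then obtain c where c: "card Z \<le> (L + 1) ^ 4 * card (fib c)" by blast
  have cl: "\<bar>g x - g y\<bar> \<le> 1 / L" if "f g x = f g y" "0 \<le> g x" "0 \<le> g y" for g x y
  proof -
    have "\<lfloor>real L * g x\<rfloor> = \<lfloor>real L * g y\<rfloor>" using that unfolding f_def by (simp add: eq_nat_nat_iff)
    then have "\<bar>real L * g x - real L * g y\<bar> < 1" by linarith
    moreover have "\<bar>real L * g x - real L * g y\<bar> = real L * \<bar>g x - g y\<bar>"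
      using L by (simp add: right_diff_distrib[symmetric] abs_mult)
    ultimately show ?thesis using L by (simp add: field_simps)
  qed
  show ?thesis
  proof (intro exI[of _ "fib c"] conjI)
    show "fib c \<subseteq> Z" by (auto simp: fib_def)
    show "fib c \<noteq> {}" using c Z by (auto simp: card_eq_0_iff)
    show "card Z \<le> (L + 1) ^ 4 * card (fib c)" by (rule c)
    show "\<forall>x\<in>fib c. \<forall>y\<in>fib c. \<bar>g1 x - g1 y\<bar> \<le> 1 / L \<and> \<bar>g2 x - g2 y\<bar> \<le> 1 / L \<and> \<bar>g3 x - g3 y\<bar> \<le> 1 / L \<and> \<bar>g4 x - g4 y\<bar> \<le> 1 / L"
    proof (intro ballI)
      fix x y assume "x \<in> fib c" "y \<in> fib c"
      then have xy: "x \<in> Z" "y \<in> Z" "h x = h y" by (auto simp: fib_def)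
      have "f g1 x = f g1 y" "f g2 x = f g2 y" "f g3 x = f g3 y" "f g4 x = f g4 y"
        using xy(3) unfolding h_def by auto
      then show "\<bar>g1 x - g1 y\<bar> \<le> 1 / L \<and> \<bar>g2 x - g2 y\<bar> \<le> 1 / L \<and> \<bar>g3 x - g3 y\<bar> \<le> 1 / L \<and> \<bar>g4 x - g4 y\<bar> \<le> 1 / L"
        using cl[of g1 x y] cl[of g2 x y] cl[of g3 x y] cl[of g4 x y] rng[OF xy(1)] rng[OF xy(2)] by blast
    qed
  qed
qed

lemma le_divide_pos_bound: "0 < b \<Longrightarrow> 0 < t \<Longrightarrow> a / t \<le> b \<Longrightarrow> t \<le> x \<Longrightarrow> 0 \<le> a \<Longrightarrow> a / x \<le> (b :: real)"
  by (meson divide_left_mono le_less_trans less_le_trans mult_pos_pos order_trans)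

text \<open>All constants are functions of \<open>\<nu>\<close>: \<open>L\<close> and
  \<open>K\<close> come first, then \<open>\<delta>\<close> and \<open>k\<close>, then
  \<open>\<xi>\<close>, and from these \<open>\<eta>0\<close>, \<open>T\<close> and
  \<open>\<kappa>\<close>. A small positive bound is enough here because it is amplified over
  disjoint blocks.\<close>

lemma two_layer_good:
  fixes \<nu> :: real
  assumes nu: "0 < \<nu>" "\<nu> \<le> 1 / 100"
  shows "\<exists>T>0. \<exists>\<eta>0>0. \<exists>\<kappa>>0. \<forall>E p \<mu> (u :: 'a) v V G cl M m q \<eta> J.
    two_layer E p \<mu> u v V G cl M m q \<eta> \<longrightarrow> 4 - 2 * sqrt 3 + 4 * \<nu> \<le> p \<longrightarrow> \<eta> \<le> \<eta>0 \<longrightarrow> \<kappa> \<le> q * m \<longrightarrow>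
    J \<subseteq> {..<M} \<longrightarrow> card J = T \<longrightarrow> \<nu> / 100 < model.pr E \<mu> (two_layer.good u v V cl M J)"
proof -
  obtain L :: nat where L0: "40 / \<nu> < L" using reals_Archimedean2 by blast
  moreover have "0 < 40 / \<nu>" using nu by simp
  ultimately have "0 < real L" by linarith
  then have L: "0 < L" "1 / L \<le> \<nu> / 40" using L0 nu by (auto simp: field_simps)
  define K :: real where "K = (real L + 1) ^ 4"
  have K: "1 \<le> K" unfolding K_def by (rule one_le_power) simp
  have K2: "0 < K\<^sup>2" using K by simp
  define \<delta> where "\<delta> = \<nu> / (4 * K\<^sup>2)"
  have \<delta>: "0 < \<delta>" unfolding \<delta>_def using nu K2 by simp
  obtain k0 :: nat where "K\<^sup>2 / \<nu> < k0" using reals_Archimedean2 by blast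
  then have "K\<^sup>2 / \<nu> \<le> Suc k0" by simp
  define k where "k = Suc k0"
  have k: "0 < k" "K\<^sup>2 \<le> \<nu> * k" using \<open>K\<^sup>2 / \<nu> \<le> Suc k0\<close> nu unfolding k_def by (auto simp: field_simps)
  define \<xi> where "\<xi> = min (\<nu>\<^sup>2 / (800 * K\<^sup>2)) (\<nu> * \<delta> / (16 * K))"
  have \<xi>: "0 < \<xi>" unfolding \<xi>_def using nu K2 K \<delta> by simp
  have \<xi>1: "8 * K\<^sup>2 * \<xi> / \<nu> \<le> \<nu> / 100"
  proof -
    have "8 * K\<^sup>2 * \<xi> / \<nu> \<le> 8 * K\<^sup>2 * (\<nu>\<^sup>2 / (800 * K\<^sup>2)) / \<nu>"
      using K2 nu unfolding \<xi>_def by (intro divide_right_mono mult_left_mono) auto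
    also have "\<dots> = \<nu> / 100" using K nu by (simp add: power2_eq_square)
    finally show ?thesis .
  qed
  have \<xi>2: "8 * K * \<xi> / \<delta> \<le> \<nu> / 2"
  proof -
    have "8 * K * \<xi> / \<delta> \<le> 8 * K * (\<nu> * \<delta> / (16 * K)) / \<delta>"
      using K \<delta> unfolding \<xi>_def by (intro divide_right_mono mult_left_mono) auto
    also have "\<dots> = \<nu> / 2" using K \<delta> by simp
    finally show ?thesis .
  qed
  define \<eta>0 where "\<eta>0 = min (1 / (120000 * K\<^sup>2)) (min (\<nu> / (12 * K\<^sup>2)) (\<nu> * \<delta> / (16 * K)))"
  have \<eta>0: "0 < \<eta>0" unfolding \<eta>0_def using nu K2 K \<delta> by simp
  obtain T where T: "0 < T" and stable: "\<And>(J :: nat set) f. card J = T \<Longrightarrow>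
    (\<forall>z\<in>J. \<forall>I I'. I \<subseteq> I' \<longrightarrow> I' \<subseteq> J \<longrightarrow> f z I \<le> f z I') \<Longrightarrow>
    (\<forall>z\<in>J. \<forall>I. I \<subseteq> J \<longrightarrow> 0 \<le> f z I \<and> f z I \<le> 1) \<Longrightarrow>
    (\<exists>I1 I2 Z. stable_triple f \<xi> (Suc k0) J I1 I2 Z)"
    using stable_choice[OF \<xi>, of k0] by blast
  define \<kappa> where "\<kappa> = k * (80 * K / \<nu>\<^sup>2) / (\<nu> / 100)"
  have \<kappa>: "0 < \<kappa>" unfolding \<kappa>_def using k(1) K nu by simp
  show ?thesis
  proof (rule exI[of _ T], rule conjI[OF T], rule exI[of _ \<eta>0], rule conjI[OF \<eta>0], rule exI[of _ \<kappa>], rule conjI[OF \<kappa>],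
      intro allI impI)
    fix E p \<mu> and u v :: 'a and V G cl M m q \<eta> and J :: "nat set"
    assume tl: "two_layer E p \<mu> u v V G cl M m q \<eta>" and p: "4 - 2 * sqrt 3 + 4 * \<nu> \<le> p" and \<eta>: "\<eta> \<le> \<eta>0"
      and qm: "\<kappa> \<le> q * real m" and J: "J \<subseteq> {..<M}" "card J = T"
    interpret two_layer E p \<mu> u v V G cl M m q \<eta> by (rule tl)
    show "\<nu> / 100 < pr (good J)"
    proof (rule ccontr)
      assume "\<not> ?thesis"
      then have gd: "pr (good J) \<le> \<nu> / 100" by simp
      obtain Iu Iv Zs where I: "Iu \<union> Iv \<union> Zs \<subseteq> J" "Iu \<inter> Iv = {}" "Iu \<inter> Zs = {}" "Iv \<inter> Zs = {}"
        "Iu \<noteq> {}" "Iv \<noteq> {}" "card Zs = k"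
        "(\<Sum>z\<in>Zs. freq z (Iu \<union> Iv \<union> Zs - {z}) - freq z Iu) \<le> \<xi>"
        "(\<Sum>z\<in>Zs. freq z (Iu \<union> Iv \<union> Zs - {z}) - freq z Iv) \<le> \<xi>"
      proof -
        have "\<exists>I1 I2 Z. stable_triple freq \<xi> (Suc k0) J I1 I2 Z"
          by (rule stable[OF J(2)]) (use freq_mono freq_range J(1) in auto)
        then show ?thesis using that unfolding stable_triple_def k_def by blast
      qed
      interpret b: block E p \<mu> u v V G cl M m q \<eta> Iu Iv Zs k \<delta>
        by unfold_locales (use I J k \<delta> in auto)
      have Zne: "b.Z \<noteq> {}" using b.card_Z k(1) m_pos by auto
      obtain U where U: "U \<subseteq> b.Z" "U \<noteq> {}" "card b.Z \<le> (L + 1) ^ 4 * card U"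
        and cl: "\<And>x y. x \<in> U \<Longrightarrow> y \<in> U \<Longrightarrow> \<bar>pr (b.B u x) - pr (b.B u y)\<bar> \<le> 1 / L \<and> \<bar>pr (b.B v x) - pr (b.B v y)\<bar> \<le> 1 / L \<and>
          \<bar>pr (b.R u x) - pr (b.R u y)\<bar> \<le> 1 / L \<and> \<bar>pr (b.R v x) - pr (b.R v y)\<bar> \<le> 1 / L"
        using pigeonhole_class[OF b.fin_Z Zne L(1), of "\<lambda>x. pr (b.B u x)" "\<lambda>x. pr (b.B v x)" "\<lambda>x. pr (b.R u x)" "\<lambda>x. pr (b.R v x)"]
          pr_nonneg pr_le1 by blast
      have qm0: "0 < q * m" using q_pos m_pos by simp
      have s3: "k * (80 * K / \<nu>\<^sup>2) / (q * m) \<le> \<nu> / 100"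
      proof (rule le_divide_pos_bound[OF _ \<kappa> _ qm])
        show "k * (80 * K / \<nu>\<^sup>2) / \<kappa> \<le> \<nu> / 100" unfolding \<kappa>_def using k(1) K nu by simp
      qed (use nu K in auto)
      have k1: "1 \<le> real k" using k(1) by simp
      have s1: "8 * K / (\<nu>\<^sup>2 * (q * m)) \<le> \<nu> / 100"
      proof -
        have "8 * K / (\<nu>\<^sup>2 * (q * m)) \<le> 1 * (80 * K / (\<nu>\<^sup>2 * (q * m)))"
          using K nu qm0 by (simp add: divide_right_mono)
        also have "\<dots> \<le> k * (80 * K / (\<nu>\<^sup>2 * (q * m)))"
          using k1 K nu qm0 by (intro mult_right_mono) auto
        also have "\<dots> = k * (80 * K / \<nu>\<^sup>2) / (q * m)" by simp
        finally show ?thesis using s3 by linarith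
      qed
      have e1: "60000 * \<eta> * K\<^sup>2 < 1"
      proof -
        have "\<eta> * K\<^sup>2 \<le> 1 / (120000 * K\<^sup>2) * K\<^sup>2" using \<eta> unfolding \<eta>0_def by (intro mult_right_mono) auto
        then show ?thesis using K2 by simp
      qed
      have e2: "12 * \<eta> * K\<^sup>2 \<le> \<nu>"
      proof -
        have "\<eta> * K\<^sup>2 \<le> \<nu> / (12 * K\<^sup>2) * K\<^sup>2" using \<eta> unfolding \<eta>0_def by (intro mult_right_mono) auto
        then show ?thesis using K2 by simp
      qed
      have e3: "8 * K * (\<xi> + \<eta>) / \<delta> \<le> \<nu>"
      proof -
        have "8 * K * \<eta> / \<delta> \<le> 8 * K * (\<nu> * \<delta> / (16 * K)) / \<delta>"
          using \<eta> K \<delta> unfolding \<eta>0_def by (intro divide_right_mono mult_left_mono) auto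
        also have "\<dots> = \<nu> / 2" using K \<delta> by simp
        finally have "8 * K * \<eta> / \<delta> \<le> \<nu> / 2" .
        moreover have "8 * K * (\<xi> + \<eta>) / \<delta> = 8 * K * \<xi> / \<delta> + 8 * K * \<eta> / \<delta>"
          by (simp add: distrib_left add_divide_distrib)
        ultimately show ?thesis using \<xi>2 by linarith
      qed
      obtain x where x: "x \<in> U" using U(2) by blast
      then have "x \<in> V" using U(1) b.Z_V by blast
      then have p1: "p \<le> 1" using pr_edge[OF vert] pr_le1 order_trans by blast
      have KU: "real (k * m) \<le> K * card U"
      proof -
        have "real (card b.Z) \<le> real ((L + 1) ^ 4 * card U)" using U(3) by (simp only: of_nat_le_iff)
        then show ?thesis unfolding b.card_Z K_def by (simp add: add.commute)
      qed
      have NJ: "b.N \<subseteq> J" using I(1) unfolding b.N_def .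
      show False
      proof (rule b.block_contradiction[OF U(1,2) NJ nu p p1 K e1 \<delta>_def k(2) e2 KU _ gd s1 \<xi>1 _ e3])
        show "(\<Sum>z\<in>Zs. freq z (b.N - {z}) - freq z (b.side w)) \<le> \<xi>" if "w \<in> {u, v}" for w
          using that I(8,9) uv unfolding b.N_def b.side_def by auto
        show "k * (80 * K / (\<nu>\<^sup>2 * (q * m))) \<le> \<nu> / 100" using s3 by simp
        show "0 \<le> \<xi>" using \<xi> by simp
        show "\<bar>pr (b.B w x) - pr (b.B w y)\<bar> \<le> \<nu> / 40 \<and> \<bar>pr (b.R w x) - pr (b.R w y)\<bar> \<le> \<nu> / 40"
          if "w \<in> {u, v}" "x \<in> U" "y \<in> U" for w x y
          using that(1) cl[OF that(2,3)] L(2) by (elim insertE emptyE) (simp_all; linarith)+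
      qed
    qed
  qed
qed

section \<open>Amplification over disjoint blocks of cells\<close>

context two_layer
begin

text \<open>Cell 0 is the common reference set, because \<open>opn\<close> in the renormalisation
  uses one set \<open>A\<close> at every site.\<close>

definition linked :: "('a \<times> nat) set set \<Rightarrow> bool" where
  "linked S \<longleftrightarrow> (\<exists>c. maj S ({u, v} \<times> V) c u (cells {0}) \<and> maj S ({u, v} \<times> V) c v (cells {0}))"

definition big :: "'a \<Rightarrow> nat \<Rightarrow> ('a \<times> nat) set set \<Rightarrow> bool" where
  "big w i S \<longleftrightarrow> (\<exists>a. maj S ({w} \<times> (cells {0} \<union> cells {i})) a w (cells {0}) \<and>
     maj S ({w} \<times> (cells {0} \<union> cells {i})) a w (cells {i}))"

text \<open>The giant given by \<open>big\<close> and the component of \<open>c\<close> both have a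
  majority in cell \<open>i\<close>, so they coincide and share the majority in cell 0.\<close>

lemma maj_transfer:
  assumes w: "w \<in> {u, v}" and c: "maj S ({u, v} \<times> V) c w (cells {i})" and g: "i = 0 \<or> big w i S"
  shows "maj S ({u, v} \<times> V) c w (cells {0})"
proof (cases "i = 0")
  case False
  let ?W = "{w} \<times> (cells {0} \<union> cells {i})"
  obtain a where a: "maj S ?W a w (cells {0})" "maj S ?W a w (cells {i})"
    using g False unfolding big_def by blast
  have sub: "?W \<subseteq> {u, v} \<times> V" using w cells_V by blast
  have "maj S ({u, v} \<times> V) a w (cells {i})" by (rule maj_mono[OF a(2) sub conn_refl fin_cells])
  then have "conn S ({u, v} \<times> V) a c" using c by (rule maj_meet[OF _ _ fin_cells])
  then show ?thesis by (rule maj_mono[OF a(1) sub _ fin_cells])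
qed (use c in simp)

lemma good_linked:
  assumes "good J S" "\<And>w i. w \<in> {u, v} \<Longrightarrow> 0 < i \<Longrightarrow> i < M \<Longrightarrow> big w i S"
  shows "linked S"
proof -
  obtain a i j where a: "i < M" "maj S (both J) a u (cells {i})" "j < M" "maj S (both J) a v (cells {j})"
    using assms(1) unfolding good_def by blast
  have sub: "both J \<subseteq> {u, v} \<times> V" unfolding both_def using cells_V by blast
  have "maj S ({u, v} \<times> V) a u (cells {0})"
    by (rule maj_transfer[OF _ maj_mono[OF a(2) sub conn_refl fin_cells]]) (use assms(2)[of u i] a(1) in auto)
  moreover have "maj S ({u, v} \<times> V) a v (cells {0})"
    by (rule maj_transfer[OF _ maj_mono[OF a(4) sub conn_refl fin_cells]]) (use assms(2)[of v j] a(3) in auto)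
  ultimately show ?thesis unfolding linked_def by blast
qed

text \<open>Blocks of \<open>T\<close> consecutive cell indices occupy disjoint vertex sets, so
  their failures are independent.\<close>

lemma pr_no_good:
  fixes c :: real
  assumes "\<And>j. j < t \<Longrightarrow> c \<le> pr (good {j * T..<Suc j * T})" "c \<le> 1"
  shows "pr (\<lambda>S. \<forall>j<t. \<not> good {j * T..<Suc j * T} S) \<le> (1 - c) ^ t"
  using assms(1)
proof (induction t)
  case 0
  then show ?case by (simp add: pr_le1)
next
  case (Suc t)
  let ?P = "\<lambda>S. \<forall>j<t. \<not> good {j * T..<Suc j * T} S" and ?Q = "\<lambda>S. \<not> good {t * T..<Suc t * T} S"
  have sub: "{j * T..<Suc j * T} \<subseteq> {..<t * T}" if "j < t" for j
    using mult_le_mono1[of "Suc j" t T] that by auto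
  have dP: "dep (both {..<t * T}) ?P"
    by (intro dep_all dep_imp dep_not) (rule dep_mono[OF dep_good both_mono[OF sub]])
  have dQ: "dep (both {t * T..<Suc t * T}) ?Q" by (intro dep_not dep_good)
  have disj: "both {..<t * T} \<inter> both {t * T..<Suc t * T} = {}" unfolding both_def cells_def by auto
  have "pr (\<lambda>S. \<forall>j<Suc t. \<not> good {j * T..<Suc j * T} S) = pr (\<lambda>S. ?P S \<and> ?Q S)"
    by (rule pr_cong) (auto simp: less_Suc_eq)
  also have "\<dots> = pr ?P * pr ?Q" by (rule pr_indep[OF fin_both fin_both disj dP dQ])
  also have "\<dots> \<le> (1 - c) ^ t * (1 - c)"
  proof (rule mult_mono)
    show "pr ?P \<le> (1 - c) ^ t" using Suc by simp
    show "pr ?Q \<le> 1 - c" using pr_not[OF fin_both dep_good] Suc.prems[of t] by simp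
  qed (use assms(2) pr_nonneg in auto)
  finally show ?case by (simp only: power_Suc2)
qed

lemma fin_uvV: "finite ({u, v} \<times> V)" using finV by simp

text \<open>One good block suffices once every cell of both copies is tied to cell 0 by a giant of
  its layer. The union over cells costs \<open>2 * M\<close> times the error of
  \<open>pr_no_giant\<close> with \<open>\<gamma> = 1\<close>, which is small when \<open>M\<close>
  is fixed and \<open>q * m\<close> is large.\<close>

lemma pr_linked:
  fixes \<nu> c :: real
  assumes M: "M = t * T" "0 < t" and good: "\<And>j. j < t \<Longrightarrow> c \<le> pr (good {j * T..<Suc j * T})" "c \<le> 1"
    and \<nu>: "0 < \<nu>" "52 / 100 \<le> p - \<nu>" "p \<le> 1" and \<eta>: "600 * \<eta> < 1"
  shows "1 - ((1 - c) ^ t + 2 * M * (8 / (\<nu>\<^sup>2 * (q * m)))) \<le> pr linked"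
proof -
  let ?I = "{u, v} \<times> {1..<M}"
  let ?bad = "\<lambda>S. (\<forall>j<t. \<not> good {j * T..<Suc j * T} S) \<or> (\<exists>z\<in>?I. \<not> big (fst z) (snd z) S)"
  have dl: "dep ({u, v} \<times> V) linked" unfolding linked_def[abs_def] by (intro dep_ex dep_conj dep_maj)
  have d1: "dep ({u, v} \<times> V) (\<lambda>S. \<forall>j<t. \<not> good {j * T..<Suc j * T} S)"
    by (intro dep_all dep_imp dep_not dep_mono[OF dep_good]) (use cells_V in \<open>auto simp: both_def\<close>)
  have db: "dep ({u, v} \<times> V) (\<lambda>S. \<not> big (fst z) (snd z) S)" if "z \<in> ?I" for z
    unfolding big_def by (intro dep_not dep_ex dep_conj dep_mono[OF dep_maj]) (use that cells_V in auto)
  have d2: "dep ({u, v} \<times> V) (\<lambda>S. \<exists>z\<in>?I. \<not> big (fst z) (snd z) S)"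
    unfolding Bex_def by (intro dep_ex dep_guard db)
  have "pr (\<lambda>S. \<not> linked S) \<le> pr ?bad"
  proof (rule pr_mono[OF fin_uvV dep_disj[OF d1 d2]])
    fix S assume n: "\<not> linked S"
    show "?bad S"
    proof (rule ccontr)
      assume "\<not> ?bad S"
      then obtain j where j: "good {j * T..<Suc j * T} S" and b0: "\<forall>z\<in>?I. big (fst z) (snd z) S"
        by blast
      have b: "big w i S" if "w \<in> {u, v}" "0 < i" "i < M" for w i
        using bspec[OF b0, of "(w, i)"] that by simp
      show False using good_linked[OF j b] n by blast
    qed
  qed
  also have "\<dots> \<le> pr (\<lambda>S. \<forall>j<t. \<not> good {j * T..<Suc j * T} S) + pr (\<lambda>S. \<exists>z\<in>?I. \<not> big (fst z) (snd z) S)"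
    by (rule pr_disj_le[OF fin_uvV d1 d2])
  also have "\<dots> \<le> (1 - c) ^ t + (\<Sum>z\<in>?I. pr (\<lambda>S. \<not> big (fst z) (snd z) S))"
    by (rule add_mono[OF pr_no_good[OF good] pr_Bex_le[OF _ fin_uvV db]]) auto
  also have "(\<Sum>z\<in>?I. pr (\<lambda>S. \<not> big (fst z) (snd z) S)) \<le> (\<Sum>z\<in>?I. 8 / (\<nu>\<^sup>2 * (q * m)))"
  proof (rule sum_mono)
    fix z assume z: "z \<in> ?I"
    then have w: "fst z \<in> {u, v}" and i: "0 < snd z" "snd z < M" by auto
    have dj: "cells {0} \<inter> cells {snd z} = {}" using i by (auto simp: cells_def)
    have "pr (\<lambda>S. \<not> big (fst z) (snd z) S) \<le> 8 / (\<nu>\<^sup>2 * 1 * (q * m))"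
      unfolding big_def
      by (rule pr_no_giant[OF w cells_V cells_V dj \<nu>]) (use i \<eta> card_cells1 in auto)
    then show "pr (\<lambda>S. \<not> big (fst z) (snd z) S) \<le> 8 / (\<nu>\<^sup>2 * (q * m))" by simp
  qed
  also have "\<dots> = 2 * (M - 1) * (8 / (\<nu>\<^sup>2 * (q * m)))"
    using uv by (simp add: card_cartesian_product)
  also have "\<dots> \<le> 2 * M * (8 / (\<nu>\<^sup>2 * (q * m)))" using q_pos by (intro mult_right_mono) auto
  finally have "pr (\<lambda>S. \<not> linked S) \<le> (1 - c) ^ t + 2 * M * (8 / (\<nu>\<^sup>2 * (q * m)))" by simp
  then show ?thesis using pr_not[OF fin_uvV dl] by linarith
qed

end

lemma two_layer_linked:
  fixes \<nu> \<epsilon> :: real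
  assumes nu: "0 < \<nu>" "\<nu> \<le> 1 / 100" and eps: "0 < \<epsilon>"
  shows "\<exists>M>0. \<exists>\<eta>0>0. \<exists>\<kappa>>0. \<forall>E p \<mu> (u :: 'a) v V G cl m q \<eta>.
    two_layer E p \<mu> u v V G cl M m q \<eta> \<longrightarrow> 4 - 2 * sqrt 3 + 4 * \<nu> \<le> p \<longrightarrow> \<eta> \<le> \<eta>0 \<longrightarrow> \<kappa> \<le> q * m \<longrightarrow>
    1 - \<epsilon> \<le> model.pr E \<mu> (two_layer.linked u v V cl)"
proof -
  obtain T \<eta>0 \<kappa> where T: "0 < T" and \<eta>0: "0 < \<eta>0" and \<kappa>: "0 < \<kappa>" and good: "\<And>E p \<mu> (u :: 'a) v V G cl M m q \<eta> J.
    two_layer E p \<mu> u v V G cl M m q \<eta> \<Longrightarrow> 4 - 2 * sqrt 3 + 4 * \<nu> \<le> p \<Longrightarrow> \<eta> \<le> \<eta>0 \<Longrightarrow> \<kappa> \<le> q * m \<Longrightarrow>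
    J \<subseteq> {..<M} \<Longrightarrow> card J = T \<Longrightarrow> \<nu> / 100 < model.pr E \<mu> (two_layer.good u v V cl M J)"
    using two_layer_good[OF nu] by metis
  have "(\<lambda>t. (1 - \<nu> / 100) ^ t) \<longlonglongrightarrow> 0" by (rule LIMSEQ_realpow_zero) (use nu in auto)
  then have "eventually (\<lambda>t. (1 - \<nu> / 100) ^ t < \<epsilon> / 2) sequentially"
    using eps by (intro order_tendstoD(2)) auto
  then obtain t0 where t0: "\<And>t. t0 \<le> t \<Longrightarrow> (1 - \<nu> / 100) ^ t < \<epsilon> / 2" unfolding eventually_sequentially by blast
  define t where "t = Suc t0"
  have t: "0 < t" "(1 - \<nu> / 100) ^ t < \<epsilon> / 2" using t0[of t] unfolding t_def by auto
  define M where "M = t * T"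
  have M: "0 < M" unfolding M_def using t(1) T by simp
  define \<eta>1 where "\<eta>1 = min \<eta>0 (1 / 1200)"
  define \<kappa>1 where "\<kappa>1 = max \<kappa> (2 * M * (8 / \<nu>\<^sup>2) / (\<epsilon> / 2))"
  have e1: "0 < \<eta>1" using \<eta>0 unfolding \<eta>1_def by simp
  have k1: "0 < \<kappa>1" using \<kappa> unfolding \<kappa>1_def by simp
  show ?thesis
  proof (rule exI[of _ M], rule conjI[OF M], rule exI[of _ \<eta>1], rule conjI[OF e1], rule exI[of _ \<kappa>1], rule conjI[OF k1],
      intro allI impI)
    fix E p \<mu> and u v :: 'a and V G cl m q \<eta>
    assume tl: "two_layer E p \<mu> u v V G cl M m q \<eta>" and p: "4 - 2 * sqrt 3 + 4 * \<nu> \<le> p" and \<eta>: "\<eta> \<le> \<eta>1"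
      and qm: "\<kappa>1 \<le> q * real m"
    interpret two_layer E p \<mu> u v V G cl M m q \<eta> by (rule tl)
    have "card (cells {0}) = m" by (rule card_cells1[OF M])
    then have "cells {0} \<noteq> {}" using m_pos by auto
    then obtain x where "x \<in> V" using cells_V by blast
    then have p1: "p \<le> 1" using pr_edge[OF vert] pr_le1 order_trans by blast
    have c: "\<nu> / 100 \<le> pr (good {j * T..<Suc j * T})" if "j < t" for j
    proof (rule less_imp_le, rule good[OF tl p])
      show "{j * T..<Suc j * T} \<subseteq> {..<M}"
        using mult_le_mono1[of "Suc j" t T] that unfolding M_def by auto
    qed (use \<eta> qm in \<open>auto simp: \<eta>1_def \<kappa>1_def\<close>)
    have small: "2 * M * (8 / \<nu>\<^sup>2) / (q * m) \<le> \<epsilon> / 2"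
    proof (rule le_divide_pos_bound)
      show "0 < 2 * M * (8 / \<nu>\<^sup>2) / (\<epsilon> / 2)" using M nu eps by simp
      show "2 * M * (8 / \<nu>\<^sup>2) / (\<epsilon> / 2) \<le> q * m" using qm unfolding \<kappa>1_def by simp
      show "2 * M * (8 / \<nu>\<^sup>2) / (2 * M * (8 / \<nu>\<^sup>2) / (\<epsilon> / 2)) \<le> \<epsilon> / 2" using M nu eps by simp
    qed (use eps nu in auto)
    have "1 - ((1 - \<nu> / 100) ^ t + 2 * M * (8 / (\<nu>\<^sup>2 * (q * m)))) \<le> pr linked"
      by (rule pr_linked[OF M_def t(1) c _ nu(1) _ p1]) (use nu p \<eta> sqrt3_bounds in \<open>auto simp: \<eta>1_def\<close>)
    moreover have "2 * M * (8 / (\<nu>\<^sup>2 * (q * m))) = 2 * M * (8 / \<nu>\<^sup>2) / (q * m)" by simp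
    ultimately show "1 - \<epsilon> \<le> pr linked" using small t(2) by linarith
  qed
qed

section \<open>The critical probability\<close>

lemma card_div_cell:
  assumes "i < M" "M * m \<le> n" "0 < (m :: nat)"
  shows "card {x \<in> {..<n}. (if x < M * m then x div m else M) = i} = m"
proof -
  have "{x \<in> {..<n}. (if x < M * m then x div m else M) = i} = {i * m..<Suc i * m}"
  proof (intro equalityI subsetI)
    fix x assume "x \<in> {x \<in> {..<n}. (if x < M * m then x div m else M) = i}"
    then have "x div m = i" using assms(1) by (auto split: if_splits)
    then show "x \<in> {i * m..<Suc i * m}"
      using assms(3) div_times_less_eq_dividend[of x m] dividend_less_div_times[of m x] by auto
  next
    fix x assume x: "x \<in> {i * m..<Suc i * m}"
    then have "x div m = i" by (auto intro: div_nat_eqI simp: mult.commute)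
    moreover have "Suc i * m \<le> M * m" using assms(1) by (intro mult_le_mono1) simp
    ultimately show "x \<in> {x \<in> {..<n}. (if x < M * m then x div m else M) = i}"
      using x assms(2) by auto
  qed
  then show ?thesis by simp
qed

lemma percolates_above:
  fixes q \<eta> p \<nu> :: real
  assumes linked: "\<And>E p \<mu> (u :: int \<times> int) v V G cl m q \<eta>.
      two_layer E p \<mu> u v V G cl M m q \<eta> \<Longrightarrow> 4 - 2 * sqrt 3 + 4 * \<nu> \<le> p \<Longrightarrow> \<eta> \<le> \<eta>0 \<Longrightarrow> \<kappa> \<le> q * m \<Longrightarrow>
      1 - 1 / 16384 \<le> model.pr E \<mu> (two_layer.linked u v V cl)"
    and G: "graph_on n G" and q: "0 < q" and \<eta>0: "0 < \<eta>0" and m: "0 < m" "M * m \<le> n" "\<kappa> \<le> q * m"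
    and pseudo: "\<And>U. U \<subseteq> {..<n} \<Longrightarrow> \<bar>real (card {e \<in> G. e \<subseteq> U}) - q * (real (card U))\<^sup>2 / 2\<bar> \<le> \<eta>0 * q * (real m)\<^sup>2"
    and p: "4 - 2 * sqrt 3 + 4 * \<nu> \<le> p"
    and \<mu>: "\<mu> \<in> models_ge (cart_prod UNIV Z2_edges {..<n} G) p"
  shows "percolates \<mu>"
proof -
  let ?E = "cart_prod UNIV Z2_edges {..<n} G"
  \<comment> \<open>Consecutive intervals of length \<open>m\<close>; the remaining vertices get the
    value \<open>M\<close>, which is not the index of a cell.\<close>
  define cl where "cl x = (if x < M * m then x div m else M)" for x
  have mod: "model ?E p \<mu>" by (rule model.intro[OF \<mu>])
  have Gxy: "\<exists>x y. e = {x, y} \<and> x \<noteq> y \<and> x \<in> {..<n} \<and> y \<in> {..<n}" if "e \<in> G" for e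
    using G that unfolding graph_on_def by auto
  have tl: "two_layer ?E p \<mu> z z' {..<n} G cl M m q \<eta>0" if z: "z' = z + (1, 0) \<or> z' = z + (0, 1)" for z z' :: "int \<times> int"
  proof (intro two_layer.intro mod two_layer_axioms.intro)
    show "z \<noteq> z'" using z by (cases z) auto
    show "Pair w ` e \<in> ?E" if e: "w \<in> {z, z'}" "e \<in> G" for w e
    proof -
      obtain x y where "e = {x, y}" using Gxy[OF e(2)] by blast
      then have "Pair w ` e = {(w, x), (w, y)}" "{x, y} \<in> G" using e(2) by auto
      then show ?thesis unfolding cart_prod_def by blast
    qed
    show "{(z, x), (z', x)} \<in> ?E" if "x \<in> {..<n}" for x
    proof -
      have "{z, z'} \<in> Z2_edges" using z unfolding Z2_edges_def by (intro CollectI exI[of _ z] exI[of _ z']) auto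
      then show ?thesis using that unfolding cart_prod_def by blast
    qed
    show "card {x \<in> {..<n}. cl x = i} = m" if "i < M" for i
      unfolding cl_def by (rule card_div_cell[OF that m(2,1)])
  qed (use Gxy m q \<eta>0 pseudo in auto)
  define A where "A = {x \<in> {..<n}. cl x = 0}"
  interpret renorm ?E p \<mu> "{..<n}" A
    by (intro renorm.intro mod renorm_axioms.intro) (auto simp: A_def)
  have eq: "two_layer.linked z z' {..<n} cl = (\<lambda>S. opn S z z')" if z: "z' = z + (1, 0) \<or> z' = z + (0, 1)" for z z'
    unfolding two_layer.linked_def[OF tl[OF z]] two_layer.cells_def[OF tl[OF z]] opn_def by (intro ext) (simp add: A_def)
  have "1 - 1 / 16384 \<le> pr (\<lambda>S. opn S z z')" if z: "z' = z + (1, 0) \<or> z' = z + (0, 1)" for z z'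
    using linked[OF tl[OF z] p order_refl m(3)] unfolding eq[OF z] .
  then show ?thesis by (intro renorm_percolates) auto
qed

lemma weakly_pseudorandomD:
  assumes "weakly_pseudorandom q G" "0 < c"
  shows "eventually (\<lambda>n. \<forall>U\<subseteq>{..<n}. \<bar>real (card {e \<in> G n. e \<subseteq> U}) - q n * (real (card U))\<^sup>2 / 2\<bar> \<le> c * \<bar>q n * (real n)\<^sup>2\<bar>) sequentially"
proof -
  let ?f = "\<lambda>n U. \<bar>real (card {e \<in> G n. e \<subseteq> U}) - q n * real (card U) ^ 2 / 2\<bar>"
  have "eventually (\<lambda>n. norm (Max (?f n ` Pow {..<n})) \<le> c * norm (q n * real n ^ 2)) sequentially"
    using landau_o.smallD[OF assms(1)[unfolded weakly_pseudorandom_def] assms(2)] .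
  then show ?thesis
  proof (rule eventually_mono, intro allI impI)
    fix n and U :: "nat set"
    assume n: "norm (Max (?f n ` Pow {..<n})) \<le> c * norm (q n * real n ^ 2)" and U: "U \<subseteq> {..<n}"
    have "?f n U \<le> Max (?f n ` Pow {..<n})" by (rule Max_ge) (use U in auto)
    then show "?f n U \<le> c * \<bar>q n * (real n)\<^sup>2\<bar>" using n unfolding real_norm_def by linarith
  qed
qed

theorem theorem11:
  fixes q :: "nat \<Rightarrow> real" and G :: "nat \<Rightarrow> nat set set"
  assumes "(\<lambda>n. ln (real n)) \<in> o(\<lambda>n. real n * q n)"
    and "\<And>n. graph_on n (G n)"
    and "weakly_pseudorandom q G"
  shows "(\<lambda>n. p1c (cart_prod UNIV Z2_edges {..<n} (G n))) \<longlonglongrightarrow> 4 - 2 * sqrt 3"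
proof (rule LIMSEQ_I)
  fix e :: real assume e: "0 < e"
  define \<nu> where "\<nu> = min (1 / 100) (e / 8)"
  have \<nu>: "0 < \<nu>" "\<nu> \<le> 1 / 100" "4 * \<nu> < e" using e unfolding \<nu>_def by auto
  define p where "p = 4 - 2 * sqrt 3 + 4 * \<nu>"
  have p0: "0 \<le> p" using sqrt3_bounds \<nu> unfolding p_def by simp
  have eps: "0 < (1 / 16384 :: real)" by simp
  obtain M \<eta>0 \<kappa> where M: "0 < M" and \<eta>0: "0 < \<eta>0" and \<kappa>: "0 < \<kappa>"
    and linked: "\<And>E p \<mu> (u :: int \<times> int) v V G cl m q \<eta>.
      two_layer E p \<mu> u v V G cl M m q \<eta> \<Longrightarrow> 4 - 2 * sqrt 3 + 4 * \<nu> \<le> p \<Longrightarrow> \<eta> \<le> \<eta>0 \<Longrightarrow> \<kappa> \<le> q * m \<Longrightarrow>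
      1 - 1 / 16384 \<le> model.pr E \<mu> (two_layer.linked u v V cl)"
    using two_layer_linked[OF \<nu>(1,2) eps, where 'a = "int \<times> int"] by metis
  \<comment> \<open>Since \<open>n \<le> 2 * M * m\<close>, an error \<open>c * q * n^2\<close> is
    at most \<open>\<eta>0 * q * m^2\<close>.\<close>
  define c where "c = \<eta>0 / (4 * (real M)\<^sup>2)"
  have c: "0 < c" unfolding c_def using \<eta>0 M by simp
  have ev1: "eventually (\<lambda>n. \<bar>ln (real n)\<bar> \<le> \<bar>real n * q n\<bar>) sequentially"
    using landau_o.smallD[OF assms(1), of 1] by simp
  have "filterlim (\<lambda>n. ln (real n)) at_top sequentially"
    by (rule filterlim_compose[OF ln_at_top filterlim_real_sequentially])
  \<comment> \<open>\<open>2 * M * \<kappa> \<le> n * q n\<close> becomes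
    \<open>\<kappa> \<le> q n * m\<close> because \<open>n \<le> 2 * M * m\<close>; the added 1
    keeps \<open>ln\<close> positive, which excludes \<open>q n = 0\<close>.\<close>
  then have ev2: "eventually (\<lambda>n. 2 * M * \<kappa> + 1 \<le> ln (real n)) sequentially"
    by (simp add: filterlim_at_top)
  \<comment> \<open>This excludes negative \<open>q n\<close>: on the whole vertex set the deviation
    would be at least \<open>\<bar>q n\<bar> * n^2 / 2\<close>, an edge count being
    nonnegative.\<close>
  have ev3: "eventually (\<lambda>n. \<forall>U\<subseteq>{..<n}. \<bar>real (card {e \<in> G n. e \<subseteq> U}) - q n * (real (card U))\<^sup>2 / 2\<bar> \<le> 1 / 4 * \<bar>q n * (real n)\<^sup>2\<bar>) sequentially"
    by (rule weakly_pseudorandomD[OF assms(3)]) simp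
  note ev4 = weakly_pseudorandomD[OF assms(3) c]
  have "eventually (\<lambda>n. norm (p1c (cart_prod UNIV Z2_edges {..<n} (G n)) - (4 - 2 * sqrt 3)) < e) sequentially"
    using ev1 ev2 ev3 ev4 eventually_ge_at_top[of M]
  proof eventually_elim
    case (elim n)
    have Mk: "0 \<le> 2 * M * \<kappa>" using M \<kappa> by simp
    have n0: "0 < real n" using elim(5) M by simp
    have q0: "q n \<noteq> 0"
    proof
      assume "q n = 0"
      then have "\<bar>ln (real n)\<bar> \<le> 0" using elim(1) by simp
      then show False using elim(2) Mk by linarith
    qed
    have q: "0 < q n"
    proof (rule ccontr)
      assume "\<not> 0 < q n"
      then have qn: "q n < 0" using q0 by simp
      have "\<bar>real (card {e \<in> G n. e \<subseteq> {..<n}}) - q n * (real n)\<^sup>2 / 2\<bar> \<le> 1 / 4 * \<bar>q n * (real n)\<^sup>2\<bar>"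
        using elim(3)[rule_format, of "{..<n}"] by simp
      moreover have "q n * (real n)\<^sup>2 < 0" using qn n0 by (simp add: mult_neg_pos)
      ultimately show False by simp
    qed
    define m where "m = n div M"
    have m: "0 < m" "M * m \<le> n" unfolding m_def using elim(5) M by (simp_all add: div_greater_zero_iff)
    have "n < M * m + M" unfolding m_def using M by (metis dividend_less_times_div mult.commute add.commute mult_Suc_right)
    also have "\<dots> \<le> M * m + M * m" using m(1) by simp
    finally have n2: "real n \<le> 2 * M * m" by (metis less_imp_le mult_2 of_nat_le_iff of_nat_mult of_nat_numeral mult.assoc)
    have "2 * M * \<kappa> \<le> real n * q n" using elim(1,2) q n0 by (simp add: abs_mult)
    also have "\<dots> \<le> (2 * M * m) * q n" using n2 q by (intro mult_right_mono) auto
    finally have "2 * M * \<kappa> \<le> 2 * M * (q n * m)" by (simp add: ac_simps)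
    then have k: "\<kappa> \<le> q n * m" using M by simp
    have cb: "c * \<bar>q n * (real n)\<^sup>2\<bar> \<le> \<eta>0 * q n * (real m)\<^sup>2"
    proof -
      have "c * \<bar>q n * (real n)\<^sup>2\<bar> = c * q n * (real n)\<^sup>2" using q by (simp add: abs_mult)
      also have "\<dots> \<le> c * q n * (2 * M * m)\<^sup>2" using n2 q c by (intro mult_left_mono power_mono) auto
      also have "\<dots> = \<eta>0 * q n * (real m)\<^sup>2" unfolding c_def using M by (simp add: power_mult_distrib)
      finally show ?thesis .
    qed
    let ?E = "cart_prod UNIV Z2_edges {..<n} (G n)"
    let ?P = "{p. 0 \<le> p \<and> (\<forall>\<mu>\<in>models_ge ?E p. percolates \<mu>)}"
    have "percolates \<mu>" if "\<mu> \<in> models_ge ?E p" for \<mu>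
    proof (rule percolates_above[where M = M and \<nu> = \<nu> and \<kappa> = \<kappa> and q = "q n" and m = m and n = n
          and G = "G n" and p = p, OF _ assms(2) q \<eta>0 m k _ _ that])
      fix E p \<mu> and u v :: "int \<times> int" and V G cl m q \<eta>
      assume "two_layer E p \<mu> u v V G cl M m q \<eta>" "4 - 2 * sqrt 3 + 4 * \<nu> \<le> p" "\<eta> \<le> \<eta>0" "\<kappa> \<le> q * real m"
      then show "1 - 1 / 16384 \<le> model.pr E \<mu> (two_layer.linked u v V cl)" by (rule linked)
    next
      show "4 - 2 * sqrt 3 + 4 * \<nu> \<le> p" by (simp add: p_def)
      show "\<bar>real (card {e \<in> G n. e \<subseteq> U}) - q n * (real (card U))\<^sup>2 / 2\<bar> \<le> \<eta>0 * q n * (real m)\<^sup>2" if "U \<subseteq> {..<n}" for U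
        using elim(4) that cb by (meson order_trans)
    qed
    then have pP: "p \<in> ?P" using p0 by blast
    have "Inf ?P \<le> p" by (rule cInf_lower[OF pP]) (auto intro: bdd_belowI[of _ 0])
    moreover have "4 - 2 * sqrt 3 \<le> Inf ?P"
      by (rule cInf_greatest) (use pP p1c_lower[OF assms(2)] in auto)
    ultimately show ?case unfolding p1c_def p_def using \<nu>(3) by simp
  qed
  then show "\<exists>no. \<forall>n\<ge>no. norm (p1c (cart_prod UNIV Z2_edges {..<n} (G n)) - (4 - 2 * sqrt 3)) < e"
    unfolding eventually_sequentially .
qed

end
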